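(* Let $p>2$, let $K\ge1$, and let $\Omega\subset\mathbb C$ be a $K$-quasidisc. Then $$\lambda_p^{(1)}(\Omega)\ \ge\ \frac{M_p(K)}{|\Omega|^{p/2}}\ =\ \frac{M_p^{\ast}(K)}{R_\ast^{\,p}},$$ where $R_\ast$ is the radius of a disc of the same area as $\Omega$, $M_p^\ast(K)=M_p(K)\,\pi^{-p/2}$, and $M_p(K)$, which depends only on $p$ and $K$, is $$M_p(K)=\frac{4\pi^{1+\frac p2}}{K^2}\exp\left\{-\frac{K^2\pi^2(2+\pi^2)^2}{2\log 3}\right\}\ \sup_{\alpha\in(1,\alpha^* )}\ \sup_{q\in(q^*,2]}\left\{A_{\frac{p\alpha}{\alpha-1},q}^{-p}(\mathbb D)\,\pi^{-\frac pq-\frac1\alpha}\,C_\alpha^{-2}\right\}.$$ Here $q^*=\dfrac{2\alpha p}{\alpha p+2(\alpha-1)}$, $$C_\alpha=\frac{10^6}{[(2\alpha-1)(1-\nu(\alpha))]^{1/(2\alpha)}},\qquad \nu(\alpha)=10^{8\alpha}\,\frac{2\alpha-2}{2\alpha-1}\,(24\pi^2K^2)^{2\alpha},$$ and $\alpha^*=\min\left(\frac{K^2}{K^2-1},\widetilde\alpha\right)$, where $\widetilde\alpha>1$ is the unique solution of $\nu(\alpha)=1$ (with $\frac{K^2}{K^2-1}=+\infty$ if $K=1$).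
   Context: $\mathbb D$ is the open unit disc in $\mathbb C$ and $|\Omega|$ is the Lebesgue measure of $\Omega$. A homeomorphism $\psi:\widetilde\Omega\to\Omega$ between planar domains is $K$-quasiconformal, $1\le K<\infty$, if $\psi\in W^{1,2}_{\mathrm{loc}}(\widetilde\Omega)$ and $|D\psi(z)|^2\le K|J(z,\psi)|$ for almost all $z\in\widetilde\Omega$ ($|D\psi|$ is the operator norm of the Jacobi matrix and $J$ its determinant). A domain $\Omega$ is a $K$-quasidisc if it is the image of $\mathbb D$ under a $K$-quasiconformal homeomorphism of the plane $\mathbb C$ onto itself. $W^{1,p}_0(\Omega)$ is the closure of $C_0^\infty(\Omega)$ in the norm $\|f\|_{L^p(\Omega)}+\|\nabla f\|_{L^p(\Omega)}$. The first Dirichlet eigenvalue of the $p$-Laplace operator is $$\lambda_p^{(1)}(\Omega)=\inf_{f\in W^{1,p}_0(\Omega)\setminus\{0\}}\frac{\iint_\Omega|\nabla f|^p\,dx\,dy}{\iint_\Omega|f|^p\,dx\,dy}.$$ $A_{r,q}(\mathbb D)$ denotes the best (smallest) constant $C$ in the $(r,q)$-Sobolev--Poincaré inequality $\|f\|_{L^r(\mathbb D)}\le C\,\|\nabla f\|_{L^q(\mathbb D)}$ for all $f\in W^{1,q}_0(\mathbb D)$. *)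

theory Defs
  imports "HOL-Analysis.Analysis"
begin

text \<open>The plane is the type \<^typ>\<open>complex\<close> with its Euclidean structure
  (\<open>Basis = {1, \<i>}\<close>).  A function on a domain \<open>\<Omega>\<close> is a total function of which only the
  values on \<open>\<Omega>\<close> matter; functions that agree almost everywhere on \<open>\<Omega>\<close> are not identified,
  so \<open>f \<noteq> 0\<close> has to be read as: \<open>f\<close> does not vanish almost everywhere on \<open>\<Omega>\<close>.\<close>

definition planar_domain :: "complex set \<Rightarrow> bool" where
  "planar_domain \<Omega> \<longleftrightarrow> open \<Omega> \<and> connected \<Omega> \<and> \<Omega> \<noteq> {}"

primrec C_k :: "nat \<Rightarrow> (complex \<Rightarrow> real) \<Rightarrow> bool" where
  "C_k 0 f \<longleftrightarrow> continuous_on UNIV f"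
| "C_k (Suc k) f \<longleftrightarrow> (\<forall>x. f differentiable (at x)) \<and>
     (\<forall>v. C_k k (\<lambda>x. frechet_derivative f (at x) v))"

text \<open>Elements of $C_0^\infty(\Omega)$, extended by zero to the whole plane.\<close>

definition test_functions :: "complex set \<Rightarrow> (complex \<Rightarrow> real) set" where
  "test_functions \<Omega> = {\<phi>. (\<forall>k. C_k k \<phi>) \<and>
     compact (closure {x. \<phi> x \<noteq> 0}) \<and> closure {x. \<phi> x \<noteq> 0} \<subseteq> \<Omega>}"

definition Lp_space :: "real \<Rightarrow> complex set \<Rightarrow> (complex \<Rightarrow> 'b::euclidean_space) set" where
  "Lp_space p \<Omega> = {f. set_borel_measurable lebesgue \<Omega> f \<and>
     set_integrable lebesgue \<Omega> (\<lambda>x. norm (f x) powr p)}"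

definition Lp_norm :: "real \<Rightarrow> complex set \<Rightarrow> (complex \<Rightarrow> 'b::euclidean_space) \<Rightarrow> real" where
  "Lp_norm p \<Omega> f = (LINT x:\<Omega>|lebesgue. norm (f x) powr p) powr (1 / p)"

definition Lp_loc :: "real \<Rightarrow> complex set \<Rightarrow> (complex \<Rightarrow> 'b::euclidean_space) set" where
  "Lp_loc p \<Omega> = {f. \<forall>C. compact C \<and> C \<subseteq> \<Omega> \<longrightarrow> f \<in> Lp_space p C}"

definition has_weak_partial ::
    "complex set \<Rightarrow> complex \<Rightarrow> (complex \<Rightarrow> 'b::euclidean_space) \<Rightarrow> (complex \<Rightarrow> 'b) \<Rightarrow> bool" where
  "has_weak_partial \<Omega> e f g \<longleftrightarrow> f \<in> Lp_loc 1 \<Omega> \<and> g \<in> Lp_loc 1 \<Omega> \<and>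
     (\<forall>\<phi>\<in>test_functions \<Omega>.
        (LINT x:\<Omega>|lebesgue. frechet_derivative \<phi> (at x) e *\<^sub>R f x) =
        - (LINT x:\<Omega>|lebesgue. \<phi> x *\<^sub>R g x))"

definition has_weak_gradient ::
    "complex set \<Rightarrow> (complex \<Rightarrow> real) \<Rightarrow> (complex \<Rightarrow> complex) \<Rightarrow> bool" where
  "has_weak_gradient \<Omega> f g \<longleftrightarrow>
     has_weak_partial \<Omega> 1 f (\<lambda>x. Re (g x)) \<and> has_weak_partial \<Omega> \<i> f (\<lambda>x. Im (g x))"

text \<open>A weak gradient is unique only up to null sets; all uses below are insensitive to the
  representative that is chosen here.\<close>

definition weak_gradient :: "complex set \<Rightarrow> (complex \<Rightarrow> real) \<Rightarrow> complex \<Rightarrow> complex" where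
  "weak_gradient \<Omega> f = (SOME g. has_weak_gradient \<Omega> f g)"

definition W1p :: "real \<Rightarrow> complex set \<Rightarrow> (complex \<Rightarrow> real) set" where
  "W1p p \<Omega> = {f \<in> Lp_space p \<Omega>. (\<exists>g. has_weak_gradient \<Omega> f g) \<and>
     weak_gradient \<Omega> f \<in> Lp_space p \<Omega>}"

definition W1p_norm :: "real \<Rightarrow> complex set \<Rightarrow> (complex \<Rightarrow> real) \<Rightarrow> real" where
  "W1p_norm p \<Omega> f = Lp_norm p \<Omega> f + Lp_norm p \<Omega> (weak_gradient \<Omega> f)"

definition W1p_0 :: "real \<Rightarrow> complex set \<Rightarrow> (complex \<Rightarrow> real) set" where
  "W1p_0 p \<Omega> = {f \<in> W1p p \<Omega>.
     \<forall>\<epsilon>>0. \<exists>\<phi>\<in>test_functions \<Omega>. W1p_norm p \<Omega> (\<lambda>x. f x - \<phi> x) < \<epsilon>}"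

definition lambda_p :: "real \<Rightarrow> complex set \<Rightarrow> real" where
  "lambda_p p \<Omega> =
     (INF f\<in>{f \<in> W1p_0 p \<Omega>. \<not> (AE x in lebesgue. x \<in> \<Omega> \<longrightarrow> f x = 0)}.
        (LINT x:\<Omega>|lebesgue. norm (weak_gradient \<Omega> f x) powr p) /
        (LINT x:\<Omega>|lebesgue. \<bar>f x\<bar> powr p))"

text \<open>The membership in \<open>Lp_space r \<Omega>\<close> says that the left-hand side of the inequality is finite;
  without it \<^const>\<open>Lp_norm\<close> would be \<open>0\<close> for a non-integrable function.  The infimum is
  meaningful for those \<open>r\<close>, \<open>q\<close> for which some constant exists, in particular for the disc with
  \<open>1 \<le> q < 2\<close>, \<open>1 \<le> r \<le> 2 q / (2 - q)\<close>, or \<open>q = 2\<close>, \<open>1 \<le> r < \<infinity>\<close>.\<close>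

definition sobolev_poincare_const :: "real \<Rightarrow> real \<Rightarrow> complex set \<Rightarrow> real" where
  "sobolev_poincare_const r q \<Omega> =
     Inf {C. 0 \<le> C \<and> (\<forall>f\<in>W1p_0 q \<Omega>. f \<in> Lp_space r \<Omega> \<and>
              Lp_norm r \<Omega> f \<le> C * Lp_norm q \<Omega> (weak_gradient \<Omega> f))}"

text \<open>\<open>\<psi>\<^sub>x\<close> and \<open>\<psi>\<^sub>y\<close> are the columns of the Jacobi matrix of \<open>\<psi>\<close>.\<close>

definition quasiconformal ::
    "real \<Rightarrow> complex set \<Rightarrow> complex set \<Rightarrow> (complex \<Rightarrow> complex) \<Rightarrow> bool" where
  "quasiconformal K S T \<psi> \<longleftrightarrow> 1 \<le> K \<and> planar_domain S \<and> planar_domain T \<and>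
     (\<exists>\<eta>. homeomorphism S T \<psi> \<eta>) \<and> \<psi> \<in> Lp_loc 2 S \<and>
     (\<exists>\<psi>\<^sub>x \<psi>\<^sub>y. has_weak_partial S 1 \<psi> \<psi>\<^sub>x \<and> has_weak_partial S \<i> \<psi> \<psi>\<^sub>y \<and>
        \<psi>\<^sub>x \<in> Lp_loc 2 S \<and> \<psi>\<^sub>y \<in> Lp_loc 2 S \<and>
        (AE z in lebesgue. z \<in> S \<longrightarrow>
           (onorm (\<lambda>h. Re h *\<^sub>R \<psi>\<^sub>x z + Im h *\<^sub>R \<psi>\<^sub>y z))\<^sup>2
             \<le> K * \<bar>Re (\<psi>\<^sub>x z) * Im (\<psi>\<^sub>y z) - Re (\<psi>\<^sub>y z) * Im (\<psi>\<^sub>x z)\<bar>))"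

definition quasidisc :: "real \<Rightarrow> complex set \<Rightarrow> bool" where
  "quasidisc K \<Omega> \<longleftrightarrow> (\<exists>\<psi>. quasiconformal K UNIV UNIV \<psi> \<and> \<Omega> = \<psi> ` ball 0 1)"

definition area :: "complex set \<Rightarrow> real" where
  "area \<Omega> = measure lebesgue \<Omega>"

definition R_star :: "complex set \<Rightarrow> real" where
  "R_star \<Omega> = (THE R. 0 < R \<and> area (ball 0 R) = area \<Omega>)"

definition nu :: "real \<Rightarrow> real \<Rightarrow> real" where
  "nu K \<alpha> = 10 powr (8 * \<alpha>) * ((2 * \<alpha> - 2) / (2 * \<alpha> - 1)) * (24 * pi\<^sup>2 * K\<^sup>2) powr (2 * \<alpha>)"

definition C_const :: "real \<Rightarrow> real \<Rightarrow> real" where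
  "C_const K \<alpha> = 10 ^ 6 / ((2 * \<alpha> - 1) * (1 - nu K \<alpha>)) powr (1 / (2 * \<alpha>))"

definition alpha_tilde :: "real \<Rightarrow> real" where
  "alpha_tilde K = (THE \<alpha>. 1 < \<alpha> \<and> nu K \<alpha> = 1)"

definition alpha_star :: "real \<Rightarrow> ereal" where
  "alpha_star K = min (if K = 1 then \<infinity> else ereal (K\<^sup>2 / (K\<^sup>2 - 1))) (ereal (alpha_tilde K))"

definition q_star :: "real \<Rightarrow> real \<Rightarrow> real" where
  "q_star p \<alpha> = 2 * \<alpha> * p / (\<alpha> * p + 2 * (\<alpha> - 1))"

text \<open>The suprema are taken in \<^typ>\<open>ereal\<close>, so that they need no a priori bound.\<close>

definition M_const :: "real \<Rightarrow> real \<Rightarrow> ereal" where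
  "M_const p K =
     ereal (4 * pi powr (1 + p / 2) / K\<^sup>2 * exp (- (K\<^sup>2 * pi\<^sup>2 * (2 + pi\<^sup>2)\<^sup>2 / (2 * ln 3)))) *
     (SUP \<alpha>\<in>{\<alpha>. 1 < \<alpha> \<and> ereal \<alpha> < alpha_star K}. SUP q\<in>{q_star p \<alpha><..2}.
        ereal (sobolev_poincare_const (p * \<alpha> / (\<alpha> - 1)) q (ball 0 1) powr (- p) *
               pi powr (- (p / q) - 1 / \<alpha>) * C_const K \<alpha> powr (- 2)))"

definition M_star_const :: "real \<Rightarrow> real \<Rightarrow> ereal" where
  "M_star_const p K = M_const p K * ereal (pi powr (- (p / 2)))"

end

theory Submission
  imports Defs
begin

text \<open>The constant \<open>M\<^sub>p(K)\<close> is so small that no quasiconformal theory is needed: a quasidisc enters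
  only as a bounded open set.

  For such a set the Gagliardo--Nirenberg inequality, applied to \<open>|\<phi>|\<^sup>s\<close>, gives
  \<open>\<integral> |\<phi>|\<^bsup>2s\<^esup> \<le> (s/2 \<integral> |\<phi>|\<^bsup>s-1\<^esup> |\<nabla>\<phi>|)\<^sup>2\<close>.  Iterating this in \<open>s\<close> yields
  \<open>\<parallel>\<phi>\<parallel>\<^sub>p \<le> 81 |\<Omega>|\<^bsup>1/2\<^esup> \<parallel>\<nabla>\<phi>\<parallel>\<^sub>p\<close> with a constant that does not depend on \<open>p > 2\<close>, so the first
  eigenvalue is at least \<open>81\<^bsup>-p\<^esup> |\<Omega>|\<^bsup>-p/2\<^esup>\<close>.

  Conversely \<open>M\<^sub>p(K) \<le> 81\<^bsup>-p\<^esup>\<close>.  The condition \<open>\<nu>(\<alpha>) < 1\<close> forces \<open>\<alpha>\<close> to be so close to \<open>1\<close> that the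
  exponent \<open>r = p\<alpha>/(\<alpha>-1)\<close> is huge, and since points have zero capacity in the plane, a logarithmic
  test function shows that the Sobolev--Poincare constants of the disc with such exponents are
  large.\<close>

section \<open>Smooth functions\<close>

text \<open>The number 81 is where two estimates meet. Because of the power \<open>- p\<close>, the
  constant in the Poincare inequality must not grow with p: the lower bound for the disc constants
  is a fixed number. One use of Gagliardo--Nirenberg gives only p/4, and this is what forces the
  iteration. It runs with the fixed gradient exponent 4 > 2, for which the accumulated constants
  stay bounded, and monotonicity of averaged norms then raises 4 to p; for p at most 4 a single step
  is enough. The remaining factors of M_p(K) only have to multiply to at most 1, which the factor
  10^(-12) inside \<open>C_const K \<alpha> powr (- 2)\<close> guarantees. The powers of pi that
  depend on p cancel exactly against the price of passing from L^2 to L^q on the unit disc. Infima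
  of real numbers give information only over nonempty sets. Hence even a lower bound for a disc
  constant needs a valid Sobolev inequality for the pair (r, q). The condition q >
  \<open>q_star p \<alpha>\<close> says exactly that r is below the critical exponent, and the same
  Gagliardo--Nirenberg step supplies the inequality.\<close>

lemma C_k_SucI:
  assumes "\<And>x. (f has_derivative f' x) (at x)" and "\<And>v. C_k k (\<lambda>x. f' x v)"
  shows "C_k (Suc k) f"
proof -
  have "frechet_derivative f (at x) = f' x" for x
    using frechet_derivative_at[OF assms(1)] by simp
  then show ?thesis
    using assms by (auto simp: differentiable_def)
qed

lemma C_k_Suc_has_derivative:
  assumes "C_k (Suc k) f"
  shows "(f has_derivative frechet_derivative f (at x)) (at x)"
  using assms by (auto simp: frechet_derivative_works)

text \<open>The product rule contains the undifferentiated factors, so the induction in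
  \<open>C_k_mult\<close> has to lower their order.\<close>

lemma C_k_Suc_imp: "C_k (Suc k) f \<Longrightarrow> C_k k f"
proof (induction k arbitrary: f)
  case 0
  then have "continuous (at x) f" for x
    using C_k_Suc_has_derivative has_derivative_continuous by blast
  then show ?case by (simp add: continuous_at_imp_continuous_on)
next
  case (Suc k)
  then show ?case by (subst C_k.simps(2)) auto
qed

lemma C_k_const [simp]: "C_k k (\<lambda>_. c)"
proof (induction k arbitrary: c)
  case (Suc k)
  show ?case by (rule C_k_SucI[where f' = "\<lambda>_ _. 0"]) (auto intro: Suc)
qed simp

lemma C_k_bounded_linear:
  assumes "bounded_linear f"
  shows "C_k k f"
proof (cases k)
  case 0
  then show ?thesis using assms by (simp add: linear_continuous_on)
next
  case (Suc m)
  have "C_k (Suc m) f"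
    by (rule C_k_SucI[where f' = "\<lambda>_. f"])
      (auto intro: bounded_linear_imp_has_derivative[OF assms])
  then show ?thesis by (simp only: Suc)
qed

lemma C_k_add: "C_k k f \<Longrightarrow> C_k k g \<Longrightarrow> C_k k (\<lambda>x. f x + g x)"
proof (induction k arbitrary: f g)
  case 0
  then show ?case by (auto intro: continuous_intros)
next
  case (Suc k)
  show ?case
    by (rule C_k_SucI[OF has_derivative_add[OF Suc.prems[THEN C_k_Suc_has_derivative]]])
      (use Suc in auto)
qed

lemma C_k_mult: "C_k k f \<Longrightarrow> C_k k g \<Longrightarrow> C_k k (\<lambda>x. f x * g x)"
proof (induction k arbitrary: f g)
  case 0
  then show ?case by (auto intro: continuous_intros)
next
  case (Suc k)
  show ?case
    by (rule C_k_SucI[OF has_derivative_mult[OF Suc.prems[THEN C_k_Suc_has_derivative]]])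
      (use Suc C_k_Suc_imp in \<open>auto intro!: C_k_add\<close>)
qed

lemma C_k_minus: "C_k k f \<Longrightarrow> C_k k (\<lambda>x. - f x)"
  using C_k_mult[of k "\<lambda>_. -1" f] by simp

lemma C_k_diff: "C_k k f \<Longrightarrow> C_k k g \<Longrightarrow> C_k k (\<lambda>x. f x - g x)"
  using C_k_add[of k f "\<lambda>x. - g x"] C_k_minus[of k g] by simp

text \<open>Differentiating \<open>d n (u x)\<close> produces \<open>d (Suc n) (u x)\<close>, so the
  whole tower of derivatives is supplied at once and the induction on k keeps n arbitrary. The set I
  admits outer functions such as \<open>ln\<close> that are smooth only on part of the line.\<close>

lemma C_k_compose:
  fixes d :: "nat \<Rightarrow> real \<Rightarrow> real"
  assumes d: "\<And>n t. t \<in> I \<Longrightarrow> (d n has_real_derivative d (Suc n) t) (at t)"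
    and u: "\<And>k. C_k k u" and I: "\<And>x. u x \<in> I"
  shows "C_k k (\<lambda>x. d n (u x))"
proof (induction k arbitrary: n)
  case 0
  have "continuous (at x) (\<lambda>x. d n (u x))" for x
  proof (rule isCont_o2[where g = "d n"])
    show "isCont u x" using u[of 0] by (simp add: continuous_on_eq_continuous_at)
    show "isCont (d n) (u x)" using d[OF I] DERIV_isCont by blast
  qed
  then show ?case by (simp add: continuous_at_imp_continuous_on)
next
  case (Suc k)
  have "((\<lambda>x. d n (u x)) has_derivative
      (\<lambda>v. d (Suc n) (u x) * frechet_derivative u (at x) v)) (at x)" for x
    using has_derivative_compose[OF C_k_Suc_has_derivative[OF u]
        d[OF I, unfolded has_field_derivative_def]] by (simp add: o_def)
  then show ?case
    by (rule C_k_SucI) (use Suc u[of "Suc k"] in \<open>auto intro!: C_k_mult\<close>)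
qed

text \<open>This class of functions is closed under differentiation, so its members are smooth.\<close>

definition flat_exp :: "real poly \<Rightarrow> real \<Rightarrow> real" where
  "flat_exp P t = (if t \<le> 0 then 0 else poly P (1 / t) * exp (- (1 / t)))"

lemma poly_exp_neg_tendsto_0: "((\<lambda>s. poly P s * exp (- s)) \<longlongrightarrow> (0::real)) at_top"
proof -
  have "((\<lambda>s. \<Sum>i\<le>degree P. coeff P i * (s ^ i / exp s)) \<longlongrightarrow> (\<Sum>i\<le>degree P. coeff P i * 0)) at_top"
    by (intro tendsto_sum tendsto_mult tendsto_const tendsto_power_div_exp_0)
  moreover have "(\<Sum>i\<le>degree P. coeff P i * (s ^ i / exp s)) = poly P s * exp (- s)" for s
    by (simp add: poly_altdef sum_distrib_right exp_minus field_simps sum_divide_distrib)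
  ultimately show ?thesis by simp
qed

lemma flat_exp_tendsto_0: "(flat_exp P \<longlongrightarrow> 0) (at 0)"
proof -
  have "((\<lambda>t. poly P (1 / t) * exp (- (1 / t))) \<longlongrightarrow> 0) (at_right (0::real))"
    using filterlim_compose[OF poly_exp_neg_tendsto_0 filterlim_inverse_at_top_right]
    by (simp add: inverse_eq_divide)
  then have "(flat_exp P \<longlongrightarrow> 0) (at_right 0)"
    by (rule Lim_transform_eventually)
      (auto simp: flat_exp_def eventually_at_filter)
  moreover have "(flat_exp P \<longlongrightarrow> 0) (at_left 0)"
    by (rule Lim_transform_eventually[OF tendsto_const])
      (auto simp: flat_exp_def eventually_at_filter)
  ultimately show ?thesis by (simp add: filterlim_split_at_real)
qed

text \<open>With s = 1/t the chain rule turns P(s) exp(-s) into s^2 (P - P')(s) exp(-s), again a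
  polynomial in s times exp(-s).\<close>

lemma flat_exp_has_derivative:
  "(flat_exp P has_real_derivative flat_exp ([:0, 0, 1:] * (P - pderiv P)) t) (at t)"
proof -
  consider "t < 0" | "t = 0" | "t > 0" by linarith
  then show ?thesis
  proof cases
    case 1
    have "(flat_exp P has_real_derivative 0) (at t)"
    proof (rule has_field_derivative_transform_within_open[of "\<lambda>_. 0" _ _ "{..<0}"])
    qed (use 1 in \<open>auto simp: flat_exp_def\<close>)
    then show ?thesis using 1 by (simp add: flat_exp_def)
  next
    case 2
    \<comment> \<open>Dividing by h multiplies the polynomial by s = 1/h, so the difference quotient
      at 0 is itself a member of the class and tends to 0.\<close>
    have eq: "flat_exp (pCons 0 P) h = (flat_exp P (0 + h) - flat_exp P 0) / h" for h
      by (auto simp: flat_exp_def)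
    show ?thesis
      using flat_exp_tendsto_0[of "pCons 0 P"] unfolding 2 DERIV_def eq by (simp add: flat_exp_def)
  next
    case 3
    have "((\<lambda>t. poly P (1 / t) * exp (- (1 / t))) has_real_derivative
        flat_exp ([:0, 0, 1:] * (P - pderiv P)) t) (at t)"
      using 3 by (auto intro!: derivative_eq_intros simp: flat_exp_def field_simps power2_eq_square)
    then show ?thesis
      by (rule has_field_derivative_transform_within_open[of _ _ _ "{0<..}"])
        (use 3 in \<open>auto simp: flat_exp_def\<close>)
  qed
qed

definition flat :: "real \<Rightarrow> real" where
  "flat t = (if t \<le> 0 then 0 else exp (- (1 / t)))"

lemma flat_eq_flat_exp: "flat = flat_exp 1"
  by (auto simp: flat_def flat_exp_def fun_eq_iff)

lemma flat_nonneg: "0 \<le> flat t" and flat_pos_iff: "0 < flat t \<longleftrightarrow> 0 < t"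
  and flat_eq_0_iff: "flat t = 0 \<longleftrightarrow> t \<le> 0"
  by (auto simp: flat_def)

lemma C_k_flat:
  assumes "\<And>k. C_k k u"
  shows "C_k k (\<lambda>x. flat (u x))"
proof -
  define d where "d n = flat_exp (((\<lambda>P. [:0, 0, 1:] * (P - pderiv P)) ^^ n) 1)" for n
  have "(d n has_real_derivative d (Suc n) t) (at t)" for n t
    using flat_exp_has_derivative by (simp add: d_def)
  then have "C_k k (\<lambda>x. d 0 (u x))"
    using C_k_compose[where I = UNIV and d = d] assms by blast
  then show ?thesis by (simp add: d_def flat_eq_flat_exp)
qed

lemma C_k_exp:
  assumes "\<And>k. C_k k u"
  shows "C_k k (\<lambda>x. exp (u x))"
  by (rule C_k_compose[where I = UNIV and d = "\<lambda>_. exp"]) (use assms in auto)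

lemma C_k_ln:
  assumes "\<And>k. C_k k u" and "\<And>x. 0 < u x"
  shows "C_k k (\<lambda>x. ln (u x))"
proof -
  \<comment> \<open>\<open>c m\<close> is (-1)^m m!, the coefficient of t^(-m-1) in the derivative
    of order m + 1 of \<open>ln\<close>.\<close>
  define c where "c n = (\<Prod>i\<in>{1..n}. - real i)" for n
  define d where "d n = (case n of 0 \<Rightarrow> ln | Suc m \<Rightarrow> (\<lambda>t. c m * t powi (- int (Suc m))))" for n
  have "(d n has_real_derivative d (Suc n) t) (at t)" if "t \<in> {0<..}" for n t
  proof (cases n)
    case 0
    then show ?thesis using that by (auto simp: d_def c_def power_int_minus inverse_eq_divide intro!: derivative_eq_intros)
  next
    case (Suc m)
    have c: "c (Suc m) = - real (Suc m) * c m"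
      by (simp add: c_def prod.nat_ivl_Suc' )
    have e: "- int (Suc m) - 1 = - int (Suc (Suc m))" by simp
    have "((\<lambda>t. c m * t powi (- int (Suc m))) has_real_derivative
        c m * (of_int (- int (Suc m)) * t powi (- int (Suc m) - 1) * 1)) (at t)"
      using that by (intro DERIV_cmult DERIV_power_int DERIV_ident) auto
    then show ?thesis unfolding d_def Suc e by (simp add: c algebra_simps)
  qed
  then have "C_k k (\<lambda>x. d 0 (u x))"
    using C_k_compose[where I = "{0<..}" and d = d] assms by auto
  then show ?thesis by (simp add: d_def)
qed

section \<open>Test functions and smooth cutoffs of boxes\<close>

lemma test_functionsI:
  assumes "\<And>k. C_k k \<phi>" and "compact K" and "K \<subseteq> \<Omega>" and "\<And>x. x \<notin> K \<Longrightarrow> \<phi> x = 0"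
  shows "\<phi> \<in> test_functions \<Omega>"
proof -
  have "closure {x. \<phi> x \<noteq> 0} \<subseteq> K"
    by (rule closure_minimal) (use assms compact_imp_closed in auto)
  then show ?thesis
    using assms compact_Int_closed[OF \<open>compact K\<close> closed_closure, of "{x. \<phi> x \<noteq> 0}"]
    by (auto simp: test_functions_def Int_absorb1)
qed

definition box_bump :: "complex \<Rightarrow> complex \<Rightarrow> complex \<Rightarrow> real" where
  "box_bump a b x = flat (Re x - Re a) * flat (Re b - Re x) * (flat (Im x - Im a) * flat (Im b - Im x))"

lemma C_k_box_bump: "C_k k (box_bump a b)"
  unfolding box_bump_def
  by (intro C_k_mult C_k_flat C_k_diff C_k_const C_k_bounded_linear
      bounded_linear_Re bounded_linear_Im)

lemma box_bump_nonneg: "0 \<le> box_bump a b x"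
  by (simp add: box_bump_def flat_nonneg)

lemma box_bump_pos_iff: "0 < box_bump a b x \<longleftrightarrow> x \<in> box a b"
proof -
  have *: "0 < s * t \<longleftrightarrow> 0 < s \<and> 0 < t" if "0 \<le> s" "0 \<le> t" for s t :: real
    using that by (auto simp: zero_less_mult_iff)
  have "0 < box_bump a b x \<longleftrightarrow> (0 < flat (Re x - Re a) \<and> 0 < flat (Re b - Re x)) \<and>
      (0 < flat (Im x - Im a) \<and> 0 < flat (Im b - Im x))"
    unfolding box_bump_def by (simp add: * flat_nonneg)
  then show ?thesis
    by (auto simp: mem_box Basis_complex_def flat_pos_iff)
qed

lemma box_bump_eq_0: "x \<notin> box a b \<Longrightarrow> box_bump a b x = 0"
  using box_bump_pos_iff box_bump_nonneg by (metis order_le_less)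

text \<open>Since \<open>box_bump\<close> is positive exactly on the open box, these functions take
  values in [0, 1] and tend pointwise to its indicator. They carry orthogonality to test functions
  over to integrals over boxes.\<close>

definition box_cutoff :: "complex \<Rightarrow> complex \<Rightarrow> nat \<Rightarrow> complex \<Rightarrow> real" where
  "box_cutoff a b n x = 1 - exp (- (real n * box_bump a b x))"

lemma box_cutoff_test_function:
  assumes "cbox a b \<subseteq> \<Omega>"
  shows "box_cutoff a b n \<in> test_functions \<Omega>"
proof (rule test_functionsI)
  show "C_k k (box_cutoff a b n)" for k
    unfolding box_cutoff_def
    by (intro C_k_diff C_k_const C_k_exp C_k_minus C_k_mult C_k_box_bump)
  show "box_cutoff a b n x = 0" if "x \<notin> cbox a b" for x
    using that box_bump_eq_0[of x a b] box_subset_cbox[of a b] by (auto simp: box_cutoff_def)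
qed (use assms in auto)

lemma box_cutoff_bounds: "0 \<le> box_cutoff a b n x" "box_cutoff a b n x \<le> 1"
  by (simp_all add: box_cutoff_def box_bump_nonneg)

lemma box_cutoff_tendsto: "(\<lambda>n. box_cutoff a b n x) \<longlonglongrightarrow> indicat_real (box a b) x"
proof (cases "x \<in> box a b")
  case True
  then have "0 < box_bump a b x" by (simp add: box_bump_pos_iff)
  then have "filterlim (\<lambda>n. real n * box_bump a b x) at_top sequentially"
    by (intro filterlim_at_top_mult_tendsto_pos[OF tendsto_const] filterlim_real_sequentially) auto
  then have "(\<lambda>n. exp (- (real n * box_bump a b x))) \<longlonglongrightarrow> 0"
    by (intro filterlim_compose[OF exp_at_bot] filterlim_compose[OF filterlim_uminus_at_bot_at_top])
  then have "(\<lambda>n. 1 - exp (- (real n * box_bump a b x))) \<longlonglongrightarrow> 1 - 0"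
    by (intro tendsto_intros)
  then show ?thesis using True by (simp add: box_cutoff_def)
next
  case False
  then show ?thesis by (simp add: box_cutoff_def box_bump_eq_0)
qed

section \<open>The Gagliardo--Nirenberg inequality in the plane\<close>

lemma measurable_Complex: "(\<lambda>(x, y). Complex x y) \<in> borel_measurable (lborel \<Otimes>\<^sub>M lborel)"
  unfolding lborel_prod
  by (simp add: case_prod_beta' Complex_eq) (intro borel_measurable_continuous_onI continuous_intros)

text \<open>Boxes determine Lebesgue measure, and the preimage of a box is a product of two
  intervals. This makes Tonelli's theorem available in the real and imaginary parts.\<close>

lemma lborel_complex_eq_distr:
  "(lborel :: complex measure) = distr (lborel \<Otimes>\<^sub>M lborel) borel (\<lambda>(x, y). Complex x y)"
proof (rule lborel_eqI)
  note measurable_Complex[measurable]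
  fix l u :: complex
  assume *: "\<And>b. b \<in> Basis \<Longrightarrow> l \<bullet> b \<le> u \<bullet> b"
  have le: "Re l \<le> Re u" "Im l \<le> Im u"
    using *[of 1] *[of \<i>] by (simp_all add: Basis_complex_def)
  have "(\<lambda>(x, y). Complex x y) -` box l u = {Re l<..<Re u} \<times> {Im l<..<Im u}"
    by (auto simp: mem_box Basis_complex_def)
  then show "emeasure (distr (lborel \<Otimes>\<^sub>M lborel) borel (\<lambda>(x, y). Complex x y)) (box l u) =
      (\<Prod>b\<in>Basis. (u - l) \<bullet> b)"
    using le
    by (simp add: emeasure_distr lborel.emeasure_pair_measure_Times Basis_complex_def
        ennreal_mult space_pair_measure)
qed simp

lemma nn_integral_complex_iterated:
  assumes [measurable]: "f \<in> borel_measurable borel"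
  shows "(\<integral>\<^sup>+z. f z \<partial>lborel) = (\<integral>\<^sup>+y. \<integral>\<^sup>+x. f (Complex x y) \<partial>lborel \<partial>lborel)"
    and "(\<integral>\<^sup>+z. f z \<partial>lborel) = (\<integral>\<^sup>+x. \<integral>\<^sup>+y. f (Complex x y) \<partial>lborel \<partial>lborel)"
proof -
  note measurable_Complex[measurable]
  have "(\<integral>\<^sup>+z. f z \<partial>lborel) = (\<integral>\<^sup>+(x, y). f (Complex x y) \<partial>(lborel \<Otimes>\<^sub>M lborel))"
    by (subst lborel_complex_eq_distr) (simp add: nn_integral_distr case_prod_beta')
  moreover have *: "(\<lambda>(x, y). f (Complex x y)) \<in> borel_measurable (lborel \<Otimes>\<^sub>M lborel)"
    using measurable_compose[OF measurable_Complex assms] by (simp add: case_prod_beta')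
  ultimately show "(\<integral>\<^sup>+z. f z \<partial>lborel) = (\<integral>\<^sup>+y. \<integral>\<^sup>+x. f (Complex x y) \<partial>lborel \<partial>lborel)"
      and "(\<integral>\<^sup>+z. f z \<partial>lborel) = (\<integral>\<^sup>+x. \<integral>\<^sup>+y. f (Complex x y) \<partial>lborel \<partial>lborel)"
    using lborel_pair.nn_integral_snd[OF *] lborel.nn_integral_fst[OF *] by simp_all
qed

text \<open>The function climbs from 0 to f(x) on the left of x and returns to 0 on the right; each
  side alone contributes at least |f(x)| of variation, whence the factor 2.\<close>

lemma two_abs_le_nn_integral_deriv:
  fixes f :: "real \<Rightarrow> real"
  assumes d: "\<And>x. (f has_real_derivative f' x) (at x)" and c: "continuous_on UNIV f'"
    and R: "\<And>x. R < \<bar>x\<bar> \<Longrightarrow> f x = 0"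
  shows "ennreal (2 * \<bar>f x\<bar>) \<le> (\<integral>\<^sup>+t. ennreal \<bar>f' t\<bar> \<partial>lborel)"
proof -
  define m where "m = max \<bar>R\<bar> \<bar>x\<bar> + 1"
  have [measurable]: "f' \<in> borel_measurable borel"
    using c by (rule borel_measurable_continuous_onI)
  have bound: "ennreal \<bar>f b - f a\<bar> \<le> (\<integral>\<^sup>+t. ennreal \<bar>f' t\<bar> * indicator {a..b} t \<partial>lborel)"
    if "a \<le> b" for a b
  proof -
    have "(\<integral>t. indicator {a..b} t *\<^sub>R f' t \<partial>lborel) = f b - f a"
      using that d c continuous_on_subset[OF c]
      by (intro integral_FTC_atLeastAtMost)
        (auto simp: has_real_derivative_iff_has_vector_derivative[symmetric]
            intro: has_field_derivative_at_within)
    moreover have "integrable lborel (\<lambda>t. indicator {a..b} t *\<^sub>R f' t)"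
      by (intro borel_integrable_compact continuous_on_subset[OF c]) auto
    ultimately have "ennreal (norm (f b - f a)) \<le>
        (\<integral>\<^sup>+t. ennreal (norm (indicator {a..b} t *\<^sub>R f' t)) \<partial>lborel)"
      using integral_norm_bound_ennreal[of lborel "\<lambda>t. indicator {a..b} t *\<^sub>R f' t"] by simp
    also have "\<dots> = (\<integral>\<^sup>+t. ennreal \<bar>f' t\<bar> * indicator {a..b} t \<partial>lborel)"
      by (intro nn_integral_cong) (auto simp: indicator_def)
    finally show ?thesis by simp
  qed
  have "f (- m) = 0" "f m = 0" "- m \<le> x" "x \<le> m"
    using R[of m] R[of "- m"] by (auto simp: m_def)
  then have "ennreal (2 * \<bar>f x\<bar>) = ennreal \<bar>f x - f (- m)\<bar> + ennreal \<bar>f m - f x\<bar>"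
    by (simp add: ennreal_plus[symmetric] del: ennreal_plus)
  also have "\<dots> \<le> (\<integral>\<^sup>+t. ennreal \<bar>f' t\<bar> * indicator {-m..x} t \<partial>lborel) +
      (\<integral>\<^sup>+t. ennreal \<bar>f' t\<bar> * indicator {x..m} t \<partial>lborel)"
    using bound \<open>- m \<le> x\<close> \<open>x \<le> m\<close> by (intro add_mono) auto
  also have "\<dots> = (\<integral>\<^sup>+t. ennreal \<bar>f' t\<bar> * indicator {-m..x} t + ennreal \<bar>f' t\<bar> * indicator {x..m} t \<partial>lborel)"
    by (rule nn_integral_add[symmetric]) auto
  also have "\<dots> \<le> (\<integral>\<^sup>+t. ennreal \<bar>f' t\<bar> \<partial>lborel)"
  proof (rule nn_integral_mono_AE)
    show "AE t in lborel. ennreal \<bar>f' t\<bar> * indicator {-m..x} t + ennreal \<bar>f' t\<bar> * indicator {x..m} t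
        \<le> ennreal \<bar>f' t\<bar>"
      \<comment> \<open>The two intervals overlap only in the point x.\<close>
      using AE_lborel_singleton[of x] by eventually_elim (auto simp: indicator_def)
  qed
  finally show ?thesis .
qed

lemma has_real_derivative_along_curve:
  fixes w :: "'a::real_normed_vector \<Rightarrow> real"
  assumes "(g has_derivative (\<lambda>h. h *\<^sub>R v)) (at t)" and "(w has_derivative w') (at (g t))"
  shows "((\<lambda>t. w (g t)) has_real_derivative w' v) (at t)"
proof -
  have "w' (h *\<^sub>R v) = w' v * h" for h
    using linear_cmul[OF has_derivative_linear[OF assms(2)], of h v] by simp
  then have "(\<lambda>h. w' (h *\<^sub>R v)) = (*) (w' v)" by (simp add: fun_eq_iff)
  then show ?thesis
    using has_derivative_compose[OF assms] by (simp add: has_field_derivative_def)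
qed

text \<open>At (x, y) the number 2|w| is bounded by the integral A(y) of |w_x| over the horizontal
  line and by the integral B(x) of |w_y| over the vertical one. The product A(y) B(x) separates the
  variables, so its plane integral factorises.\<close>

lemma gagliardo_nirenberg:
  fixes w :: "complex \<Rightarrow> real"
  assumes d: "\<And>z. (w has_derivative w' z) (at z)"
    and c: "continuous_on UNIV (\<lambda>z. w' z 1)" "continuous_on UNIV (\<lambda>z. w' z \<i>)"
    and R: "\<And>z. R < norm z \<Longrightarrow> w z = 0"
  shows "(\<integral>\<^sup>+z. ennreal ((2 * w z)\<^sup>2) \<partial>lborel) \<le>
    (\<integral>\<^sup>+z. ennreal \<bar>w' z 1\<bar> \<partial>lborel) * (\<integral>\<^sup>+z. ennreal \<bar>w' z \<i>\<bar> \<partial>lborel)"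
proof -
  define A where "A y = (\<integral>\<^sup>+x. ennreal \<bar>w' (Complex x y) 1\<bar> \<partial>lborel)" for y
  define B where "B x = (\<integral>\<^sup>+y. ennreal \<bar>w' (Complex x y) \<i>\<bar> \<partial>lborel)" for x
  have "continuous_on UNIV w"
    using d has_derivative_continuous continuous_at_imp_continuous_on by blast
  then have [measurable]: "w \<in> borel_measurable borel"
    by (rule borel_measurable_continuous_onI)
  have [measurable]: "(\<lambda>z. w' z 1) \<in> borel_measurable borel" "(\<lambda>z. w' z \<i>) \<in> borel_measurable borel"
    using c by (auto intro: borel_measurable_continuous_onI)
  note measurable_Complex[measurable]
  have m: "(\<lambda>(x, y). g (Complex x y)) \<in> borel_measurable (lborel \<Otimes>\<^sub>M lborel)"
    if "g \<in> borel_measurable borel" for g :: "complex \<Rightarrow> real"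
    using measurable_compose[OF measurable_Complex that] by (simp add: case_prod_beta')
  have sw: "(\<lambda>(x, y). g (Complex y x)) \<in> borel_measurable (lborel \<Otimes>\<^sub>M lborel)"
    if "g \<in> borel_measurable borel" for g :: "complex \<Rightarrow> real"
    using measurable_pair_swap[OF m[OF that]] by (simp add: case_prod_beta')
  have [measurable]: "A \<in> borel_measurable borel" "B \<in> borel_measurable borel"
    using m[of "\<lambda>z. w' z \<i>"] sw[of "\<lambda>z. w' z 1"]
    unfolding A_def[abs_def] B_def[abs_def] by simp_all
  have Complex_line: "((\<lambda>t. Complex t y) has_derivative (\<lambda>h. h *\<^sub>R 1)) (at x)"
      "((\<lambda>t. Complex x t) has_derivative (\<lambda>h. h *\<^sub>R \<i>)) (at y)" for x y
    unfolding Complex_eq by (auto intro!: derivative_eq_intros simp: scaleR_conv_of_real)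
  have cont_line: "continuous_on UNIV (\<lambda>t. Complex t y)" "continuous_on UNIV (\<lambda>t. Complex x t)" for x y
    unfolding Complex_eq by (intro continuous_intros)+
  have large: "\<bar>Re z\<bar> \<le> norm z" "\<bar>Im z\<bar> \<le> norm z" for z
    by (rule abs_Re_le_cmod abs_Im_le_cmod)+
  have hor: "ennreal (2 * \<bar>w (Complex x y)\<bar>) \<le> A y" for x y
    unfolding A_def
  proof (rule two_abs_le_nn_integral_deriv[where f = "\<lambda>t. w (Complex t y)" and R = R])
    show "((\<lambda>t. w (Complex t y)) has_real_derivative w' (Complex x y) 1) (at x)" for x
      by (rule has_real_derivative_along_curve[OF Complex_line(1) d])
    show "continuous_on UNIV (\<lambda>x. w' (Complex x y) 1)"
      by (rule continuous_on_compose2[OF c(1) cont_line(1)]) auto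
    show "w (Complex x y) = 0" if "R < \<bar>x\<bar>" for x
      using that large(1)[of "Complex x y"] by (intro R) simp
  qed
  have ver: "ennreal (2 * \<bar>w (Complex x y)\<bar>) \<le> B x" for x y
    unfolding B_def
  proof (rule two_abs_le_nn_integral_deriv[where f = "\<lambda>t. w (Complex x t)" and R = R])
    show "((\<lambda>t. w (Complex x t)) has_real_derivative w' (Complex x y) \<i>) (at y)" for y
      by (rule has_real_derivative_along_curve[OF Complex_line(2) d])
    show "continuous_on UNIV (\<lambda>y. w' (Complex x y) \<i>)"
      by (rule continuous_on_compose2[OF c(2) cont_line(2)]) auto
    show "w (Complex x y) = 0" if "R < \<bar>y\<bar>" for y
      using that large(2)[of "Complex x y"] by (intro R) simp
  qed
  have "(\<integral>\<^sup>+z. ennreal ((2 * w z)\<^sup>2) \<partial>lborel) =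
      (\<integral>\<^sup>+y. \<integral>\<^sup>+x. ennreal ((2 * w (Complex x y))\<^sup>2) \<partial>lborel \<partial>lborel)"
    by (rule nn_integral_complex_iterated) measurable
  also have "\<dots> \<le> (\<integral>\<^sup>+y. \<integral>\<^sup>+x. A y * B x \<partial>lborel \<partial>lborel)"
  proof (intro nn_integral_mono)
    fix x y
    have "ennreal ((2 * w (Complex x y))\<^sup>2) =
        ennreal (2 * \<bar>w (Complex x y)\<bar>) * ennreal (2 * \<bar>w (Complex x y)\<bar>)"
      by (simp add: ennreal_mult'[symmetric] power2_eq_square)
    also have "\<dots> \<le> A y * B x"
      by (intro mult_mono hor ver) auto
    finally show "ennreal ((2 * w (Complex x y))\<^sup>2) \<le> A y * B x" .
  qed
  also have "\<dots> = (\<integral>\<^sup>+y. A y \<partial>lborel) * (\<integral>\<^sup>+x. B x \<partial>lborel)"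
    by (simp add: nn_integral_cmult nn_integral_multc)
  also have "(\<integral>\<^sup>+y. A y \<partial>lborel) = (\<integral>\<^sup>+z. ennreal \<bar>w' z 1\<bar> \<partial>lborel)"
    unfolding A_def by (rule nn_integral_complex_iterated(1)[symmetric]) measurable
  also have "(\<integral>\<^sup>+x. B x \<partial>lborel) = (\<integral>\<^sup>+z. ennreal \<bar>w' z \<i>\<bar> \<partial>lborel)"
    unfolding B_def by (rule nn_integral_complex_iterated(2)[symmetric]) measurable
  finally show ?thesis .
qed

lemma derivative_eq_0_on_open:
  fixes w :: "'a::euclidean_space \<Rightarrow> real"
  assumes "(w has_derivative w') (at z)" and "open S" and "z \<in> S" and "\<And>x. x \<in> S \<Longrightarrow> w x = 0"
  shows "w' = (\<lambda>_. 0)"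
proof (rule has_derivative_unique[OF assms(1)])
  show "(w has_derivative (\<lambda>_. 0)) (at z)"
    by (rule has_derivative_transform_within_open[OF has_derivative_const[of 0] \<open>open S\<close>])
      (use assms in auto)
qed

text \<open>By translation invariance the difference quotients of \<open>w\<close> have integral zero.\<close>

lemma integral_derivative_eq_0:
  fixes w :: "'a::euclidean_space \<Rightarrow> real"
  assumes d: "\<And>z. (w has_derivative w' z) (at z)" and c: "continuous_on UNIV (\<lambda>z. w' z v)"
    and R: "\<And>z. R < norm z \<Longrightarrow> w z = 0"
  shows "(\<integral>z. w' z v \<partial>lborel) = 0"
proof -
  define h where "h n = 1 / real (Suc n)" for n
  define s where "s n z = (w (z + h n *\<^sub>R v) - w z) / h n" for n z
  have h: "0 < h n" "h n \<le> 1" for n by (auto simp: h_def)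
  have cw: "continuous_on UNIV w"
    using d has_derivative_continuous continuous_at_imp_continuous_on by blast
  have "\<exists>B\<ge>0. \<forall>z. \<bar>w' z v\<bar> \<le> B"
  proof -
    have "bounded ((\<lambda>z. w' z v) ` cball 0 R)"
      by (intro compact_imp_bounded compact_continuous_image continuous_on_subset[OF c]) auto
    then obtain B where "\<forall>z\<in>cball 0 R. \<bar>w' z v\<bar> \<le> B"
      unfolding bounded_iff by auto
    then have B: "\<bar>w' z v\<bar> \<le> B" if "z \<in> cball 0 R" for z using that by blast
    have "\<bar>w' z v\<bar> \<le> max B 0" for z
    proof (cases "R < norm z")
      case True
      have "open {z::'a. R < norm z}"
        by (intro open_Collect_less continuous_intros)
      from derivative_eq_0_on_open[OF d this] True R have "w' z = (\<lambda>_. 0)" by auto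
      then show ?thesis by simp
    qed (use B[of z] in auto)
    then show ?thesis by (intro exI[of _ "max B 0"]) auto
  qed
  then obtain B where B: "0 \<le> B" "\<And>z. \<bar>w' z v\<bar> \<le> B" by blast
  \<comment> \<open>The mean value theorem turns the bound B for the derivative into one constant
    for all difference quotients. As h n is at most 1, their supports also stay in a common ball,
    which gives the integrable majorant.\<close>
  have s_bound: "\<bar>s n z\<bar> \<le> B" for n z
  proof -
    have "((\<lambda>t. w (z + t *\<^sub>R v)) has_real_derivative w' (z + t *\<^sub>R v) v) (at t)" for t
    proof -
      have "((\<lambda>t. z + t *\<^sub>R v) has_derivative (\<lambda>h. h *\<^sub>R v)) (at t)"
        by (auto intro!: derivative_eq_intros)
      from has_real_derivative_along_curve[OF this d] show ?thesis .
    qed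
    from MVT2[OF h(1)[of n], of "\<lambda>t. w (z + t *\<^sub>R v)" "\<lambda>t. w' (z + t *\<^sub>R v) v", OF this]
    obtain t where "w (z + h n *\<^sub>R v) - w (z + 0 *\<^sub>R v) = (h n - 0) * w' (z + t *\<^sub>R v) v"
      by auto
    then have "s n z = w' (z + t *\<^sub>R v) v"
      using h(1)[of n] by (simp add: s_def field_simps)
    then show ?thesis using B by simp
  qed
  have s_support: "s n z = 0" if "R + norm v < norm z" for n z
  proof -
    have "norm z \<le> norm (z + h n *\<^sub>R v) + norm (h n *\<^sub>R v)"
      using norm_triangle_ineq4[of "z + h n *\<^sub>R v" "h n *\<^sub>R v"] by simp
    moreover have "norm (h n *\<^sub>R v) \<le> norm v"
      using h[of n] by (simp add: mult_left_le_one_le)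
    ultimately have "R < norm (z + h n *\<^sub>R v)" using that by linarith
    moreover have "R < norm z" using that norm_ge_zero[of v] by linarith
    ultimately show ?thesis by (simp add: s_def R)
  qed
  have tends: "(\<lambda>n. s n z) \<longlonglongrightarrow> w' z v" for z
  proof -
    have "((\<lambda>t. z + t *\<^sub>R v) has_derivative (\<lambda>h. h *\<^sub>R v)) (at 0)"
      by (auto intro!: derivative_eq_intros)
    from has_real_derivative_along_curve[OF this, of w "w' z"] d[of z]
    have "((\<lambda>t. w (z + t *\<^sub>R v)) has_real_derivative w' z v) (at 0)"
      by simp
    then have "((\<lambda>t. (w (z + t *\<^sub>R v) - w z) / t) \<longlongrightarrow> w' z v) (at 0)"
      by (simp add: DERIV_def)
    moreover have "filterlim h (at 0) sequentially"
      using LIMSEQ_inverse_real_of_nat by (simp add: filterlim_at h_def[abs_def] inverse_eq_divide)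
    ultimately show ?thesis unfolding s_def by (rule filterlim_compose)
  qed
  have [measurable]: "w \<in> borel_measurable borel" "(\<lambda>z. w' z v) \<in> borel_measurable borel"
    using cw c by (auto intro: borel_measurable_continuous_onI)
  have iw: "integrable lborel w"
  proof -
    have "integrable lborel (\<lambda>x. indicator (cball 0 R) x *\<^sub>R w x)"
      by (intro borel_integrable_compact continuous_on_subset[OF cw]) auto
    moreover have "(\<lambda>x. indicator (cball 0 R) x *\<^sub>R w x) = w"
      by (auto simp: indicator_def fun_eq_iff R)
    ultimately show ?thesis by simp
  qed
  have shift: "integrable lborel (\<lambda>z. w (z + c)) \<and> (\<integral>z. w (z + c) \<partial>lborel) = (\<integral>z. w z \<partial>lborel)" for c
    using iw integrable_distr_eq[of "(+) c" lborel borel w] integral_distr[of "(+) c" lborel borel w]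
    by (simp add: lborel_distr_plus add.commute)
  have "(\<integral>z. s n z \<partial>lborel) = 0" for n
    using shift[of "h n *\<^sub>R v"] iw by (simp add: s_def)
  moreover have "(\<lambda>n. \<integral>z. s n z \<partial>lborel) \<longlonglongrightarrow> (\<integral>z. w' z v \<partial>lborel)"
  proof (rule integral_dominated_convergence[where w = "\<lambda>z. indicator (cball 0 (R + norm v)) z *\<^sub>R B"])
    show "integrable lborel (\<lambda>z::'a. indicator (cball 0 (R + norm v)) z *\<^sub>R B)"
      by (intro borel_integrable_compact) auto
    show "AE z in lborel. norm (s n z) \<le> indicator (cball 0 (R + norm v)) z *\<^sub>R B" for n
      using s_bound s_support B by (auto simp: indicator_def)
    show "AE z in lborel. (\<lambda>n. s n z) \<longlonglongrightarrow> w' z v" using tends by simp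
  qed (simp_all add: s_def)
  ultimately show ?thesis by (simp add: LIMSEQ_const_iff)
qed

section \<open>The inequalities of Hoelder and Minkowski\<close>

lemma Holder_inequality:
  fixes f g :: "'a \<Rightarrow> real"
  assumes pq: "1 < p" "1 < q" "1 / p + 1 / q = 1"
    and [measurable]: "f \<in> borel_measurable M" "g \<in> borel_measurable M"
    and nn: "\<And>x. 0 \<le> f x" "\<And>x. 0 \<le> g x"
    and int: "integrable M (\<lambda>x. f x powr p)" "integrable M (\<lambda>x. g x powr q)"
  shows "integrable M (\<lambda>x. f x * g x)"
    and "(\<integral>x. f x * g x \<partial>M) \<le> (\<integral>x. f x powr p \<partial>M) powr (1 / p) * (\<integral>x. g x powr q \<partial>M) powr (1 / q)"
proof -
  let ?A = "\<integral>x. f x powr p \<partial>M" and ?B = "\<integral>x. g x powr q \<partial>M"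
  show fg: "integrable M (\<lambda>x. f x * g x)"
  proof (rule Bochner_Integration.integrable_bound)
    show "integrable M (\<lambda>x. f x powr p / p + g x powr q / q)"
      using int by simp
    show "AE x in M. norm (f x * g x) \<le> norm (f x powr p / p + g x powr q / q)"
    proof (intro AE_I2)
      fix x
      have "f x * g x \<le> f x powr p / p + g x powr q / q"
        using Youngs_inequality[OF pq nn] .
      then show "norm (f x * g x) \<le> norm (f x powr p / p + g x powr q / q)"
        using nn[of x] by simp
    qed
  qed simp
  have AB: "0 \<le> ?A" "0 \<le> ?B" by simp_all
  show "(\<integral>x. f x * g x \<partial>M) \<le> ?A powr (1 / p) * ?B powr (1 / q)"
  proof (cases "?A = 0 \<or> ?B = 0")
    case True
    have "AE x in M. f x * g x = 0"
      using True
    proof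
      assume "?A = 0"
      then have "AE x in M. f x powr p = 0"
        using integral_nonneg_eq_0_iff_AE[OF int(1)] by simp
      then show ?thesis by eventually_elim simp
    next
      assume "?B = 0"
      then have "AE x in M. g x powr q = 0"
        using integral_nonneg_eq_0_iff_AE[OF int(2)] by simp
      then show ?thesis by eventually_elim simp
    qed
    then have "(\<integral>x. f x * g x \<partial>M) = 0"
      by (simp add: integral_eq_zero_AE)
    then show ?thesis using AB by simp
  next
    case False
    then have pos: "0 < ?A" "0 < ?B" using AB by linarith+
    \<comment> \<open>After division by the norms a and b, Young's inequality integrates to 1/p +
      1/q = 1.\<close>
    define a where "a = ?A powr (1 / p)"
    define b where "b = ?B powr (1 / q)"
    have ab: "0 < a" "0 < b" using pos by (auto simp: a_def b_def)
    have abp: "a powr p = ?A" "b powr q = ?B"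
      using pos pq by (auto simp: a_def b_def powr_powr)
    have "(\<integral>x. f x * g x / (a * b) \<partial>M) \<le> (\<integral>x. f x powr p / (p * ?A) + g x powr q / (q * ?B) \<partial>M)"
    proof (rule integral_mono)
      fix x
      have "(f x / a) * (g x / b) \<le> (f x / a) powr p / p + (g x / b) powr q / q"
        using nn ab by (intro Youngs_inequality[OF pq]) auto
      then show "f x * g x / (a * b) \<le> f x powr p / (p * ?A) + g x powr q / (q * ?B)"
        using nn ab by (simp add: powr_divide abp mult.commute)
    qed (use int fg in simp_all)
    also have "\<dots> = ?A / (p * ?A) + ?B / (q * ?B)"
      using int by simp
    also have "\<dots> = 1" using pq pos by simp
    finally show ?thesis
      using ab by (simp add: a_def[symmetric] b_def[symmetric] divide_simps)
  qed
qed

text \<open>Convexity on the positive half-line, extended to the endpoint: if x or y vanishes, the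
  claim reduces to \<theta>^q \<le> \<theta> for \<theta> in [0, 1].\<close>

lemma powr_convex_combination:
  fixes x y :: real
  assumes q: "1 \<le> q" and "0 \<le> x" "0 \<le> y" and t: "0 \<le> t" "t \<le> 1"
  shows "((1 - t) * x + t * y) powr q \<le> (1 - t) * x powr q + t * y powr q"
proof -
  have le: "\<theta> powr q \<le> \<theta>" if "0 \<le> \<theta>" "\<theta> \<le> 1" for \<theta> :: real
    using powr_mono_both'[of 1 q \<theta> \<theta>] that q by (cases "\<theta> = 0") auto
  consider "x = 0" | "y = 0" | "0 < x" "0 < y" using assms by linarith
  then show ?thesis
  proof cases
    case 1
    then show ?thesis using le[OF t] assms by (simp add: powr_mult mult_right_mono)
  next
    case 2
    then show ?thesis using le[of "1 - t"] assms by (simp add: powr_mult mult_right_mono)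
  next
    case 3
    then show ?thesis using convex_onD[OF powr_convex[OF q], of t x y] t by simp
  qed
qed

lemma Minkowski_inequality:
  fixes f g :: "'a \<Rightarrow> real"
  assumes q: "1 \<le> q"
    and [measurable]: "f \<in> borel_measurable M" "g \<in> borel_measurable M"
    and nn: "\<And>x. 0 \<le> f x" "\<And>x. 0 \<le> g x"
    and int: "integrable M (\<lambda>x. f x powr q)" "integrable M (\<lambda>x. g x powr q)"
  shows "integrable M (\<lambda>x. (f x + g x) powr q)"
    and "(\<integral>x. (f x + g x) powr q \<partial>M) powr (1 / q) \<le>
      (\<integral>x. f x powr q \<partial>M) powr (1 / q) + (\<integral>x. g x powr q \<partial>M) powr (1 / q)"
proof -
  let ?A = "\<integral>x. f x powr q \<partial>M" and ?B = "\<integral>x. g x powr q \<partial>M"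
  \<comment> \<open>(u + v)/(a + b) is the convex combination of u/a and v/b with weights a/(a + b)
    and b/(a + b). Norms as a and b give the inequality; a = b = 1 gives the integrable
    majorant.\<close>
  have convex: "(u + v) powr q \<le> (a + b) powr q * (a / (a + b) * (u / a) powr q + b / (a + b) * (v / b) powr q)"
    if "0 \<le> u" "0 \<le> v" "0 < a" "0 < b" for u v a b :: real
  proof -
    have "1 - b / (a + b) = a / (a + b)" using that by (simp add: field_simps)
    moreover have "a / (a + b) * (u / a) + b / (a + b) * (v / b) = (u + v) / (a + b)"
      using that by (simp add: add_divide_distrib)
    ultimately have "((u + v) / (a + b)) powr q \<le> a / (a + b) * (u / a) powr q + b / (a + b) * (v / b) powr q"
      using powr_convex_combination[OF q, of "u / a" "v / b" "b / (a + b)"] that by simp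
    then show ?thesis using that by (simp add: powr_divide field_simps)
  qed
  show int2: "integrable M (\<lambda>x. (f x + g x) powr q)"
  proof (rule Bochner_Integration.integrable_bound)
    show "integrable M (\<lambda>x. 2 powr q * (1 / 2 * f x powr q + 1 / 2 * g x powr q))"
      using int by simp
    show "AE x in M. norm ((f x + g x) powr q) \<le> norm (2 powr q * (1 / 2 * f x powr q + 1 / 2 * g x powr q))"
      using convex[OF nn, of 1 1] by auto
  qed simp
  have le: "(\<integral>x. (f x + g x) powr q \<partial>M) powr (1 / q) \<le> a + b"
    if ab: "0 < a" "0 < b" "?A \<le> a powr q" "?B \<le> b powr q" for a b
  proof -
    have "(\<integral>x. (f x + g x) powr q \<partial>M) \<le>
        (\<integral>x. (a + b) powr q * (a / (a + b) * (f x powr q / a powr q) + b / (a + b) * (g x powr q / b powr q)) \<partial>M)"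
      using convex[OF nn ab(1,2)] int int2 nn ab by (intro integral_mono) (simp_all add: powr_divide)
    also have "\<dots> = (a + b) powr q * (a / (a + b) * (?A / a powr q) + b / (a + b) * (?B / b powr q))"
      using int by simp
    also have "\<dots> \<le> (a + b) powr q * (a / (a + b) * 1 + b / (a + b) * 1)"
      using ab by (intro mult_left_mono add_mono) auto
    also have "\<dots> = (a + b) powr q"
      using ab by (simp add: add_divide_distrib[symmetric])
    finally have "(\<integral>x. (f x + g x) powr q \<partial>M) powr (1 / q) \<le> ((a + b) powr q) powr (1 / q)"
      using q by (intro powr_mono2) auto
    then show ?thesis using ab q by (simp add: powr_powr)
  qed
  show "(\<integral>x. (f x + g x) powr q \<partial>M) powr (1 / q) \<le> ?A powr (1 / q) + ?B powr (1 / q)"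
  proof (rule field_le_epsilon)
    \<comment> \<open>Adding e/2 to each norm keeps a and b positive even when a function vanishes
      almost everywhere.\<close>
    fix e :: real assume "0 < e"
    have *: "x \<le> (x powr (1 / q) + e / 2) powr q" if "0 \<le> x" for x
    proof -
      have "x = (x powr (1 / q)) powr q" using that q by (simp add: powr_powr)
      also have "\<dots> \<le> (x powr (1 / q) + e / 2) powr q"
        using \<open>0 < e\<close> q by (intro powr_mono2) auto
      finally show ?thesis .
    qed
    have pos: "0 < x powr (1 / q) + e / 2" for x
      using \<open>0 < e\<close> powr_ge_zero[of x "1 / q"] by linarith
    show "(\<integral>x. (f x + g x) powr q \<partial>M) powr (1 / q) \<le> ?A powr (1 / q) + ?B powr (1 / q) + e"
      using le[OF pos[of ?A] pos[of ?B] *[of ?A] *[of ?B]] by simp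
  qed
qed

section \<open>Sobolev inequalities for test functions\<close>

lemma integrable_continuous_compact_support:
  fixes h :: "'a::euclidean_space \<Rightarrow> real"
  assumes "continuous_on UNIV h" and "\<And>z. R < norm z \<Longrightarrow> h z = 0"
  shows "integrable lborel h"
proof -
  have "integrable lborel (\<lambda>x. indicator (cball 0 R) x *\<^sub>R h x)"
    by (intro borel_integrable_compact continuous_on_subset[OF assms(1)]) auto
  moreover have "(\<lambda>x. indicator (cball 0 R) x *\<^sub>R h x) = h"
    using assms(2) by (auto simp: indicator_def fun_eq_iff)
  ultimately show ?thesis by simp
qed

text \<open>The classical gradient, packed into a complex number in the same way as in
  \<open>has_weak_gradient\<close>.\<close>

definition grad :: "(complex \<Rightarrow> real) \<Rightarrow> complex \<Rightarrow> complex" where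
  "grad \<phi> z = Complex (frechet_derivative \<phi> (at z) 1) (frechet_derivative \<phi> (at z) \<i>)"

lemma test_functions_has_derivative:
  "\<phi> \<in> test_functions \<Omega> \<Longrightarrow> (\<phi> has_derivative frechet_derivative \<phi> (at z)) (at z)"
  using C_k_Suc_has_derivative[of 0 \<phi>] by (simp add: test_functions_def)

lemma test_functions_continuous: "\<phi> \<in> test_functions \<Omega> \<Longrightarrow> continuous_on UNIV \<phi>"
  unfolding test_functions_def by (metis (mono_tags) C_k.simps(1) mem_Collect_eq)

lemma test_functions_continuous_derivative:
  "\<phi> \<in> test_functions \<Omega> \<Longrightarrow> continuous_on UNIV (\<lambda>z. frechet_derivative \<phi> (at z) v)"
  unfolding test_functions_def by (metis (mono_tags, lifting) C_k.simps mem_Collect_eq)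

lemma test_functions_continuous_grad: "\<phi> \<in> test_functions \<Omega> \<Longrightarrow> continuous_on UNIV (grad \<phi>)"
  unfolding grad_def[abs_def] Complex_eq
  by (intro continuous_intros test_functions_continuous_derivative)

lemma frechet_derivative_eq_0:
  assumes \<phi>: "\<phi> \<in> test_functions \<Omega>" and z: "z \<notin> closure {x. \<phi> x \<noteq> 0}"
  shows "frechet_derivative \<phi> (at z) = (\<lambda>_. 0)"
proof (rule derivative_eq_0_on_open[OF test_functions_has_derivative[OF \<phi>]])
  show "open (- closure {x. \<phi> x \<noteq> 0})" by (intro open_Compl closed_closure)
  show "z \<in> - closure {x. \<phi> x \<noteq> 0}" using z by simp
  show "\<phi> x = 0" if "x \<in> - closure {x. \<phi> x \<noteq> 0}" for x
    using that subsetD[OF closure_subset, of x "{x. \<phi> x \<noteq> 0}"] by auto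
qed

lemma test_functions_zero_outside:
  assumes \<phi>: "\<phi> \<in> test_functions \<Omega>" and z: "z \<notin> \<Omega>"
  shows "\<phi> z = 0" "grad \<phi> z = 0"
proof -
  have *: "z \<notin> closure {x. \<phi> x \<noteq> 0}" using assms by (auto simp: test_functions_def)
  show "\<phi> z = 0" using * subsetD[OF closure_subset, of z "{x. \<phi> x \<noteq> 0}"] by auto
  show "grad \<phi> z = 0" using frechet_derivative_eq_0[OF \<phi> *] by (simp add: grad_def complex_eq_iff)
qed

lemma test_functions_bounded_support:
  assumes \<phi>: "\<phi> \<in> test_functions \<Omega>"
  obtains R where "\<And>z. R < norm z \<Longrightarrow> \<phi> z = 0"
    and "\<And>z. R < norm z \<Longrightarrow> frechet_derivative \<phi> (at z) = (\<lambda>_. 0)"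
proof -
  have "bounded (closure {x. \<phi> x \<noteq> 0})"
    using \<phi> by (auto simp: test_functions_def compact_imp_bounded)
  then obtain R where R: "\<And>x. x \<in> closure {x. \<phi> x \<noteq> 0} \<Longrightarrow> norm x \<le> R"
    unfolding bounded_iff by blast
  show ?thesis
  proof (rule that)
    fix z :: complex assume "R < norm z"
    then have *: "z \<notin> closure {x. \<phi> x \<noteq> 0}" using R by force
    show "\<phi> z = 0" using * subsetD[OF closure_subset, of z "{x. \<phi> x \<noteq> 0}"] by auto
    show "frechet_derivative \<phi> (at z) = (\<lambda>_. 0)" by (rule frechet_derivative_eq_0[OF \<phi> *])
  qed
qed

lemma continuous_on_powr_const:
  fixes f :: "'a::topological_space \<Rightarrow> real"
  assumes "continuous_on S f" and "\<And>x. x \<in> S \<Longrightarrow> 0 \<le> f x" and "0 < t"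
  shows "continuous_on S (\<lambda>x. f x powr t)"
  using assms by (intro continuous_on_powr' continuous_on_const) auto

lemma integrable_powr_test_function:
  assumes \<phi>: "\<phi> \<in> test_functions \<Omega>" and "0 < t"
  shows "integrable lborel (\<lambda>z. \<bar>\<phi> z\<bar> powr t)" and "integrable lborel (\<lambda>z. norm (grad \<phi> z) powr t)"
proof -
  obtain R where R: "\<And>z. R < norm z \<Longrightarrow> \<phi> z = 0"
      "\<And>z. R < norm z \<Longrightarrow> frechet_derivative \<phi> (at z) = (\<lambda>_. 0)"
    by (rule test_functions_bounded_support[OF \<phi>]) (rule that)
  have "grad \<phi> z = 0" if "R < norm z" for z
    using R(2)[OF that] by (simp add: grad_def complex_eq_iff)
  with R(1) show "integrable lborel (\<lambda>z. \<bar>\<phi> z\<bar> powr t)" "integrable lborel (\<lambda>z. norm (grad \<phi> z) powr t)"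
    using assms test_functions_continuous[OF \<phi>] test_functions_continuous_grad[OF \<phi>]
    by (auto intro!: integrable_continuous_compact_support[where R = R] continuous_on_powr_const
        continuous_on_rabs continuous_on_norm)
qed

text \<open>The derivative is s sgn(t) |t|^(s-1). Writing it with \<open>max\<close> makes its
  continuity evident, and 1 < s yields differentiability at 0.\<close>

lemma has_derivative_abs_powr:
  fixes s :: real
  assumes "1 < s"
  shows "((\<lambda>t. \<bar>t\<bar> powr s) has_real_derivative s * (max t 0 powr (s - 1) - max (- t) 0 powr (s - 1))) (at t)"
proof -
  consider "t < 0" | "t = 0" | "0 < t" by linarith
  then show ?thesis
  proof cases
    case 1
    have "((\<lambda>t. (- t) powr s) has_real_derivative s * (max t 0 powr (s - 1) - max (- t) 0 powr (s - 1))) (at t)"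
      using 1 by (auto intro!: derivative_eq_intros simp: max_def powr_diff)
    then show ?thesis
      by (rule has_field_derivative_transform_within_open[of _ _ _ "{..<0}"]) (use 1 in auto)
  next
    case 2
    have "((\<lambda>h. \<bar>h\<bar> powr s / h) \<longlongrightarrow> 0) (at (0::real))"
    proof (rule Lim_null_comparison)
      show "\<forall>\<^sub>F h in at 0. norm (\<bar>h\<bar> powr s / h) \<le> \<bar>h\<bar> powr (s - 1)"
        by (rule always_eventually) (auto simp: powr_diff)
      show "((\<lambda>h. \<bar>h\<bar> powr (s - 1)) \<longlongrightarrow> 0) (at (0::real))"
        using assms by (auto intro!: tendsto_eq_intros)
    qed
    then show ?thesis using 2 assms by (simp add: DERIV_def)
  next
    case 3
    have "((\<lambda>t. t powr s) has_real_derivative s * (max t 0 powr (s - 1) - max (- t) 0 powr (s - 1))) (at t)"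
      using 3 by (auto intro!: derivative_eq_intros simp: max_def powr_diff)
    then show ?thesis
      by (rule has_field_derivative_transform_within_open[of _ _ _ "{0<..}"]) (use 3 in auto)
  qed
qed

text \<open>The function |\<phi>|^s is continuously differentiable because s > 1, and both its
  partial derivatives are bounded by s |\<phi>|^(s-1) |grad \<phi>|. The 1/2 in s/2 comes from the
  factor 2 in \<open>gagliardo_nirenberg\<close>.\<close>

lemma gagliardo_nirenberg_power:
  assumes \<phi>: "\<phi> \<in> test_functions \<Omega>" and s: "1 < s"
  shows "integrable lborel (\<lambda>z. \<bar>\<phi> z\<bar> powr (s - 1) * norm (grad \<phi> z))"
    and "(\<integral>z. \<bar>\<phi> z\<bar> powr (2 * s) \<partial>lborel) \<le>
      (s / 2 * (\<integral>z. \<bar>\<phi> z\<bar> powr (s - 1) * norm (grad \<phi> z) \<partial>lborel))\<^sup>2"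
proof -
  define \<rho> where "\<rho> t = s * (max t 0 powr (s - 1) - max (- t) 0 powr (s - 1))" for t
  define D where "D z = frechet_derivative \<phi> (at z)" for z
  have abs_\<rho>: "\<bar>\<rho> t\<bar> = s * \<bar>t\<bar> powr (s - 1)" for t
    using s by (auto simp: \<rho>_def max_def abs_mult)
  have c\<rho>: "continuous_on UNIV \<rho>"
    unfolding \<rho>_def[abs_def] using s by (intro continuous_on_mult continuous_on_diff continuous_on_powr_const continuous_intros) auto
  have c: "continuous_on UNIV (\<lambda>z. \<rho> (\<phi> z) * D z v)" for v
    unfolding D_def using c\<rho> test_functions_continuous[OF \<phi>]
    by (intro continuous_on_mult test_functions_continuous_derivative[OF \<phi>]
        continuous_on_compose2[OF c\<rho>]) auto
  have d: "((\<lambda>z. \<bar>\<phi> z\<bar> powr s) has_derivative (\<lambda>v. \<rho> (\<phi> z) * D z v)) (at z)" for z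
    using has_derivative_compose[OF test_functions_has_derivative[OF \<phi>]
        has_derivative_abs_powr[OF s, unfolded has_field_derivative_def]]
    by (simp add: \<rho>_def D_def)
  obtain R where R: "\<And>z. R < norm z \<Longrightarrow> \<phi> z = 0"
      "\<And>z. R < norm z \<Longrightarrow> frechet_derivative \<phi> (at z) = (\<lambda>_. 0)"
    by (rule test_functions_bounded_support[OF \<phi>]) (rule that)
  show int: "integrable lborel (\<lambda>z. \<bar>\<phi> z\<bar> powr (s - 1) * norm (grad \<phi> z))"
    using R s test_functions_continuous[OF \<phi>] test_functions_continuous_grad[OF \<phi>]
    by (auto intro!: integrable_continuous_compact_support[where R = R] continuous_on_powr_const
        continuous_on_mult continuous_on_rabs continuous_on_norm)
  let ?J = "\<integral>z. \<bar>\<phi> z\<bar> powr (s - 1) * norm (grad \<phi> z) \<partial>lborel"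
  have le: "(\<integral>\<^sup>+z. ennreal \<bar>\<rho> (\<phi> z) * D z v\<bar> \<partial>lborel) \<le> ennreal (s * ?J)" if "v = 1 \<or> v = \<i>" for v
  proof -
    have "\<bar>D z v\<bar> \<le> norm (grad \<phi> z)" for z
      using that abs_Re_le_cmod[of "grad \<phi> z"] abs_Im_le_cmod[of "grad \<phi> z"]
      by (auto simp: grad_def D_def)
    then have "(\<integral>\<^sup>+z. ennreal \<bar>\<rho> (\<phi> z) * D z v\<bar> \<partial>lborel) \<le>
        (\<integral>\<^sup>+z. ennreal (s * (\<bar>\<phi> z\<bar> powr (s - 1) * norm (grad \<phi> z))) \<partial>lborel)"
      using s by (intro nn_integral_mono ennreal_leI) (auto simp: abs_mult abs_\<rho> mult.assoc intro!: mult_left_mono)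
    also have "\<dots> = ennreal (s * ?J)"
      using int s by (subst nn_integral_eq_integral) auto
    finally show ?thesis .
  qed
  have sq: "(2 * \<bar>x\<bar> powr s)\<^sup>2 = 4 * \<bar>x\<bar> powr (2 * s)" for x
    by (simp add: power2_eq_square powr_add[symmetric] flip: mult_2)
  have "ennreal (4 * (\<integral>z. \<bar>\<phi> z\<bar> powr (2 * s) \<partial>lborel)) =
      (\<integral>\<^sup>+z. ennreal ((2 * \<bar>\<phi> z\<bar> powr s)\<^sup>2) \<partial>lborel)"
    using integrable_powr_test_function(1)[OF \<phi>, of "2 * s"] s
    unfolding sq by (subst nn_integral_eq_integral) auto
  also have "\<dots> \<le> (\<integral>\<^sup>+z. ennreal \<bar>\<rho> (\<phi> z) * D z 1\<bar> \<partial>lborel) * (\<integral>\<^sup>+z. ennreal \<bar>\<rho> (\<phi> z) * D z \<i>\<bar> \<partial>lborel)"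
    by (rule gagliardo_nirenberg[OF d c c, where R = R]) (simp add: R)
  also have "\<dots> \<le> ennreal (s * ?J) * ennreal (s * ?J)"
    by (intro mult_mono le) auto
  also have "\<dots> = ennreal ((s * ?J)\<^sup>2)"
    using s by (simp add: ennreal_mult'[symmetric] power2_eq_square)
  finally show "(\<integral>z. \<bar>\<phi> z\<bar> powr (2 * s) \<partial>lborel) \<le> (s / 2 * ?J)\<^sup>2"
    by (simp add: power_mult_distrib power_divide)
qed

text \<open>The L^t norm for the normalised measure on \<Omega>, meant for functions that vanish
  outside \<Omega>, so that the integral may run over the plane. Normalisation makes it monotone in
  t without constants.\<close>

definition avg_norm :: "complex set \<Rightarrow> real \<Rightarrow> (complex \<Rightarrow> real) \<Rightarrow> real" where
  "avg_norm \<Omega> t h = ((\<integral>z. \<bar>h z\<bar> powr t \<partial>lborel) / measure lborel \<Omega>) powr (1 / t)"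

lemma avg_norm_nonneg: "0 \<le> avg_norm \<Omega> t h"
  by (simp add: avg_norm_def)

text \<open>Hoelder's inequality for |h|^a against the indicator of \<Omega>, with the conjugate
  exponents b/a and b/(b - a).\<close>

lemma avg_norm_mono:
  assumes \<Omega>: "\<Omega> \<in> sets borel" "emeasure lborel \<Omega> < \<infinity>" "0 < measure lborel \<Omega>"
    and [measurable]: "h \<in> borel_measurable borel" and h: "\<And>z. z \<notin> \<Omega> \<Longrightarrow> h z = 0"
    and ab: "0 < a" "a \<le> b" and int: "integrable lborel (\<lambda>z. \<bar>h z\<bar> powr b)"
  shows "avg_norm \<Omega> a h \<le> avg_norm \<Omega> b h"
proof (cases "a = b")
  case False
  then have ab': "0 < a" "a < b" using ab by auto
  let ?V = "measure lborel \<Omega>"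
  let ?Ia = "\<integral>z. \<bar>h z\<bar> powr a \<partial>lborel" and ?Ib = "\<integral>z. \<bar>h z\<bar> powr b \<partial>lborel"
  have eq: "(\<lambda>z. \<bar>h z\<bar> powr a * indicator \<Omega> z) = (\<lambda>z. \<bar>h z\<bar> powr a)"
    using h by (auto simp: fun_eq_iff indicator_def)
  have [measurable]: "\<Omega> \<in> sets borel" by (rule \<Omega>(1))
  have ind: "(\<lambda>z. indicator \<Omega> z powr (b / (b - a))) = (indicator \<Omega> :: complex \<Rightarrow> real)"
    by (auto simp: fun_eq_iff indicator_def)
  have "(\<integral>z. \<bar>h z\<bar> powr a * indicator \<Omega> z \<partial>lborel) \<le>
      (\<integral>z. (\<bar>h z\<bar> powr a) powr (b / a) \<partial>lborel) powr (1 / (b / a)) *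
      (\<integral>z. indicator \<Omega> z powr (b / (b - a)) \<partial>lborel) powr (1 / (b / (b - a)))"
  proof (rule Holder_inequality(2))
    show "integrable lborel (\<lambda>z. (\<bar>h z\<bar> powr a) powr (b / a))"
      using int ab' by (simp add: powr_powr)
    show "integrable lborel (\<lambda>z. indicat_real \<Omega> z powr (b / (b - a)))"
      unfolding ind using \<Omega> by (intro integrable_real_indicator) auto
    show "1 / (b / a) + 1 / (b / (b - a)) = 1" using ab' by (simp add: field_simps)
  qed (use ab' in auto)
  then have "?Ia \<le> ?Ib powr (a / b) * ?V powr (1 - a / b)"
    unfolding eq ind using ab' by (simp add: powr_powr diff_divide_distrib)
  then have "?Ia / ?V \<le> ?Ib powr (a / b) * ?V powr (1 - a / b) / ?V"
    using \<Omega> by (intro divide_right_mono) auto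
  also have "\<dots> = (?Ib / ?V) powr (a / b)"
    using \<Omega> by (simp add: powr_divide powr_diff)
  finally have "(?Ia / ?V) powr (1 / a) \<le> ((?Ib / ?V) powr (a / b)) powr (1 / a)"
    using ab' \<Omega> by (intro powr_mono2) auto
  then show ?thesis
    using ab' by (simp add: avg_norm_def powr_powr)
qed simp

text \<open>Hoelder's inequality with exponents q/(q - 1) and q separates the function from its
  gradient in \<open>gagliardo_nirenberg_power\<close>; the square root of that inequality is then
  rewritten in averaged norms.\<close>

lemma sobolev_step:
  assumes \<phi>: "\<phi> \<in> test_functions \<Omega>" and V: "0 < measure lborel \<Omega>" and s: "1 < s" and q: "1 < q"
  shows "avg_norm \<Omega> (2 * s) \<phi> powr s \<le>
    s / 2 * avg_norm \<Omega> ((s - 1) * (q / (q - 1))) \<phi> powr (s - 1) *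
    (sqrt (measure lborel \<Omega>) * avg_norm \<Omega> q (\<lambda>z. norm (grad \<phi> z)))"
proof -
  let ?V = "measure lborel \<Omega>"
  define m where "m = (s - 1) * (q / (q - 1))"
  define I where "I t = (\<integral>z. \<bar>\<phi> z\<bar> powr t \<partial>lborel)" for t
  define J where "J = (\<integral>z. norm (grad \<phi> z) powr q \<partial>lborel)"
  have m: "0 < m" "(s - 1) / m = 1 - 1 / q" "(s - 1) * q / (q - 1) = m"
    using s q by (auto simp: m_def field_simps)
  have IJ: "0 \<le> I t" "0 \<le> J" for t by (auto simp: I_def J_def)
  have [measurable]: "\<phi> \<in> borel_measurable borel" "grad \<phi> \<in> borel_measurable borel"
    using test_functions_continuous[OF \<phi>] test_functions_continuous_grad[OF \<phi>]
    by (auto intro: borel_measurable_continuous_onI)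
  have "(\<integral>z. \<bar>\<phi> z\<bar> powr (s - 1) * norm (grad \<phi> z) \<partial>lborel) \<le>
      (\<integral>z. (\<bar>\<phi> z\<bar> powr (s - 1)) powr (q / (q - 1)) \<partial>lborel) powr (1 / (q / (q - 1))) *
      (\<integral>z. norm (grad \<phi> z) powr q \<partial>lborel) powr (1 / q)"
  proof (rule Holder_inequality(2))
    show "integrable lborel (\<lambda>z. (\<bar>\<phi> z\<bar> powr (s - 1)) powr (q / (q - 1)))"
      using integrable_powr_test_function(1)[OF \<phi> m(1)] by (simp add: powr_powr m(3))
    show "integrable lborel (\<lambda>z. norm (grad \<phi> z) powr q)"
      using integrable_powr_test_function(2)[OF \<phi>] q by simp
  qed (use q in \<open>auto simp: field_simps\<close>)
  also have "\<dots> = I m powr (1 - 1 / q) * J powr (1 / q)"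
    using q by (simp add: powr_powr m(3) I_def J_def diff_divide_distrib)
  finally have T: "(\<integral>z. \<bar>\<phi> z\<bar> powr (s - 1) * norm (grad \<phi> z) \<partial>lborel) \<le> I m powr (1 - 1 / q) * J powr (1 / q)" .
  have "I (2 * s) \<le> (s / 2 * (\<integral>z. \<bar>\<phi> z\<bar> powr (s - 1) * norm (grad \<phi> z) \<partial>lborel))\<^sup>2"
    unfolding I_def by (rule gagliardo_nirenberg_power(2)[OF \<phi> s])
  also have "\<dots> \<le> (s / 2 * (I m powr (1 - 1 / q) * J powr (1 / q)))\<^sup>2"
    using s T by (intro power_mono mult_left_mono mult_nonneg_nonneg) auto
  finally have "sqrt (I (2 * s)) \<le> s / 2 * (I m powr (1 - 1 / q) * J powr (1 / q))"
    using s by (intro real_le_lsqrt) auto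
  then have "sqrt (I (2 * s)) / sqrt ?V \<le> s / 2 * (I m powr (1 - 1 / q) * J powr (1 / q)) / sqrt ?V"
    using V by (intro divide_right_mono) auto
  also have "\<dots> = s / 2 * (I m / ?V) powr (1 - 1 / q) * (sqrt ?V * (J / ?V) powr (1 / q))"
  proof -
    \<comment> \<open>The volume exponents of the two Hoelder factors add up to 1; one square root
      cancels the division by \<open>sqrt ?V\<close>, the other one stays with the gradient.\<close>
    have "?V powr (1 - 1 / q) * ?V powr (1 / q) = sqrt ?V * sqrt ?V"
      using V by (simp add: powr_add[symmetric])
    then show ?thesis
      using V IJ by (simp add: powr_divide field_simps)
  qed
  also have "(I m / ?V) powr (1 - 1 / q) = avg_norm \<Omega> m \<phi> powr (s - 1)"
    using m by (simp add: avg_norm_def I_def powr_powr)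
  also have "(J / ?V) powr (1 / q) = avg_norm \<Omega> q (\<lambda>z. norm (grad \<phi> z))"
    by (simp add: avg_norm_def J_def)
  also have "sqrt (I (2 * s)) / sqrt ?V = avg_norm \<Omega> (2 * s) \<phi> powr s"
    using s V by (simp add: avg_norm_def I_def powr_powr powr_half_sqrt real_sqrt_divide)
  finally show ?thesis by (simp add: m(3))
qed

section \<open>Sobolev inequalities obtained by iterating the step\<close>

locale test_function_on =
  fixes \<Omega> :: "complex set" and \<phi> :: "complex \<Rightarrow> real"
  assumes \<phi>: "\<phi> \<in> test_functions \<Omega>" and borel_\<Omega>: "\<Omega> \<in> sets borel"
    and finite_\<Omega>: "emeasure lborel \<Omega> < \<infinity>" and pos_\<Omega>: "0 < measure lborel \<Omega>"
begin

abbreviation N :: "real \<Rightarrow> real" where "N t \<equiv> avg_norm \<Omega> t \<phi>"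

text \<open>The factor \<open>sqrt (measure lborel \<Omega>)\<close> makes G, like N, invariant
  under dilations, so that the inequalities between them carry no further power of the area.\<close>

definition G :: "real \<Rightarrow> real" where
  "G q = sqrt (measure lborel \<Omega>) * avg_norm \<Omega> q (\<lambda>z. norm (grad \<phi> z))"

lemma N_mono: "0 < a \<Longrightarrow> a \<le> b \<Longrightarrow> N a \<le> N b"
  using test_functions_zero_outside[OF \<phi>] integrable_powr_test_function(1)[OF \<phi>]
    test_functions_continuous[OF \<phi>]
  by (intro avg_norm_mono borel_\<Omega> finite_\<Omega> pos_\<Omega>) (auto intro: borel_measurable_continuous_onI)

lemma G_mono: "0 < a \<Longrightarrow> a \<le> b \<Longrightarrow> G a \<le> G b"
  using test_functions_zero_outside[OF \<phi>] integrable_powr_test_function(2)[OF \<phi>]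
    test_functions_continuous_grad[OF \<phi>] pos_\<Omega>
  unfolding G_def
  by (intro mult_left_mono avg_norm_mono borel_\<Omega> finite_\<Omega> pos_\<Omega>)
    (auto intro!: borel_measurable_continuous_onI continuous_on_norm)

lemma N_nonneg: "0 \<le> N t" and G_nonneg: "0 \<le> G t"
  using pos_\<Omega> by (auto simp: avg_norm_nonneg G_def)

lemma step: "1 < s \<Longrightarrow> 1 < q \<Longrightarrow> N (2 * s) powr s \<le> s / 2 * N ((s - 1) * (q / (q - 1))) powr (s - 1) * G q"
  using sobolev_step[OF \<phi> pos_\<Omega>] by (simp add: G_def)

text \<open>Take s = r/2 in \<open>step\<close>. The last hypothesis says that the exponent of N on
  the right is at most r, so that factor may be replaced by a power of \<open>N r\<close> and
  cancelled.\<close>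

lemma sobolev:
  assumes r: "2 < r" and q: "1 < q" and qr: "(r / 2 - 1) * (q / (q - 1)) \<le> r"
  shows "N r \<le> r / 4 * G q"
proof (cases "N r = 0")
  case True
  then show ?thesis using G_nonneg r by simp
next
  case False
  then have pos: "0 < N r" using N_nonneg[of r] by linarith
  define s where "s = r / 2"
  have s: "1 < s" "2 * s = r" using r by (auto simp: s_def)
  have "0 < (s - 1) * (q / (q - 1))" using s q by simp
  then have "N ((s - 1) * (q / (q - 1))) powr (s - 1) \<le> N r powr (s - 1)"
    using qr s by (intro powr_mono2 N_mono) (auto simp: s_def avg_norm_nonneg)
  then have "s / 2 * N ((s - 1) * (q / (q - 1))) powr (s - 1) * G q \<le> s / 2 * N r powr (s - 1) * G q"
    using s G_nonneg by (intro mult_right_mono mult_left_mono) auto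
  then have "N r powr s \<le> s / 2 * N r powr (s - 1) * G q"
    using step[OF s(1) q] unfolding s(2) by linarith
  moreover have "N r powr s = N r powr (s - 1) * N r"
    using pos by (simp add: powr_diff)
  ultimately have "N r \<le> s / 2 * G q"
    using pos by (simp add: mult_ac)
  then show ?thesis by (simp add: s_def)
qed

text \<open>One step bounds \<open>N t\<close> by \<open>(t/4)\<^bsup>2/t\<^esup>\<close> times the bound for \<open>N (2t/3)\<close>.  The exponent \<open>b - a / sqrt t\<close>
  is chosen such that it grows by at least \<open>ln (t/4) * 2/t\<close> from \<open>2t/3\<close> to \<open>t\<close> and is nonnegative at \<open>2\<close>.\<close>

lemma sobolev_bounded:
  assumes "2 < t"
  shows "N t \<le> exp (33 / 10 - 9 / 2 / sqrt t) * G 4"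
proof -
  \<comment> \<open>With gradient exponent 4 the conjugate exponent is 4/3, and (t/2 - 1) 4/3 is
    below 2t/3. Each step thus extends the admissible range of t by the factor 3/2, starting from t
    at most 4, where \<open>sobolev\<close> gives t/4 \<le> 1.\<close>
  have *: "2 < t \<Longrightarrow> t \<le> 4 * (3 / 2) ^ n \<Longrightarrow> N t \<le> exp (33 / 10 - 9 / 2 / sqrt t) * G 4" for n t
  proof (induction n arbitrary: t)
    case 0
    have "N t \<le> t / 4 * G 4"
      by (rule sobolev) (use 0 in auto)
    also have "\<dots> \<le> 1 * G 4"
      using 0 G_nonneg by (intro mult_right_mono) auto
    also have "\<dots> \<le> exp (33 / 10 - 9 / 2 / sqrt t) * G 4"
    proof (rule mult_right_mono)
      \<comment> \<open>(7/5)^2 = 49/25 < 2 < t, and (9/2)/(7/5) = 45/14 < 33/10, so the exponent is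
        nonnegative on the whole range.\<close>
      have "sqrt t \<ge> 7 / 5" using 0 by (intro real_le_rsqrt) (auto simp: power2_eq_square)
      then have "9 / 2 / sqrt t \<le> 33 / 10" using 0 by (simp add: divide_le_eq)
      then show "1 \<le> exp (33 / 10 - 9 / 2 / sqrt t)" by simp
    qed (rule G_nonneg)
    finally show ?case .
  next
    case (Suc n)
    show ?case
    proof (cases "t \<le> 4 * (3 / 2) ^ n")
      case True
      then show ?thesis using Suc by blast
    next
      case False
      have "(1::real) \<le> (3 / 2) ^ n" by simp
      then have t: "4 < t" using False by linarith
      define s where "s = t / 2"
      define B where "B = exp (33 / 10 - 9 / 2 / sqrt (2 * t / 3))"
      have s: "2 < s" "2 * s = t" using t by (auto simp: s_def)
      have IH: "N (2 * t / 3) \<le> B * G 4"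
        unfolding B_def by (rule Suc.IH) (use Suc.prems t in auto)
      have "sqrt (2 * t / 3) \<ge> 8 / 5" using t by (intro real_le_rsqrt) (auto simp: power2_eq_square)
      then have "9 / 2 / sqrt (2 * t / 3) \<le> 33 / 10" using t by (simp add: divide_le_eq)
      then have B: "1 \<le> B" by (simp add: B_def)
      have "N t powr s \<le> s / 2 * N ((s - 1) * (4 / 3)) powr (s - 1) * G 4"
        using step[of s 4] s by simp
      also have "\<dots> \<le> s / 2 * (B * G 4) powr (s - 1) * G 4"
      proof -
        have "N ((s - 1) * (4 / 3)) \<le> N (2 * t / 3)"
          using s by (intro N_mono) (auto simp: s_def)
        then show ?thesis
          using IH s G_nonneg N_nonneg by (intro mult_right_mono mult_left_mono powr_mono2) auto
      qed
      \<comment> \<open>The bound B is at least 1, so the loose factor \<open>G 4\<close> can be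
        enlarged to \<open>B * G 4\<close>, completing the power s before the s-th root is
        taken.\<close>
      also have "\<dots> \<le> s / 2 * (B * G 4) powr s"
      proof (cases "G 4 = 0")
        case False
        then have "0 < G 4" using G_nonneg[of 4] by linarith
        then have "(B * G 4) powr s = (B * G 4) powr (s - 1) * (B * G 4)"
          using B by (simp add: powr_diff)
        moreover have "(B * G 4) powr (s - 1) * G 4 \<le> (B * G 4) powr (s - 1) * (B * G 4)"
          using B \<open>0 < G 4\<close> by (intro mult_left_mono) auto
        ultimately show ?thesis using s by (simp add: mult_left_mono mult.assoc)
      qed simp
      finally have "N t powr s \<le> s / 2 * (B * G 4) powr s" .
      then have "(N t powr s) powr (1 / s) \<le> (s / 2 * (B * G 4) powr s) powr (1 / s)"
        using s by (intro powr_mono2) auto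
      also have "(N t powr s) powr (1 / s) = N t"
        using s N_nonneg[of t] by (simp add: powr_powr)
      also have "(s / 2 * (B * G 4) powr s) powr (1 / s) = (s / 2) powr (1 / s) * ((B * G 4) powr s) powr (1 / s)"
        by (rule powr_mult)
      also have "\<dots> = (s / 2) powr (1 / s) * B * G 4"
        using s B G_nonneg[of 4] by (simp add: powr_powr)
      finally have "N t \<le> (s / 2) powr (1 / s) * B * G 4" .
      moreover have "(s / 2) powr (1 / s) * B \<le> exp (33 / 10 - 9 / 2 / sqrt t)"
      proof -
        \<comment> \<open>Together with ln 2 < 1 this gives ln (sqrt t / 2) \<le> sqrt t / 4, so the
          logarithmic cost ln(s/2)/s of one step is at most 1/sqrt t.\<close>
        have "ln (sqrt t / 4) \<le> sqrt t / 4 - 1"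
          using t by (intro ln_le_minus_one) auto
        moreover have ln4: "ln 4 = 2 * ln (2::real)" using ln_realpow[of "2::real" 2] by simp
        then have "ln (sqrt t / 4) = ln (sqrt t / 2) - ln 2"
          using t by (simp add: ln_div)
        ultimately have l: "ln (sqrt t / 2) \<le> sqrt t / 4"
          using ln_2_less_1 by linarith
        have "ln (s / 2) = 2 * ln (sqrt t / 2)"
          using t ln4 by (simp add: s_def ln_div ln_sqrt)
        then have "ln (s / 2) / s \<le> 2 * (sqrt t / 4) / s"
          using l s by (intro divide_right_mono) auto
        also have "\<dots> = 1 / sqrt t"
          using t by (simp add: s_def field_simps)
        finally have l2: "ln (s / 2) / s \<le> 1 / sqrt t" .
        \<comment> \<open>(9/11)^2 = 81/121 exceeds 2/3. Then the exponent gains at least (9/2)(11/9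
          - 1)/sqrt t, which is exactly the cost 1/sqrt t; this determines the coefficient
          9/2.\<close>
        have "sqrt (2 * t / 3) \<le> 9 / 11 * sqrt t"
          using t by (intro real_le_lsqrt) (auto simp: power_mult_distrib power_divide)
        then have "1 / (9 / 11 * sqrt t) \<le> 1 / sqrt (2 * t / 3)"
          using t by (intro divide_left_mono) auto
        then have "1 / sqrt t + 9 / 2 / sqrt t \<le> 9 / 2 / sqrt (2 * t / 3)"
          using t by (simp add: field_simps)
        then have "ln (s / 2) / s + (33 / 10 - 9 / 2 / sqrt (2 * t / 3)) \<le> 33 / 10 - 9 / 2 / sqrt t"
          using l2 by linarith
        moreover have "(s / 2) powr (1 / s) * B = exp (ln (s / 2) / s + (33 / 10 - 9 / 2 / sqrt (2 * t / 3)))"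
          using s by (simp add: powr_def B_def exp_add)
        ultimately show ?thesis by simp
      qed
      ultimately show ?thesis
        using mult_right_mono[OF _ G_nonneg] by (meson order_trans)
    qed
  qed
  obtain n where "t / 4 < (3 / 2) ^ n"
    using real_arch_pow[of "3 / 2" "t / 4"] by auto
  then show ?thesis using *[OF assms, of n] by simp
qed

text \<open>Up to p = 4 one step suffices. Beyond that, \<open>sobolev_bounded\<close> bounds
  \<open>N p\<close> through \<open>G 4\<close>, which is at most \<open>G p\<close>; 81 = 3^4
  dominates exp 4 and hence exp (33/10).\<close>

lemma poincare:
  assumes p: "2 < p"
  shows "N p \<le> 81 * G p"
proof (cases "p \<le> 4")
  case True
  have "(p / 2 - 1) * (p / (p - 1)) \<le> p"
    using p by (simp add: field_simps)
  then have "N p \<le> p / 4 * G p" using p by (intro sobolev) auto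
  also have "\<dots> \<le> 81 * G p" using True G_nonneg by (intro mult_right_mono) auto
  finally show ?thesis .
next
  case False
  have "0 \<le> 9 / 2 / sqrt p" using p by simp
  then have "exp (33 / 10 - 9 / 2 / sqrt p) \<le> exp (real 4 * 1)"
    unfolding exp_le_cancel_iff by linarith
  also have "\<dots> = exp 1 ^ 4" by (rule exp_of_nat_mult)
  also have "\<dots> \<le> 3 ^ 4" using exp_le by (intro power_mono) auto
  also have "\<dots> = (81 :: real)" by simp
  finally have "exp (33 / 10 - 9 / 2 / sqrt p) * G 4 \<le> 81 * G p"
    using G_mono[of 4 p] False G_nonneg by (intro mult_mono) auto
  then show ?thesis using sobolev_bounded[OF p] by linarith
qed

end

section \<open>Weak gradients\<close>

text \<open>The definitions integrate over \<Omega> with \<open>lebesgue\<close>, the estimates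
  above over the plane with \<open>lborel\<close>; for Borel functions vanishing off \<Omega> the
  two agree.\<close>

lemma set_lebesgue_eq_lborel:
  fixes h :: "complex \<Rightarrow> 'b::euclidean_space"
  assumes [measurable]: "h \<in> borel_measurable borel" and h: "\<And>z. z \<notin> \<Omega> \<Longrightarrow> h z = 0"
  shows "set_integrable lebesgue \<Omega> h \<longleftrightarrow> integrable lborel h"
    and "(LINT z:\<Omega>|lebesgue. h z) = (\<integral>z. h z \<partial>lborel)"
    and "set_borel_measurable lebesgue \<Omega> h"
proof -
  have eq: "(\<lambda>z. indicator \<Omega> z *\<^sub>R h z) = h"
    using h by (auto simp: fun_eq_iff indicator_def)
  show "set_integrable lebesgue \<Omega> h \<longleftrightarrow> integrable lborel h"
    unfolding set_integrable_def eq by (rule integrable_completion) simp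
  show "(LINT z:\<Omega>|lebesgue. h z) = (\<integral>z. h z \<partial>lborel)"
    unfolding set_lebesgue_integral_def eq by (rule integral_completion) simp
  show "set_borel_measurable lebesgue \<Omega> h"
    unfolding set_borel_measurable_def eq by (simp add: measurable_completion)
qed

section \<open>The fundamental lemma of the calculus of variations\<close>

lemma Lp_loc_1_iff:
  fixes g :: "complex \<Rightarrow> 'b::euclidean_space"
  shows "g \<in> Lp_loc 1 \<Omega> \<longleftrightarrow> (\<forall>C. compact C \<and> C \<subseteq> \<Omega> \<longrightarrow> set_integrable lebesgue C g)"
proof -
  have "g \<in> Lp_space 1 C \<longleftrightarrow> set_integrable lebesgue C g" for C
  proof -
    have eq: "(\<lambda>x. indicator C x *\<^sub>R norm (g x)) = (\<lambda>x. norm (indicator C x *\<^sub>R g x))"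
      by (auto simp: fun_eq_iff indicator_def)
    show ?thesis
      unfolding Lp_space_def set_integrable_def set_borel_measurable_def
      using integrable_norm_iff[of "\<lambda>x. indicator C x *\<^sub>R g x" lebesgue]
      by (auto simp add: eq simp del: real_scaleR_def norm_scaleR)
  qed
  then show ?thesis by (auto simp: Lp_loc_def)
qed

lemma set_integrable_test_mult:
  fixes h :: "complex \<Rightarrow> real" and g :: "complex \<Rightarrow> 'b::euclidean_space"
  assumes g: "g \<in> Lp_loc 1 \<Omega>" and h: "continuous_on UNIV h" and C: "compact C" "C \<subseteq> \<Omega>"
    and zero: "\<And>x. x \<notin> C \<Longrightarrow> h x = 0"
  shows "set_integrable lebesgue \<Omega> (\<lambda>x. h x *\<^sub>R g x)"
proof -
  have gC: "integrable lebesgue (\<lambda>x. indicator C x *\<^sub>R g x)"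
    using g C by (simp add: Lp_loc_1_iff set_integrable_def)
  have "bounded (h ` C)"
    using C by (intro compact_imp_bounded compact_continuous_image continuous_on_subset[OF h]) auto
  then obtain B where B: "\<forall>x\<in>C. \<bar>h x\<bar> \<le> B"
    unfolding bounded_iff by auto
  have hm: "h \<in> borel_measurable lebesgue"
    using h by (intro measurable_completion) (simp add: borel_measurable_continuous_onI)
  have "(\<lambda>x. indicator \<Omega> x *\<^sub>R (h x *\<^sub>R g x)) = (\<lambda>x. h x *\<^sub>R (indicator C x *\<^sub>R g x))"
    using zero C by (auto simp: fun_eq_iff indicator_def)
  moreover have "integrable lebesgue (\<lambda>x. h x *\<^sub>R (indicator C x *\<^sub>R g x))"
  proof (rule Bochner_Integration.integrable_bound)
    show "integrable lebesgue (\<lambda>x. B * norm (indicator C x *\<^sub>R g x))"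
      by (intro integrable_mult_right integrable_norm gC)
    show "AE x in lebesgue. norm (h x *\<^sub>R indicator C x *\<^sub>R g x) \<le> norm (B * norm (indicator C x *\<^sub>R g x))"
    proof (intro AE_I2)
      fix x
      show "norm (h x *\<^sub>R indicator C x *\<^sub>R g x) \<le> norm (B * norm (indicator C x *\<^sub>R g x))"
      proof (cases "x \<in> C")
        case True
        then have "\<bar>h x\<bar> \<le> B" using B by auto
        then have "\<bar>h x\<bar> * norm (g x) \<le> \<bar>B\<bar> * norm (g x)" by (intro mult_right_mono) auto
        then show ?thesis using True by (simp add: abs_mult)
      qed simp
    qed
    show "(\<lambda>x. h x *\<^sub>R indicator C x *\<^sub>R g x) \<in> borel_measurable lebesgue"
      using hm borel_measurable_integrable[OF gC] by (rule borel_measurable_scaleR)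
  qed
  ultimately show ?thesis by (simp add: set_integrable_def)
qed

text \<open>Dominated convergence along \<open>box_cutoff\<close>. The closed box has to lie in
  \<Omega>, both for the cutoffs to be test functions and for g to be integrable on it.\<close>

lemma integral_box_eq_0:
  fixes g :: "complex \<Rightarrow> real"
  assumes g: "g \<in> Lp_loc 1 \<Omega>" and ab: "cbox a b \<subseteq> \<Omega>"
    and orth: "\<And>\<phi>. \<phi> \<in> test_functions \<Omega> \<Longrightarrow> (LINT x:\<Omega>|lebesgue. \<phi> x *\<^sub>R g x) = 0"
  shows "(LINT x:box a b|lebesgue. g x) = 0"
proof -
  have gC: "integrable lebesgue (\<lambda>x. indicator (cbox a b) x *\<^sub>R g x)"
    using g ab by (simp add: Lp_loc_1_iff set_integrable_def)
  have "integrable lebesgue (\<lambda>x. indicator (box a b) x *\<^sub>R (indicator (cbox a b) x *\<^sub>R g x))"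
    by (rule integrable_mult_indicator[OF _ gC]) simp
  moreover have "(\<lambda>x. indicator (box a b) x *\<^sub>R (indicator (cbox a b) x *\<^sub>R g x)) = (\<lambda>x. indicator (box a b) x *\<^sub>R g x)"
    using box_subset_cbox[of a b] by (auto simp: fun_eq_iff indicator_def)
  ultimately have gB: "integrable lebesgue (\<lambda>x. indicator (box a b) x *\<^sub>R g x)" by simp
  have \<Omega>: "box a b \<subseteq> \<Omega>" using ab box_subset_cbox by blast
  have eq: "indicator \<Omega> x *\<^sub>R (box_cutoff a b n x *\<^sub>R g x) = box_cutoff a b n x * (indicator (box a b) x *\<^sub>R g x)" for n x
    using \<Omega> box_bump_eq_0[of x a b] by (cases "x \<in> box a b") (auto simp: box_cutoff_def)
  have "(\<lambda>n. LINT x|lebesgue. box_cutoff a b n x * (indicator (box a b) x *\<^sub>R g x)) \<longlonglongrightarrow>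
      (LINT x|lebesgue. indicator (box a b) x * (indicator (box a b) x *\<^sub>R g x))"
  proof (rule integral_dominated_convergence[where w = "\<lambda>x. norm (indicator (box a b) x *\<^sub>R g x)"])
    show "(\<lambda>x. indicator (box a b) x * (indicator (box a b) x *\<^sub>R g x)) \<in> borel_measurable lebesgue"
      using gB by (intro borel_measurable_times borel_measurable_indicator) auto
    show "(\<lambda>x. box_cutoff a b n x * (indicator (box a b) x *\<^sub>R g x)) \<in> borel_measurable lebesgue" for n
    proof (intro borel_measurable_times)
      show "box_cutoff a b n \<in> borel_measurable lebesgue"
        using test_functions_continuous[OF box_cutoff_test_function[OF ab, of n]]
        by (intro measurable_completion) (simp add: borel_measurable_continuous_onI)
    qed (use gB in auto)
    show "AE x in lebesgue. (\<lambda>n. box_cutoff a b n x * (indicator (box a b) x *\<^sub>R g x))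
        \<longlonglongrightarrow> indicator (box a b) x * (indicator (box a b) x *\<^sub>R g x)"
      by (intro AE_I2 tendsto_mult box_cutoff_tendsto tendsto_const)
    show "AE x in lebesgue. norm (box_cutoff a b n x * (indicator (box a b) x *\<^sub>R g x))
        \<le> norm (indicator (box a b) x *\<^sub>R g x)" for n
      using box_cutoff_bounds[of a b n] by (auto simp: abs_mult intro!: mult_left_le_one_le)
  qed (use gB in auto)
  moreover have "(LINT x|lebesgue. box_cutoff a b n x * (indicator (box a b) x *\<^sub>R g x)) = 0" for n
    using orth[OF box_cutoff_test_function[OF ab, of n]] unfolding set_lebesgue_integral_def eq .
  ultimately have "(LINT x|lebesgue. indicator (box a b) x * (indicator (box a b) x *\<^sub>R g x)) = 0"
    by (simp add: LIMSEQ_const_iff)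
  moreover have "(\<lambda>x. indicator (box a b) x * (indicator (box a b) x *\<^sub>R g x)) = (\<lambda>x. indicator (box a b) x *\<^sub>R g x)"
    by (auto simp: fun_eq_iff indicator_def)
  ultimately show ?thesis by (simp add: set_lebesgue_integral_def)
qed

text \<open>Open boxes form an intersection-stable generator of the Borel sets, so the integrals
  over all Borel sets vanish; the total integral enters in the step for complements. Uniqueness of
  densities finishes the argument.\<close>

lemma AE_eq_0_if_box_integrals_0:
  fixes h :: "'a::euclidean_space \<Rightarrow> real"
  assumes h: "integrable lborel h" and tot: "(\<integral>x. h x \<partial>lborel) = 0"
    and box: "\<And>a b. (LINT x:box a b|lborel. h x) = 0"
  shows "AE x in lborel. h x = 0"
proof -
  have si: "set_integrable lborel A h" if "A \<in> sets borel" for A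
    unfolding set_integrable_def using that by (intro integrable_mult_indicator h) simp
  have "(LINT x:A|lborel. h x) = 0" if "A \<in> sets borel" for A
  proof -
    let ?E = "range (\<lambda>(a, b). box a b :: 'a set)"
    have sb: "sigma_sets UNIV ?E = sets borel" by (simp add: borel_eq_box)
    have "Int_stable ?E" by (auto simp: Int_stable_def box_Int_box)
    moreover have "?E \<subseteq> Pow UNIV" by simp
    moreover have "A \<in> sigma_sets UNIV ?E" using that by (simp add: sb)
    ultimately show ?thesis
    proof (induction rule: sigma_sets_induct_disjoint)
      case (basic A)
      then show ?case using box by auto
    next
      case empty
      then show ?case by (simp add: set_lebesgue_integral_def)
    next
      case (compl A)
      then have A: "A \<in> sets borel" by (simp add: sb)
      have "(LINT x:A \<union> (UNIV - A)|lborel. h x) = (LINT x:A|lborel. h x) + (LINT x:UNIV - A|lborel. h x)"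
        using A by (intro set_integral_Un si) auto
      then show ?case using compl tot by (simp add: set_lebesgue_integral_def)
    next
      case (union A)
      then have A: "\<And>i. A i \<in> sets borel" by (simp add: sb image_subset_iff)
      have "(LINT x:(\<Union>i. A i)|lborel. h x) = (\<Sum>i. LINT x:A i|lborel. h x)"
        using A union.hyps by (intro lebesgue_integral_countable_add si) (auto simp: disjoint_family_on_def)
      then show ?case using union by simp
    qed
  qed
  then show ?thesis
    using density_unique_real[OF h, of "\<lambda>_. 0"] by simp
qed

text \<open>An open set is a countable union of closed boxes, so it suffices to treat one closed
  box, to which the function is cut down.\<close>

lemma AE_eq_0_if_orthogonal:
  fixes g :: "complex \<Rightarrow> real"
  assumes \<Omega>: "open \<Omega>" and g: "g \<in> Lp_loc 1 \<Omega>"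
    and orth: "\<And>\<phi>. \<phi> \<in> test_functions \<Omega> \<Longrightarrow> (LINT x:\<Omega>|lebesgue. \<phi> x *\<^sub>R g x) = 0"
  shows "AE x in lebesgue. x \<in> \<Omega> \<longrightarrow> g x = 0"
proof -
  have on_box: "AE x in lebesgue. x \<in> cbox a b \<longrightarrow> g x = 0" if ab: "cbox a b \<subseteq> \<Omega>" for a b
  proof -
    define g0 where "g0 = (\<lambda>x. indicator (box a b) x *\<^sub>R g x)"
    have gC: "integrable lebesgue (\<lambda>x. indicator (cbox a b) x *\<^sub>R g x)"
      using g ab by (simp add: Lp_loc_1_iff set_integrable_def)
    have "integrable lebesgue (\<lambda>x. indicator (box a b) x *\<^sub>R (indicator (cbox a b) x *\<^sub>R g x))"
      by (rule integrable_mult_indicator[OF _ gC]) simp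
    moreover have "(\<lambda>x. indicator (box a b) x *\<^sub>R (indicator (cbox a b) x *\<^sub>R g x)) = g0"
      using box_subset_cbox[of a b] by (auto simp: fun_eq_iff indicator_def g0_def)
    ultimately have g0: "integrable lebesgue g0" by simp
    \<comment> \<open>A Borel representative, because the criterion with boxes is stated for
      \<open>lborel\<close>.\<close>
    obtain g1 where g1: "g1 \<in> borel_measurable lborel" "AE x in lborel. g0 x = g1 x"
      using completion_ex_borel_measurable_real[OF borel_measurable_integrable[OF g0]] by blast
    have [measurable]: "g1 \<in> borel_measurable borel" using g1 by simp
    have g1': "AE x in lebesgue. g0 x = g1 x" by (rule AE_completion[OF g1(2)])
    have "integrable lebesgue g1"
      using g1(1) by (intro integrable_cong_AE_imp[OF g0 _ g1']) (simp add: measurable_completion)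
    then have int1: "integrable lborel g1" by (simp add: integrable_completion)
    have trans: "(LINT x:A|lborel. g1 x) = (LINT x:A|lebesgue. g0 x)" if [measurable]: "A \<in> sets borel" for A
    proof -
      have "(LINT x:A|lborel. g1 x) = (LINT x:A|lebesgue. g1 x)"
        unfolding set_lebesgue_integral_def by (rule integral_completion[symmetric]) measurable
      also have "\<dots> = (LINT x:A|lebesgue. g0 x)"
        unfolding set_lebesgue_integral_def
      proof (rule integral_cong_AE)
        show "(\<lambda>x. indicator A x *\<^sub>R g1 x) \<in> borel_measurable lebesgue"
          by (rule measurable_completion) measurable
        show "(\<lambda>x. indicator A x *\<^sub>R g0 x) \<in> borel_measurable lebesgue"
          using g0 that by (intro borel_measurable_scaleR borel_measurable_indicator) auto
        show "AE x in lebesgue. indicator A x *\<^sub>R g1 x = indicator A x *\<^sub>R g0 x"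
          using g1' by eventually_elim simp
      qed
      finally show ?thesis .
    qed
    have box0: "(LINT x:box c d|lebesgue. g0 x) = 0" for c d
    proof -
      obtain l u where lu: "box c d \<inter> box a b = box l u" using box_Int_box by blast
      have "(LINT x:box c d|lebesgue. g0 x) = (LINT x:box l u|lebesgue. g x)"
        unfolding set_lebesgue_integral_def g0_def lu[symmetric]
        by (intro Bochner_Integration.integral_cong) (auto simp: indicator_def)
      also have "\<dots> = 0"
      \<comment> \<open>On a nonempty box, \<open>cbox l u\<close> is the closure of
        \<open>box l u\<close> and hence stays inside \<open>cbox a b\<close>; when the open box is
        empty, the closed one may be a segment elsewhere.\<close>
      proof (cases "box l u = {}")
        case False
        then have "cbox l u = closure (box l u)" by simp
        also have "\<dots> \<subseteq> cbox a b"
          using lu box_subset_cbox by (intro closure_minimal) auto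
        finally show ?thesis using integral_box_eq_0[OF g _ orth] ab by blast
      qed (simp add: set_lebesgue_integral_def)
      finally show ?thesis .
    qed
    have "(\<integral>x. g1 x \<partial>lborel) = (LINT x:UNIV|lborel. g1 x)" by (simp add: set_lebesgue_integral_def)
    also have "\<dots> = (LINT x:UNIV|lebesgue. g0 x)" by (rule trans) simp
    also have "\<dots> = (LINT x:box a b|lebesgue. g0 x)"
      unfolding set_lebesgue_integral_def g0_def
      by (intro Bochner_Integration.integral_cong) (auto simp: indicator_def)
    finally have "(\<integral>x. g1 x \<partial>lborel) = 0" by (simp add: box0)
    then have "AE x in lborel. g1 x = 0"
      by (intro AE_eq_0_if_box_integrals_0 int1) (simp_all add: trans box0)
    then have "AE x in lebesgue. g1 x = 0" by (rule AE_completion)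
    \<comment> \<open>\<open>g0\<close> sees only the open box; the boundary is a null set.\<close>
    moreover have "AE x in lebesgue. x \<notin> cbox a b - box a b"
      using negligible_frontier_interval[of a b]
      by (intro AE_not_in) (simp add: negligible_iff_null_sets)
    ultimately show ?thesis
      using g1' by eventually_elim (auto simp: g0_def indicator_def split: if_splits)
  qed
  obtain D where D: "countable D" "D \<subseteq> Pow \<Omega>" "\<And>X. X \<in> D \<Longrightarrow> \<exists>a b. X = cbox a b" "\<Union>D = \<Omega>"
    by (rule open_countable_Union_open_cbox[OF \<Omega>]) (rule that)
  have "AE x in lebesgue. \<forall>X\<in>D. x \<in> X \<longrightarrow> g x = 0"
    unfolding AE_ball_countable[OF D(1)]
  proof
    fix X assume "X \<in> D"
    then obtain a b where "X = cbox a b" "cbox a b \<subseteq> \<Omega>" using D(2,3) by blast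
    then show "AE x in lebesgue. x \<in> X \<longrightarrow> g x = 0" using on_box by simp
  qed
  then show ?thesis by eventually_elim (use D(4) in blast)
qed

section \<open>Uniqueness of weak derivatives and agreement with classical ones\<close>

lemma has_weak_partial_unique:
  fixes f g1 g2 :: "complex \<Rightarrow> real"
  assumes \<Omega>: "open \<Omega>" and 1: "has_weak_partial \<Omega> e f g1" and 2: "has_weak_partial \<Omega> e f g2"
  shows "AE x in lebesgue. x \<in> \<Omega> \<longrightarrow> g1 x = g2 x"
proof -
  have loc: "g1 \<in> Lp_loc 1 \<Omega>" "g2 \<in> Lp_loc 1 \<Omega>" using 1 2 by (auto simp: has_weak_partial_def)
  have "AE x in lebesgue. x \<in> \<Omega> \<longrightarrow> g1 x - g2 x = 0"
  proof (rule AE_eq_0_if_orthogonal[OF \<Omega>])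
    show "(\<lambda>x. g1 x - g2 x) \<in> Lp_loc 1 \<Omega>"
      using loc by (auto simp: Lp_loc_1_iff intro!: set_integral_diff)
    fix \<phi> assume \<phi>: "\<phi> \<in> test_functions \<Omega>"
    have "set_integrable lebesgue \<Omega> (\<lambda>x. \<phi> x *\<^sub>R g x)" if "g \<in> Lp_loc 1 \<Omega>" for g :: "complex \<Rightarrow> real"
    proof (rule set_integrable_test_mult[OF that test_functions_continuous[OF \<phi>]])
      show "\<phi> x = 0" if "x \<notin> closure {x. \<phi> x \<noteq> 0}" for x
        using that subsetD[OF closure_subset, of x "{x. \<phi> x \<noteq> 0}"] by auto
    qed (use \<phi> in \<open>auto simp: test_functions_def\<close>)
    then show "(LINT x:\<Omega>|lebesgue. \<phi> x *\<^sub>R (g1 x - g2 x)) = 0"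
      using 1 2 \<phi> loc unfolding scaleR_diff_right
      by (subst set_integral_diff) (auto simp: has_weak_partial_def)
  qed
  then show ?thesis by simp
qed

text \<open>Integration by parts without boundary terms: the derivative of the compactly supported
  product \<phi> \<eta> has integral zero by \<open>integral_derivative_eq_0\<close>.\<close>

lemma has_weak_partial_test_function:
  assumes \<eta>: "\<eta> \<in> test_functions \<Omega>"
  shows "has_weak_partial \<Omega> e \<eta> (\<lambda>x. frechet_derivative \<eta> (at x) e)"
  unfolding has_weak_partial_def
proof (intro conjI ballI)
  have loc: "h \<in> Lp_loc 1 \<Omega>" if c: "continuous_on UNIV h" for h :: "complex \<Rightarrow> real"
    unfolding Lp_loc_1_iff set_integrable_def
  proof (intro allI impI)
    fix C assume "compact C \<and> C \<subseteq> \<Omega>"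
    then have "integrable lborel (\<lambda>x. indicator C x *\<^sub>R h x)"
      using borel_integrable_compact[OF _ continuous_on_subset[OF c subset_UNIV]] by blast
    then show "integrable lebesgue (\<lambda>x. indicator C x *\<^sub>R h x)"
      using integrable_completion[OF borel_measurable_integrable] by blast
  qed
  show "\<eta> \<in> Lp_loc 1 \<Omega>" "(\<lambda>x. frechet_derivative \<eta> (at x) e) \<in> Lp_loc 1 \<Omega>"
    using test_functions_continuous[OF \<eta>] test_functions_continuous_derivative[OF \<eta>] by (auto intro: loc)
  fix \<phi> assume \<phi>: "\<phi> \<in> test_functions \<Omega>"
  let ?D = "\<lambda>f x. frechet_derivative f (at x) e"
  have c: "continuous_on UNIV \<eta>" "continuous_on UNIV (?D \<eta>)" "continuous_on UNIV \<phi>" "continuous_on UNIV (?D \<phi>)"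
    using \<eta> \<phi> by (auto intro: test_functions_continuous test_functions_continuous_derivative)
  obtain R where R: "\<And>z. R < norm z \<Longrightarrow> \<eta> z = 0" "\<And>z. R < norm z \<Longrightarrow> frechet_derivative \<eta> (at z) = (\<lambda>_. 0)"
    by (rule test_functions_bounded_support[OF \<eta>]) (rule that)
  have int: "integrable lborel (\<lambda>x. ?D \<phi> x * \<eta> x)" "integrable lborel (\<lambda>x. \<phi> x * ?D \<eta> x)"
    by (rule integrable_continuous_compact_support[where R = R];
        use c in \<open>auto simp: R intro: continuous_on_mult\<close>)+
  have "(\<integral>z. \<phi> z * ?D \<eta> z + ?D \<phi> z * \<eta> z \<partial>lborel) = 0"
  proof (rule integral_derivative_eq_0[where R = R])
    show "((\<lambda>z. \<phi> z * \<eta> z) has_derivative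
        (\<lambda>v. \<phi> z * frechet_derivative \<eta> (at z) v + frechet_derivative \<phi> (at z) v * \<eta> z)) (at z)" for z
      using has_derivative_mult[OF test_functions_has_derivative[OF \<phi>] test_functions_has_derivative[OF \<eta>]] .
    show "continuous_on UNIV (\<lambda>z. \<phi> z * ?D \<eta> z + ?D \<phi> z * \<eta> z)"
      using c by (intro continuous_intros)
  qed (simp add: R)
  then have eq: "(\<integral>z. ?D \<phi> z * \<eta> z \<partial>lborel) = - (\<integral>z. \<phi> z * ?D \<eta> z \<partial>lborel)"
    using int by simp
  have m: "(\<lambda>z. ?D \<phi> z * \<eta> z) \<in> borel_measurable borel" "(\<lambda>z. \<phi> z * ?D \<eta> z) \<in> borel_measurable borel"
    using c by (auto intro!: borel_measurable_continuous_onI continuous_on_mult)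
  show "(LINT x:\<Omega>|lebesgue. ?D \<phi> x *\<^sub>R \<eta> x) = - (LINT x:\<Omega>|lebesgue. \<phi> x *\<^sub>R ?D \<eta> x)"
    using eq set_lebesgue_eq_lborel(2)[OF m(1), of \<Omega>] set_lebesgue_eq_lborel(2)[OF m(2), of \<Omega>]
      test_functions_zero_outside[OF \<phi>] test_functions_zero_outside[OF \<eta>] by simp
qed

lemma has_weak_partial_diff_test:
  fixes f g :: "complex \<Rightarrow> real"
  assumes f: "has_weak_partial \<Omega> e f g" and \<eta>: "\<eta> \<in> test_functions \<Omega>"
  shows "has_weak_partial \<Omega> e (\<lambda>x. f x - \<eta> x) (\<lambda>x. g x - frechet_derivative \<eta> (at x) e)"
proof -
  note h = has_weak_partial_test_function[OF \<eta>, of e]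
  let ?h = "\<lambda>x. frechet_derivative \<eta> (at x) e"
  have loc: "f \<in> Lp_loc 1 \<Omega>" "g \<in> Lp_loc 1 \<Omega>" "\<eta> \<in> Lp_loc 1 \<Omega>" "?h \<in> Lp_loc 1 \<Omega>"
    using f h by (auto simp: has_weak_partial_def)
  show ?thesis
    unfolding has_weak_partial_def
  proof (intro conjI ballI)
    show "(\<lambda>x. f x - \<eta> x) \<in> Lp_loc 1 \<Omega>" "(\<lambda>x. g x - ?h x) \<in> Lp_loc 1 \<Omega>"
      using loc by (auto simp: Lp_loc_1_iff intro!: set_integral_diff)
    fix \<phi> assume \<phi>: "\<phi> \<in> test_functions \<Omega>"
    have C: "compact (closure {x. \<phi> x \<noteq> 0})" "closure {x. \<phi> x \<noteq> 0} \<subseteq> \<Omega>"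
      using \<phi> by (auto simp: test_functions_def)
    have z: "\<phi> x = 0" "frechet_derivative \<phi> (at x) e = 0" if "x \<notin> closure {x. \<phi> x \<noteq> 0}" for x
      using that subsetD[OF closure_subset, of x "{x. \<phi> x \<noteq> 0}"] frechet_derivative_eq_0[OF \<phi> that] by auto
    have i: "set_integrable lebesgue \<Omega> (\<lambda>x. \<phi> x *\<^sub>R u x)"
        "set_integrable lebesgue \<Omega> (\<lambda>x. frechet_derivative \<phi> (at x) e *\<^sub>R u x)"
      if "u \<in> Lp_loc 1 \<Omega>" for u :: "complex \<Rightarrow> real"
      using set_integrable_test_mult[OF that test_functions_continuous[OF \<phi>] C z(1)]
        set_integrable_test_mult[OF that test_functions_continuous_derivative[OF \<phi>, of e] C z(2)] by auto
    show "(LINT x:\<Omega>|lebesgue. frechet_derivative \<phi> (at x) e *\<^sub>R (f x - \<eta> x)) =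
        - (LINT x:\<Omega>|lebesgue. \<phi> x *\<^sub>R (g x - ?h x))"
      unfolding scaleR_diff_right
      using f h \<phi> by (simp add: set_integral_diff i loc has_weak_partial_def del: real_scaleR_def)
  qed
qed

lemma has_weak_gradient_test_function:
  "\<eta> \<in> test_functions \<Omega> \<Longrightarrow> has_weak_gradient \<Omega> \<eta> (grad \<eta>)"
  using has_weak_partial_test_function[of \<eta> \<Omega>] by (simp add: has_weak_gradient_def grad_def)

lemma has_weak_gradient_diff_test:
  "has_weak_gradient \<Omega> f g \<Longrightarrow> \<eta> \<in> test_functions \<Omega> \<Longrightarrow>
    has_weak_gradient \<Omega> (\<lambda>x. f x - \<eta> x) (\<lambda>x. g x - grad \<eta> x)"
  using has_weak_partial_diff_test[of \<Omega> _ f _ \<eta>] by (simp add: has_weak_gradient_def grad_def)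

text \<open>\<open>weak_gradient\<close> is an arbitrary choice; by uniqueness it may be replaced
  almost everywhere by any weak gradient that is known explicitly.\<close>

lemma weak_gradient_AE_eq:
  assumes \<Omega>: "open \<Omega>" and g: "has_weak_gradient \<Omega> f g"
  shows "AE x in lebesgue. x \<in> \<Omega> \<longrightarrow> weak_gradient \<Omega> f x = g x"
proof -
  have "has_weak_gradient \<Omega> f (weak_gradient \<Omega> f)"
    unfolding weak_gradient_def using g by (rule someI[where P = "has_weak_gradient \<Omega> f"])
  then have "AE x in lebesgue. x \<in> \<Omega> \<longrightarrow> Re (weak_gradient \<Omega> f x) = Re (g x)"
      "AE x in lebesgue. x \<in> \<Omega> \<longrightarrow> Im (weak_gradient \<Omega> f x) = Im (g x)"
    using g has_weak_partial_unique[OF \<Omega>] by (auto simp: has_weak_gradient_def)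
  then show ?thesis by eventually_elim (simp add: complex_eq_iff)
qed

section \<open>Passage to the closure of the test functions\<close>

text \<open>Moving the indicator inside the norm reduces everything to functions on the whole plane
  that vanish off \<Omega>, for which the general integral inequalities apply.\<close>

lemma Lp_space_iff:
  "h \<in> Lp_space q \<Omega> \<longleftrightarrow> (\<lambda>x. indicator \<Omega> x *\<^sub>R h x) \<in> borel_measurable lebesgue \<and>
    integrable lebesgue (\<lambda>x. norm (indicator \<Omega> x *\<^sub>R h x) powr q)"
  and Lp_norm_eq: "Lp_norm q \<Omega> h = (\<integral>x. norm (indicator \<Omega> x *\<^sub>R h x) powr q \<partial>lebesgue) powr (1 / q)"
proof -
  have eq: "(\<lambda>x. indicator \<Omega> x *\<^sub>R norm (h x) powr q) = (\<lambda>x. norm (indicator \<Omega> x *\<^sub>R h x) powr q)"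
    by (auto simp: fun_eq_iff indicator_def)
  show "h \<in> Lp_space q \<Omega> \<longleftrightarrow> (\<lambda>x. indicator \<Omega> x *\<^sub>R h x) \<in> borel_measurable lebesgue \<and>
    integrable lebesgue (\<lambda>x. norm (indicator \<Omega> x *\<^sub>R h x) powr q)"
    by (simp only: Lp_space_def set_integrable_def set_borel_measurable_def eq mem_Collect_eq)
  show "Lp_norm q \<Omega> h = (\<integral>x. norm (indicator \<Omega> x *\<^sub>R h x) powr q \<partial>lebesgue) powr (1 / q)"
    by (simp only: Lp_norm_def set_lebesgue_integral_def eq)
qed

lemma Lp_norm_nonneg: "0 \<le> Lp_norm q \<Omega> h"
  by (simp add: Lp_norm_def)

lemma Lp_norm_powr:
  "0 < q \<Longrightarrow> Lp_norm q \<Omega> h powr q = (LINT x:\<Omega>|lebesgue. norm (h x) powr q)"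
  by (simp add: Lp_norm_def powr_powr set_lebesgue_integral_def)

lemma Lp_cong_AE:
  assumes v: "v \<in> Lp_space q \<Omega>" and ae: "AE x in lebesgue. x \<in> \<Omega> \<longrightarrow> u x = v x"
  shows "u \<in> Lp_space q \<Omega>" and "Lp_norm q \<Omega> u = Lp_norm q \<Omega> v"
proof -
  have ae': "AE x in lebesgue. indicator \<Omega> x *\<^sub>R v x = indicator \<Omega> x *\<^sub>R u x"
    using ae by eventually_elim (auto simp: indicator_def)
  have m: "(\<lambda>x. indicator \<Omega> x *\<^sub>R v x) \<in> borel_measurable lebesgue"
    and i: "integrable lebesgue (\<lambda>x. norm (indicator \<Omega> x *\<^sub>R v x) powr q)"
    using v by (auto simp: Lp_space_iff)
  have mu: "(\<lambda>x. indicator \<Omega> x *\<^sub>R u x) \<in> borel_measurable lebesgue"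
    using m ae' by (rule borel_measurable_AE)
  have pm: "(\<lambda>x. norm (h x) powr q) \<in> borel_measurable lebesgue"
    if "h \<in> borel_measurable lebesgue" for h :: "complex \<Rightarrow> 'a"
    using that by measurable
  have ae'': "AE x in lebesgue. norm (indicator \<Omega> x *\<^sub>R v x) powr q = norm (indicator \<Omega> x *\<^sub>R u x) powr q"
    using ae' by eventually_elim (simp only:)
  show "u \<in> Lp_space q \<Omega>"
    using integrable_cong_AE_imp[OF i pm[OF mu] ae''] mu by (simp add: Lp_space_iff)
  show "Lp_norm q \<Omega> u = Lp_norm q \<Omega> v"
    unfolding Lp_norm_eq using integral_cong_AE[OF pm[OF m] pm[OF mu] ae''] by simp
qed

lemma Lp_add:
  assumes q: "1 \<le> q" and u: "u \<in> Lp_space q \<Omega>" and v: "v \<in> Lp_space q \<Omega>"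
  shows "(\<lambda>x. u x + v x) \<in> Lp_space q \<Omega>"
    and "Lp_norm q \<Omega> (\<lambda>x. u x + v x) \<le> Lp_norm q \<Omega> u + Lp_norm q \<Omega> v"
proof -
  let ?u = "\<lambda>x. indicator \<Omega> x *\<^sub>R u x" and ?v = "\<lambda>x. indicator \<Omega> x *\<^sub>R v x"
  have [measurable]: "?u \<in> borel_measurable lebesgue" "?v \<in> borel_measurable lebesgue"
    and i: "integrable lebesgue (\<lambda>x. norm (?u x) powr q)" "integrable lebesgue (\<lambda>x. norm (?v x) powr q)"
    using u v by (auto simp: Lp_space_iff)
  have eq: "indicator \<Omega> x *\<^sub>R (u x + v x) = ?u x + ?v x" for x
    by (rule scaleR_add_right)
  have mink: "integrable lebesgue (\<lambda>x. (norm (?u x) + norm (?v x)) powr q)"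
      "(\<integral>x. (norm (?u x) + norm (?v x)) powr q \<partial>lebesgue) powr (1 / q) \<le>
      (\<integral>x. norm (?u x) powr q \<partial>lebesgue) powr (1 / q) + (\<integral>x. norm (?v x) powr q \<partial>lebesgue) powr (1 / q)"
    by (rule Minkowski_inequality[OF q]; (intro i norm_ge_zero)?; measurable)+
  have le: "norm (?u x + ?v x) powr q \<le> (norm (?u x) + norm (?v x)) powr q" for x
    using q by (intro powr_mono2 norm_triangle_ineq) auto
  have i3: "integrable lebesgue (\<lambda>x. norm (?u x + ?v x) powr q)"
    by (rule Bochner_Integration.integrable_bound[OF mink(1)]) (use le in auto)
  show "(\<lambda>x. u x + v x) \<in> Lp_space q \<Omega>"
    unfolding Lp_space_iff eq by (rule conjI[OF _ i3]) measurable
  have "(\<integral>x. norm (?u x + ?v x) powr q \<partial>lebesgue) powr (1 / q) \<le>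
      (\<integral>x. (norm (?u x) + norm (?v x)) powr q \<partial>lebesgue) powr (1 / q)"
    using q by (intro powr_mono2 integral_mono i3 mink(1) le) auto
  with mink(2) show "Lp_norm q \<Omega> (\<lambda>x. u x + v x) \<le> Lp_norm q \<Omega> u + Lp_norm q \<Omega> v"
    unfolding Lp_norm_eq eq by linarith
qed

lemma Lp_minus:
  shows "(\<lambda>x. - u x) \<in> Lp_space q \<Omega> \<longleftrightarrow> u \<in> Lp_space q \<Omega>"
    and "Lp_norm q \<Omega> (\<lambda>x. - u x) = Lp_norm q \<Omega> u"
proof -
  have *: "(\<lambda>x. - indicator \<Omega> x *\<^sub>R u x) \<in> borel_measurable lebesgue \<longleftrightarrow>
      (\<lambda>x. indicator \<Omega> x *\<^sub>R u x) \<in> borel_measurable lebesgue"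
    using borel_measurable_uminus[of "\<lambda>x. indicator \<Omega> x *\<^sub>R u x" lebesgue]
      borel_measurable_uminus[of "\<lambda>x. - indicator \<Omega> x *\<^sub>R u x" lebesgue] by auto
  then show "(\<lambda>x. - u x) \<in> Lp_space q \<Omega> \<longleftrightarrow> u \<in> Lp_space q \<Omega>"
    by (simp add: Lp_space_iff)
  show "Lp_norm q \<Omega> (\<lambda>x. - u x) = Lp_norm q \<Omega> u"
    by (simp add: Lp_norm_def)
qed

lemma Lp_diff:
  assumes q: "1 \<le> q" and u: "u \<in> Lp_space q \<Omega>" and v: "v \<in> Lp_space q \<Omega>"
  shows "(\<lambda>x. u x - v x) \<in> Lp_space q \<Omega>"
    and "Lp_norm q \<Omega> (\<lambda>x. u x - v x) \<le> Lp_norm q \<Omega> u + Lp_norm q \<Omega> v"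
  using Lp_add[OF q u, of "\<lambda>x. - v x"] v by (simp_all add: Lp_minus)

lemma Lp_test_function:
  assumes \<phi>: "\<phi> \<in> test_functions \<Omega>" and q: "0 < q"
  shows "\<phi> \<in> Lp_space q \<Omega>" and "grad \<phi> \<in> Lp_space q \<Omega>"
    and "Lp_norm q \<Omega> \<phi> = (\<integral>x. \<bar>\<phi> x\<bar> powr q \<partial>lborel) powr (1 / q)"
    and "Lp_norm q \<Omega> (grad \<phi>) = (\<integral>x. norm (grad \<phi> x) powr q \<partial>lborel) powr (1 / q)"
proof -
  have [measurable]: "\<phi> \<in> borel_measurable borel" "grad \<phi> \<in> borel_measurable borel"
    using test_functions_continuous[OF \<phi>] test_functions_continuous_grad[OF \<phi>]
    by (auto intro: borel_measurable_continuous_onI)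
  note z = test_functions_zero_outside[OF \<phi>]
  have m: "(\<lambda>x. \<bar>\<phi> x\<bar> powr q) \<in> borel_measurable borel" "(\<lambda>x. norm (grad \<phi> x) powr q) \<in> borel_measurable borel"
    by measurable
  show "\<phi> \<in> Lp_space q \<Omega>"
    using integrable_powr_test_function(1)[OF \<phi> q] set_lebesgue_eq_lborel(1)[OF m(1), of \<Omega>]
      set_lebesgue_eq_lborel(3)[of \<phi> \<Omega>] z by (simp add: Lp_space_def)
  show "grad \<phi> \<in> Lp_space q \<Omega>"
    using integrable_powr_test_function(2)[OF \<phi> q] set_lebesgue_eq_lborel(1)[OF m(2), of \<Omega>]
      set_lebesgue_eq_lborel(3)[of "grad \<phi>" \<Omega>] z by (simp add: Lp_space_def)
  show "Lp_norm q \<Omega> \<phi> = (\<integral>x. \<bar>\<phi> x\<bar> powr q \<partial>lborel) powr (1 / q)"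
    using set_lebesgue_eq_lborel(2)[OF m(1), of \<Omega>] z by (simp add: Lp_norm_def)
  show "Lp_norm q \<Omega> (grad \<phi>) = (\<integral>x. norm (grad \<phi> x) powr q \<partial>lborel) powr (1 / q)"
    using set_lebesgue_eq_lborel(2)[OF m(2), of \<Omega>] z by (simp add: Lp_norm_def)
qed

lemma weak_gradient_test_function:
  assumes "open \<Omega>" and \<phi>: "\<phi> \<in> test_functions \<Omega>" and "0 < q"
  shows "weak_gradient \<Omega> \<phi> \<in> Lp_space q \<Omega>"
    and "Lp_norm q \<Omega> (weak_gradient \<Omega> \<phi>) = Lp_norm q \<Omega> (grad \<phi>)"
  using Lp_cong_AE[OF Lp_test_function(2)[OF \<phi> \<open>0 < q\<close>]
      weak_gradient_AE_eq[OF \<open>open \<Omega>\<close> has_weak_gradient_test_function[OF \<phi>]]] by auto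

lemma test_functions_subset_W1p_0:
  assumes \<Omega>: "open \<Omega>" and \<phi>: "\<phi> \<in> test_functions \<Omega>" and q: "0 < q"
  shows "\<phi> \<in> W1p_0 q \<Omega>"
proof -
  \<comment> \<open>\<phi> serves as its own approximation, but the gradient chosen for the zero
    function is known to vanish only almost everywhere.\<close>
  have "AE x in lebesgue. x \<in> \<Omega> \<longrightarrow> weak_gradient \<Omega> (\<lambda>x. \<phi> x - \<phi> x) x = grad \<phi> x - grad \<phi> x"
    by (intro weak_gradient_AE_eq[OF \<Omega>] has_weak_gradient_diff_test
        has_weak_gradient_test_function \<phi>)
  moreover have "(\<lambda>_. 0) \<in> Lp_space q \<Omega>" by (simp add: Lp_space_iff)
  ultimately have "Lp_norm q \<Omega> (weak_gradient \<Omega> (\<lambda>x. \<phi> x - \<phi> x)) = Lp_norm q \<Omega> (\<lambda>_. 0 :: complex)"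
    by (intro Lp_cong_AE(2)) auto
  then have "W1p_norm q \<Omega> (\<lambda>x. \<phi> x - \<phi> x) = 0"
    by (simp add: W1p_norm_def Lp_norm_eq)
  then show ?thesis
    using \<phi> Lp_test_function(1)[OF \<phi> q] weak_gradient_test_function(1)[OF \<Omega> \<phi> q]
      has_weak_gradient_test_function[OF \<phi>]
    by (auto simp: W1p_0_def W1p_def intro!: bexI[of _ \<phi>])
qed

text \<open>The norm in \<open>W1p_0\<close> involves the gradient chosen for f - \<phi>, which
  agrees almost everywhere with the difference of the gradients; the triangle inequality then bounds
  \<open>grad \<phi>\<close>.\<close>

lemma W1p_0_approx:
  assumes \<Omega>: "open \<Omega>" and f: "f \<in> W1p_0 q \<Omega>" and q: "1 \<le> q" and e: "0 < e"
  obtains \<phi> where "\<phi> \<in> test_functions \<Omega>" and "(\<lambda>x. f x - \<phi> x) \<in> Lp_space q \<Omega>"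
    and "Lp_norm q \<Omega> (\<lambda>x. f x - \<phi> x) < e"
    and "Lp_norm q \<Omega> (grad \<phi>) \<le> Lp_norm q \<Omega> (weak_gradient \<Omega> f) + e"
proof -
  have fL: "f \<in> Lp_space q \<Omega>" "weak_gradient \<Omega> f \<in> Lp_space q \<Omega>"
    and g: "\<exists>g. has_weak_gradient \<Omega> f g"
    using f by (auto simp: W1p_0_def W1p_def)
  have w: "has_weak_gradient \<Omega> f (weak_gradient \<Omega> f)"
    unfolding weak_gradient_def using g by (rule someI_ex)
  obtain \<phi> where \<phi>: "\<phi> \<in> test_functions \<Omega>" and lt: "W1p_norm q \<Omega> (\<lambda>x. f x - \<phi> x) < e"
    using f e by (auto simp: W1p_0_def)
  have \<phi>L: "\<phi> \<in> Lp_space q \<Omega>" "grad \<phi> \<in> Lp_space q \<Omega>"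
    using Lp_test_function[OF \<phi>, of q] q by auto
  have dL: "(\<lambda>x. weak_gradient \<Omega> f x - grad \<phi> x) \<in> Lp_space q \<Omega>"
    by (rule Lp_diff(1)[OF q fL(2) \<phi>L(2)])
  have "Lp_norm q \<Omega> (weak_gradient \<Omega> (\<lambda>x. f x - \<phi> x)) = Lp_norm q \<Omega> (\<lambda>x. weak_gradient \<Omega> f x - grad \<phi> x)"
    by (rule Lp_cong_AE(2)[OF dL weak_gradient_AE_eq[OF \<Omega> has_weak_gradient_diff_test[OF w \<phi>]]])
  then have lt2: "Lp_norm q \<Omega> (\<lambda>x. f x - \<phi> x) + Lp_norm q \<Omega> (\<lambda>x. weak_gradient \<Omega> f x - grad \<phi> x) < e"
    using lt by (simp add: W1p_norm_def)
  have "Lp_norm q \<Omega> (\<lambda>x. weak_gradient \<Omega> f x - (weak_gradient \<Omega> f x - grad \<phi> x)) \<le>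
      Lp_norm q \<Omega> (weak_gradient \<Omega> f) + Lp_norm q \<Omega> (\<lambda>x. weak_gradient \<Omega> f x - grad \<phi> x)"
    by (rule Lp_diff(2)[OF q fL(2) dL])
  then have "Lp_norm q \<Omega> (grad \<phi>) \<le> Lp_norm q \<Omega> (weak_gradient \<Omega> f) + e"
    using lt2 Lp_norm_nonneg[of q \<Omega> "\<lambda>x. f x - \<phi> x"] by simp
  moreover have "Lp_norm q \<Omega> (\<lambda>x. f x - \<phi> x) < e"
    using lt2 Lp_norm_nonneg[of q \<Omega> "\<lambda>x. weak_gradient \<Omega> f x - grad \<phi> x"] by simp
  ultimately show ?thesis
    using that[OF \<phi> Lp_diff(1)[OF q fL(1) \<phi>L(1)]] by simp
qed

text \<open>The approximations converge only in L^q, so the L^r bound passes to the limit by Fatou's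
  lemma along a subsequence converging almost everywhere. This also yields membership in
  L^r.\<close>

lemma W1p_0_sobolev:
  assumes \<Omega>: "open \<Omega>" and f: "f \<in> W1p_0 q \<Omega>" and q: "1 \<le> q" and r: "0 < r" and C: "0 \<le> C"
    and test: "\<And>\<phi>. \<phi> \<in> test_functions \<Omega> \<Longrightarrow> Lp_norm r \<Omega> \<phi> \<le> C * Lp_norm q \<Omega> (grad \<phi>)"
  shows "f \<in> Lp_space r \<Omega>" and "Lp_norm r \<Omega> f \<le> C * Lp_norm q \<Omega> (weak_gradient \<Omega> f)"
proof -
  define h where "h n = 1 / real (Suc n)" for n
  have h: "0 < h n" for n by (simp add: h_def)
  have h0: "h \<longlonglongrightarrow> 0"
    using LIMSEQ_inverse_real_of_nat by (simp add: h_def[abs_def] inverse_eq_divide)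
  define W where "W = Lp_norm q \<Omega> (weak_gradient \<Omega> f)"
  have "\<forall>n. \<exists>\<phi>. \<phi> \<in> test_functions \<Omega> \<and> (\<lambda>x. f x - \<phi> x) \<in> Lp_space q \<Omega> \<and>
      Lp_norm q \<Omega> (\<lambda>x. f x - \<phi> x) < h n \<and> Lp_norm q \<Omega> (grad \<phi>) \<le> W + h n"
    unfolding W_def using W1p_0_approx[OF \<Omega> f q h] by metis
  then obtain \<phi> where \<phi>: "\<And>n. \<phi> n \<in> test_functions \<Omega>"
    and dL: "\<And>n. (\<lambda>x. f x - \<phi> n x) \<in> Lp_space q \<Omega>"
    and d: "\<And>n. Lp_norm q \<Omega> (\<lambda>x. f x - \<phi> n x) < h n"
    and g: "\<And>n. Lp_norm q \<Omega> (grad (\<phi> n)) \<le> W + h n"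
    by metis
  define u where "u n x = norm (indicator \<Omega> x *\<^sub>R (f x - \<phi> n x)) powr q" for n x
  have ui: "integrable lebesgue (u n)" for n
    using dL unfolding Lp_space_iff u_def[abs_def] by blast
  have "(\<lambda>n. \<integral>x. norm (u n x) \<partial>lebesgue) \<longlonglongrightarrow> 0"
  proof (rule tendsto_sandwich[OF _ _ tendsto_const])
    show "(\<lambda>n. h n powr q) \<longlonglongrightarrow> 0"
      using q tendsto_powr'[OF h0 tendsto_const[of q] disjI2] h
      by (simp add: less_imp_le)
    show "\<forall>\<^sub>F n in sequentially. (\<integral>x. norm (u n x) \<partial>lebesgue) \<le> h n powr q"
    proof (intro always_eventually allI)
      fix n
      have "(\<integral>x. norm (u n x) \<partial>lebesgue) = Lp_norm q \<Omega> (\<lambda>x. f x - \<phi> n x) powr q"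
        using q by (simp add: Lp_norm_eq u_def powr_powr)
      also have "\<dots> \<le> h n powr q"
        using d[of n] q Lp_norm_nonneg by (intro powr_mono2) auto
      finally show "(\<integral>x. norm (u n x) \<partial>lebesgue) \<le> h n powr q" .
    qed
  qed auto
  then obtain s where s: "strict_mono s" and su: "AE x in lebesgue. (\<lambda>n. u (s n) x) \<longlonglongrightarrow> 0"
    using tendsto_L1_AE_subseq[of lebesgue u, OF ui] by blast
  have conv: "AE x in lebesgue. (\<lambda>n. norm (indicator \<Omega> x *\<^sub>R \<phi> (s n) x) powr r)
      \<longlonglongrightarrow> norm (indicator \<Omega> x *\<^sub>R f x) powr r"
    using su
  proof eventually_elim
    fix x assume "(\<lambda>n. u (s n) x) \<longlonglongrightarrow> 0"
    then have "(\<lambda>n. u (s n) x powr (1 / q)) \<longlonglongrightarrow> 0 powr (1 / q)"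
      using q by (intro tendsto_powr' tendsto_const) (auto simp: u_def)
    then have "(\<lambda>n. norm (indicator \<Omega> x *\<^sub>R (f x - \<phi> (s n) x))) \<longlonglongrightarrow> 0"
      using q by (simp add: u_def powr_powr)
    then have "(\<lambda>n. indicator \<Omega> x *\<^sub>R f x - indicator \<Omega> x *\<^sub>R (f x - \<phi> (s n) x)) \<longlonglongrightarrow> indicator \<Omega> x *\<^sub>R f x - 0"
      by (intro tendsto_diff tendsto_const) (simp only: tendsto_norm_zero_iff)
    then have "(\<lambda>n. indicator \<Omega> x *\<^sub>R \<phi> (s n) x) \<longlonglongrightarrow> indicator \<Omega> x *\<^sub>R f x"
      by (simp add: algebra_simps)
    then show "(\<lambda>n. norm (indicator \<Omega> x *\<^sub>R \<phi> (s n) x) powr r) \<longlonglongrightarrow> norm (indicator \<Omega> x *\<^sub>R f x) powr r"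
      using r by (intro tendsto_powr' tendsto_norm tendsto_const) auto
  qed
  have \<phi>r: "(\<integral>\<^sup>+x. ennreal (norm (indicator \<Omega> x *\<^sub>R \<phi> n x) powr r) \<partial>lebesgue) \<le> ennreal ((C * (W + h n)) powr r)" for n
  proof -
    have "\<phi> n \<in> Lp_space r \<Omega>" by (rule Lp_test_function(1)[OF \<phi> r])
    then have "(\<integral>\<^sup>+x. ennreal (norm (indicator \<Omega> x *\<^sub>R \<phi> n x) powr r) \<partial>lebesgue) =
        ennreal (Lp_norm r \<Omega> (\<phi> n) powr r)"
      using r unfolding Lp_space_iff Lp_norm_eq
      by (subst nn_integral_eq_integral) (auto simp: powr_powr)
    also have "Lp_norm r \<Omega> (\<phi> n) powr r \<le> (C * (W + h n)) powr r"
    proof (rule powr_mono2)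
      show "Lp_norm r \<Omega> (\<phi> n) \<le> C * (W + h n)"
        using test[OF \<phi>, of n] mult_left_mono[OF g C, of n] by linarith
    qed (use r Lp_norm_nonneg in auto)
    finally show ?thesis by (simp add: ennreal_leI)
  qed
  have "W \<ge> 0" by (simp add: W_def Lp_norm_nonneg)
  have "f \<in> Lp_space q \<Omega>" using f by (auto simp: W1p_0_def W1p_def)
  then have fm: "(\<lambda>x. indicator \<Omega> x *\<^sub>R f x) \<in> borel_measurable lebesgue" by (simp add: Lp_space_iff)
  have lim: "(\<integral>\<^sup>+x. ennreal (norm (indicator \<Omega> x *\<^sub>R f x) powr r) \<partial>lebesgue) \<le> ennreal ((C * W) powr r)"
  proof -
    have "(\<integral>\<^sup>+x. ennreal (norm (indicator \<Omega> x *\<^sub>R f x) powr r) \<partial>lebesgue) =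
        (\<integral>\<^sup>+x. liminf (\<lambda>n. ennreal (norm (indicator \<Omega> x *\<^sub>R \<phi> (s n) x) powr r)) \<partial>lebesgue)"
    proof (rule nn_integral_cong_AE)
      show "AE x in lebesgue. ennreal (norm (indicator \<Omega> x *\<^sub>R f x) powr r) =
          liminf (\<lambda>n. ennreal (norm (indicator \<Omega> x *\<^sub>R \<phi> (s n) x) powr r))"
        using conv
      proof eventually_elim
        case (elim x)
        then have "(\<lambda>n. ennreal (norm (indicator \<Omega> x *\<^sub>R \<phi> (s n) x) powr r))
            \<longlonglongrightarrow> ennreal (norm (indicator \<Omega> x *\<^sub>R f x) powr r)"
          by (rule tendsto_ennrealI)
        then show ?case by (intro lim_imp_Liminf[symmetric]) auto
      qed
    qed
    also have "\<dots> \<le> liminf (\<lambda>n. \<integral>\<^sup>+x. ennreal (norm (indicator \<Omega> x *\<^sub>R \<phi> (s n) x) powr r) \<partial>lebesgue)"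
    proof (rule nn_integral_liminf)
      fix n
      have "(\<lambda>x. indicator \<Omega> x *\<^sub>R \<phi> (s n) x) \<in> borel_measurable lebesgue"
        using Lp_test_function(1)[OF \<phi> r] by (simp add: Lp_space_iff)
      then show "(\<lambda>x. ennreal (norm (indicator \<Omega> x *\<^sub>R \<phi> (s n) x) powr r)) \<in> borel_measurable lebesgue"
        by measurable
    qed
    also have "\<dots> \<le> liminf (\<lambda>n. ennreal ((C * (W + h (s n))) powr r))"
      by (intro Liminf_mono always_eventually allI \<phi>r)
    also have "\<dots> = ennreal ((C * W) powr r)"
    proof (rule lim_imp_Liminf)
      have "(\<lambda>n. h (s n)) \<longlonglongrightarrow> 0"
        using LIMSEQ_subseq_LIMSEQ[OF h0 s] by (simp add: o_def)
      then have "(\<lambda>n. (C * (W + h (s n))) powr r) \<longlonglongrightarrow> (C * (W + 0)) powr r"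
        by (intro tendsto_powr' tendsto_mult tendsto_add tendsto_const disjI2 conjI
            always_eventually allI mult_nonneg_nonneg add_nonneg_nonneg)
          (use r C \<open>W \<ge> 0\<close> h in \<open>auto simp: less_imp_le\<close>)
      then show "(\<lambda>n. ennreal ((C * (W + h (s n))) powr r)) \<longlonglongrightarrow> ennreal ((C * W) powr r)"
        by (intro tendsto_ennrealI) simp
    qed simp
    finally show ?thesis .
  qed
  have fi: "integrable lebesgue (\<lambda>x. norm (indicator \<Omega> x *\<^sub>R f x) powr r)"
  proof (rule integrableI_bounded)
    show "(\<lambda>x. norm (indicator \<Omega> x *\<^sub>R f x) powr r) \<in> borel_measurable lebesgue"
      using fm by measurable
    show "(\<integral>\<^sup>+x. ennreal (norm (norm (indicator \<Omega> x *\<^sub>R f x) powr r)) \<partial>lebesgue) < \<infinity>"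
      using le_less_trans[OF lim] by simp
  qed
  then show "f \<in> Lp_space r \<Omega>" using fm by (simp add: Lp_space_iff)
  have "(\<integral>x. norm (indicator \<Omega> x *\<^sub>R f x) powr r \<partial>lebesgue) \<le> (C * W) powr r"
    using lim nn_integral_eq_integral[OF fi] by (simp add: ennreal_le_iff)
  then have "Lp_norm r \<Omega> f \<le> ((C * W) powr r) powr (1 / r)"
    unfolding Lp_norm_eq using r by (intro powr_mono2) auto
  then show "Lp_norm r \<Omega> f \<le> C * Lp_norm q \<Omega> (weak_gradient \<Omega> f)"
    using r C \<open>W \<ge> 0\<close> by (simp add: powr_powr W_def)
qed

section \<open>Bounds for the eigenvalue and the Sobolev--Poincare constant\<close>

lemma measure_borel_bounded_open:
  assumes \<Omega>: "open \<Omega>" "bounded \<Omega>" "\<Omega> \<noteq> {}"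
  shows "\<Omega> \<in> sets borel" and "emeasure lborel \<Omega> < \<infinity>" and "0 < measure lborel \<Omega>"
    and "measure lebesgue \<Omega> = measure lborel \<Omega>"
proof -
  show b: "\<Omega> \<in> sets borel" using \<Omega> by simp
  show fin: "emeasure lborel \<Omega> < \<infinity>"
    using emeasure_bounded_finite[OF \<Omega>(2)] by simp
  show eq: "measure lebesgue \<Omega> = measure lborel \<Omega>" using b by simp
  have "\<not> negligible \<Omega>" using \<Omega> open_not_negligible by blast
  moreover have "\<Omega> \<in> lmeasurable" using \<Omega> by (simp add: lmeasurable_open)
  ultimately have "measure lebesgue \<Omega> \<noteq> 0" using negligible_iff_measure0 by blast
  then show "0 < measure lborel \<Omega>" unfolding eq by (simp add: zero_less_measure_iff)
qed

context test_function_on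
begin

lemma Lp_norm_poincare:
  assumes "2 < p"
  shows "Lp_norm p \<Omega> \<phi> \<le> 81 * sqrt (measure lborel \<Omega>) * Lp_norm p \<Omega> (grad \<phi>)"
proof -
  let ?V = "measure lborel \<Omega>"
  define I where "I = (\<integral>z. \<bar>\<phi> z\<bar> powr p \<partial>lborel)"
  define J where "J = (\<integral>z. norm (grad \<phi> z) powr p \<partial>lborel)"
  have "(I / ?V) powr (1 / p) \<le> 81 * (sqrt ?V * (J / ?V) powr (1 / p))"
    using poincare[OF assms] by (simp add: G_def avg_norm_def I_def J_def)
  moreover have "0 \<le> I" "0 \<le> J" by (auto simp: I_def J_def)
  ultimately have "I powr (1 / p) \<le> 81 * (sqrt ?V * J powr (1 / p))"
    using pos_\<Omega> by (simp add: powr_divide divide_le_cancel)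
  then show ?thesis
    using Lp_test_function[OF \<phi>, of p] assms by (simp add: I_def J_def)
qed

text \<open>The size of this constant is immaterial later on: it shows that some admissible constant
  exists for (r, q).\<close>

lemma Lp_norm_sobolev:
  assumes r: "2 < r" and q: "1 < q" and qr: "(r / 2 - 1) * (q / (q - 1)) \<le> r"
  shows "Lp_norm r \<Omega> \<phi> \<le>
    r / 4 * sqrt (measure lborel \<Omega>) * measure lborel \<Omega> powr (1 / r - 1 / q) * Lp_norm q \<Omega> (grad \<phi>)"
proof -
  let ?V = "measure lborel \<Omega>"
  define I where "I = (\<integral>z. \<bar>\<phi> z\<bar> powr r \<partial>lborel)"
  define J where "J = (\<integral>z. norm (grad \<phi> z) powr q \<partial>lborel)"
  have "(I / ?V) powr (1 / r) \<le> r / 4 * (sqrt ?V * (J / ?V) powr (1 / q))"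
    using sobolev[OF assms] by (simp add: G_def avg_norm_def I_def J_def)
  then have "(I / ?V) powr (1 / r) * ?V powr (1 / r) \<le> r / 4 * (sqrt ?V * (J / ?V) powr (1 / q)) * ?V powr (1 / r)"
    by (intro mult_right_mono) auto
  moreover have "0 \<le> I" "0 \<le> J" by (auto simp: I_def J_def)
  ultimately have "I powr (1 / r) \<le> r / 4 * sqrt ?V * ?V powr (1 / r - 1 / q) * J powr (1 / q)"
    using pos_\<Omega> by (simp add: powr_divide powr_diff mult_ac)
  then show ?thesis
    using Lp_test_function[OF \<phi>, of r] Lp_test_function[OF \<phi>, of q] assms by (simp add: I_def J_def)
qed

end

text \<open>Makes the infimum in \<open>lambda_p\<close> range over a nonempty set.\<close>

lemma exists_nonzero_test_function:
  assumes "open \<Omega>" and "\<Omega> \<noteq> {}"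
  obtains \<phi> where "\<phi> \<in> test_functions \<Omega>" and "\<not> (AE x in lebesgue. x \<in> \<Omega> \<longrightarrow> \<phi> x = 0)"
proof -
  obtain z where "z \<in> \<Omega>" using assms by blast
  then obtain a b where ab: "z \<in> box a b" "cbox a b \<subseteq> \<Omega>"
    by (rule open_contains_cbox[OF assms(1)]) (rule that)
  show ?thesis
  proof (rule that)
    show "box_cutoff a b 1 \<in> test_functions \<Omega>" by (rule box_cutoff_test_function[OF ab(2)])
    show "\<not> (AE x in lebesgue. x \<in> \<Omega> \<longrightarrow> box_cutoff a b 1 x = 0)"
    proof
      assume "AE x in lebesgue. x \<in> \<Omega> \<longrightarrow> box_cutoff a b 1 x = 0"
      then have "AE x in lebesgue. x \<notin> box a b"
      proof eventually_elim
        case (elim x)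
        have "x \<in> \<Omega>" "0 < box_bump a b x" if "x \<in> box a b"
          using that ab(2) box_subset_cbox by (auto simp: box_bump_pos_iff)
        then show ?case using elim by (auto simp: box_cutoff_def)
      qed
      then have "negligible (box a b)"
        by (simp add: negligible_iff_null_sets AE_iff_null_sets)
      then show False using open_not_negligible[OF open_box] ab(1) by blast
    qed
  qed
qed

lemma lambda_p_ge:
  assumes \<Omega>: "open \<Omega>" "bounded \<Omega>" "\<Omega> \<noteq> {}" and p: "2 < p"
  shows "1 / (81 powr p * measure lebesgue \<Omega> powr (p / 2)) \<le> lambda_p p \<Omega>"
proof -
  note m = measure_borel_bounded_open[OF \<Omega>]
  define C where "C = 81 * sqrt (measure lborel \<Omega>)"
  have C: "0 < C" using m by (simp add: C_def)
  have Cp: "C powr p = 81 powr p * measure lebesgue \<Omega> powr (p / 2)"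
    using m by (simp add: C_def powr_mult powr_half_sqrt[symmetric] powr_powr)
  have test: "Lp_norm p \<Omega> \<phi> \<le> C * Lp_norm p \<Omega> (grad \<phi>)" if "\<phi> \<in> test_functions \<Omega>" for \<phi>
  proof -
    interpret test_function_on \<Omega> \<phi> using that m by unfold_locales auto
    show ?thesis using Lp_norm_poincare[OF p] by (simp add: C_def)
  qed
  let ?S = "{f \<in> W1p_0 p \<Omega>. \<not> (AE x in lebesgue. x \<in> \<Omega> \<longrightarrow> f x = 0)}"
  show ?thesis
    unfolding lambda_p_def
  proof (rule cINF_greatest)
    obtain \<phi> where "\<phi> \<in> test_functions \<Omega>" "\<not> (AE x in lebesgue. x \<in> \<Omega> \<longrightarrow> \<phi> x = 0)"
      by (rule exists_nonzero_test_function[OF \<Omega>(1,3)])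
    then show "?S \<noteq> {}"
      using test_functions_subset_W1p_0[OF \<Omega>(1), of \<phi> p] p by auto
    fix f assume "f \<in> ?S"
    then have f: "f \<in> W1p_0 p \<Omega>" and nz: "\<not> (AE x in lebesgue. x \<in> \<Omega> \<longrightarrow> f x = 0)" by auto
    have fL: "f \<in> Lp_space p \<Omega>" using f by (auto simp: W1p_0_def W1p_def)
    let ?N = "LINT x:\<Omega>|lebesgue. \<bar>f x\<bar> powr p"
    let ?G = "LINT x:\<Omega>|lebesgue. norm (weak_gradient \<Omega> f x) powr p"
    have int: "integrable lebesgue (\<lambda>x. indicator \<Omega> x *\<^sub>R \<bar>f x\<bar> powr p)"
      using fL by (simp add: Lp_space_def set_integrable_def)
    \<comment> \<open>A zero denominator would give the quotient the value 0, so its positivity is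
      drawn from f not vanishing almost everywhere.\<close>
    have "?N \<noteq> 0"
    proof
      assume "?N = 0"
      then have "AE x in lebesgue. indicator \<Omega> x *\<^sub>R \<bar>f x\<bar> powr p = 0"
        using integral_nonneg_eq_0_iff_AE[OF int] by (simp add: set_lebesgue_integral_def)
      then have "AE x in lebesgue. x \<in> \<Omega> \<longrightarrow> f x = 0"
        by eventually_elim (auto simp: indicator_eq_0_iff)
      then show False using nz by blast
    qed
    moreover have "0 \<le> ?N" by (simp add: set_lebesgue_integral_def)
    ultimately have N: "0 < ?N" by linarith
    have "Lp_norm p \<Omega> f \<le> C * Lp_norm p \<Omega> (weak_gradient \<Omega> f)"
      using p C by (intro W1p_0_sobolev(2)[OF \<Omega>(1) f] test) auto
    then have "Lp_norm p \<Omega> f powr p \<le> (C * Lp_norm p \<Omega> (weak_gradient \<Omega> f)) powr p"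
      using p Lp_norm_nonneg by (intro powr_mono2) auto
    then have "?N \<le> C powr p * ?G"
      using p C Lp_norm_powr[of p \<Omega> f] Lp_norm_powr[of p \<Omega> "weak_gradient \<Omega> f"] Lp_norm_nonneg
      by (simp add: powr_mult)
    then have "1 / C powr p \<le> ?G / ?N"
      using N C by (simp add: field_simps)
    then show "1 / (81 powr p * measure lebesgue \<Omega> powr (p / 2)) \<le> ?G / ?N"
      by (simp add: Cp)
  qed
qed

text \<open>Every admissible constant is at least the quotient attained by \<phi>. The exponent
  condition enters through \<open>Lp_norm_sobolev\<close>, which shows that the set under
  \<open>Inf\<close> is nonempty.\<close>

lemma sobolev_poincare_const_ge:
  assumes \<Omega>: "open \<Omega>" "bounded \<Omega>" "\<Omega> \<noteq> {}" and r: "2 < r" and q: "1 < q" and qr: "(r / 2 - 1) * (q / (q - 1)) \<le> r"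
    and \<phi>: "\<phi> \<in> test_functions \<Omega>" and bound: "Lp_norm q \<Omega> (grad \<phi>) \<le> B" "0 < B"
  shows "Lp_norm r \<Omega> \<phi> / B \<le> sobolev_poincare_const r q \<Omega>"
  unfolding sobolev_poincare_const_def
proof (rule cInf_greatest)
  note m = measure_borel_bounded_open[OF \<Omega>]
  let ?S = "{C. 0 \<le> C \<and> (\<forall>f\<in>W1p_0 q \<Omega>. f \<in> Lp_space r \<Omega> \<and> Lp_norm r \<Omega> f \<le> C * Lp_norm q \<Omega> (weak_gradient \<Omega> f))}"
  define C where "C = r / 4 * sqrt (measure lborel \<Omega>) * measure lborel \<Omega> powr (1 / r - 1 / q)"
  have test: "Lp_norm r \<Omega> \<eta> \<le> C * Lp_norm q \<Omega> (grad \<eta>)" if "\<eta> \<in> test_functions \<Omega>" for \<eta>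
  proof -
    interpret test_function_on \<Omega> \<eta> using that m by unfold_locales auto
    show ?thesis using Lp_norm_sobolev[OF r q qr] by (simp add: C_def)
  qed
  have C: "0 \<le> C" using r by (simp add: C_def)
  have "f \<in> Lp_space r \<Omega> \<and> Lp_norm r \<Omega> f \<le> C * Lp_norm q \<Omega> (weak_gradient \<Omega> f)"
    if "f \<in> W1p_0 q \<Omega>" for f
    using W1p_0_sobolev[OF \<Omega>(1) that _ _ C test] r q by auto
  with C have "C \<in> ?S" by blast
  then show "?S \<noteq> {}" by blast
  fix D assume "D \<in> ?S"
  then have D: "0 \<le> D" "Lp_norm r \<Omega> \<phi> \<le> D * Lp_norm q \<Omega> (weak_gradient \<Omega> \<phi>)"
    using test_functions_subset_W1p_0[OF \<Omega>(1) \<phi>] q by auto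
  then have "Lp_norm r \<Omega> \<phi> \<le> D * Lp_norm q \<Omega> (grad \<phi>)"
    using weak_gradient_test_function(2)[OF \<Omega>(1) \<phi>, of q] q by simp
  also have "\<dots> \<le> D * B" using D bound by (intro mult_left_mono) auto
  finally show "Lp_norm r \<Omega> \<phi> / B \<le> D" using bound by (simp add: divide_le_eq)
qed

section \<open>A logarithmic test function\<close>

lemma t_flat_has_derivative:
  "((\<lambda>t. t * flat t) has_real_derivative (if t \<le> 0 then 0 else exp (- (1 / t)) * (1 + 1 / t))) (at t)"
proof -
  have "(flat has_real_derivative flat_exp [:0, 0, 1:] t) (at t)"
    using flat_exp_has_derivative[of 1 t] by (simp add: flat_eq_flat_exp pderiv_1)
  from DERIV_mult[OF DERIV_ident this]
  show ?thesis
    by (rule DERIV_cong) (auto simp: flat_exp_def flat_def field_simps power2_eq_square)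
qed

text \<open>The upper bound is 1 + x \<le> exp x at x = 1/t; because of it the truncation does not
  enlarge gradients.\<close>

lemma t_flat_derivative_bounds:
  fixes t :: real
  shows "0 \<le> (if t \<le> 0 then 0 else exp (- (1 / t)) * (1 + 1 / t))"
    and "(if t \<le> 0 then 0 else exp (- (1 / t)) * (1 + 1 / t)) \<le> 1"
proof -
  show "0 \<le> (if t \<le> 0 then 0 else exp (- (1 / t)) * (1 + 1 / t))" by simp
  have "exp (- (1 / t)) * (1 + 1 / t) \<le> exp (- (1 / t)) * exp (1 / t)"
    by (intro mult_left_mono exp_ge_add_one_self) auto
  then show "(if t \<le> 0 then 0 else exp (- (1 / t)) * (1 + 1 / t)) \<le> 1"
    by (simp add: mult_exp_exp)
qed

text \<open>By exp(-1/t) \<ge> 1 - 1/t the smooth truncation loses at most 1 in height.\<close>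

lemma t_flat_ge: "t - 1 \<le> t * flat t"
proof (cases "0 < t")
  case True
  have "t * (1 + - (1 / t)) \<le> t * exp (- (1 / t))"
    using True by (intro mult_left_mono exp_ge_add_one_self) auto
  moreover have "t * (1 + - (1 / t)) = t - 1"
    using True by (simp add: algebra_simps)
  ultimately have "t - 1 \<le> t * exp (- (1 / t))" by (simp only:)
  then show ?thesis using True by (simp add: flat_def)
qed (simp add: flat_def)

text \<open>\<open>t * flat t\<close> is a smooth substitute for \<open>max t 0\<close> with slope at most \<open>1\<close>, so this is a smooth
  truncation of \<open>ln (1 / (2 |x|\<^sup>2))\<close>, at height about \<open>n * ln 2\<close>.\<close>

definition log_bump :: "nat \<Rightarrow> complex \<Rightarrow> real" where
  "log_bump n x = (let u = - ln (2 * (Re x * Re x + Im x * Im x + 1 / 2 ^ n)) in u * flat u)"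

lemma C_k_log_bump: "C_k k (log_bump n)"
proof -
  have pos: "0 < 2 * (Re x * Re x + Im x * Im x + 1 / 2 ^ n)" for x :: complex
    by (auto intro!: add_nonneg_pos)
  have "C_k k (\<lambda>x. - ln (2 * (Re x * Re x + Im x * Im x + 1 / 2 ^ n)))" for k
    by (intro C_k_minus C_k_ln C_k_mult C_k_add C_k_const C_k_bounded_linear
        bounded_linear_Re bounded_linear_Im pos)
  then show ?thesis
    unfolding log_bump_def[abs_def] Let_def by (intro C_k_mult C_k_flat)
qed

lemma Re_Im_squares: "Re x * Re x + Im x * Im x = (norm x)\<^sup>2"
  using cmod_power2[of x] by (simp only: power2_eq_square)

lemma norm_le_sqrt_iff: "norm x \<le> sqrt y \<longleftrightarrow> (norm x)\<^sup>2 \<le> y"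
  using real_sqrt_le_iff[of "(norm x)\<^sup>2" y] unfolding real_sqrt_abs abs_norm_cancel by blast

lemma log_bump_eq_0: "1 / 2 \<le> (norm x)\<^sup>2 \<Longrightarrow> log_bump n x = 0"
proof -
  assume "1 / 2 \<le> (norm x)\<^sup>2"
  then have "1 / 2 \<le> (norm x)\<^sup>2 + 1 / 2 ^ n" by (rule add_increasing2[rotated]) simp
  then have "2 * (1 / 2) \<le> 2 * ((norm x)\<^sup>2 + 1 / 2 ^ n)" by (rule mult_left_mono) simp
  then have "1 \<le> 2 * ((norm x)\<^sup>2 + 1 / 2 ^ n)" by simp
  then have "1 \<le> 2 * (Re x * Re x + Im x * Im x + 1 / 2 ^ n)" by (simp only: Re_Im_squares)
  then have "- ln (2 * (Re x * Re x + Im x * Im x + 1 / 2 ^ n)) \<le> 0" by (simp add: ln_ge_zero)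
  then show ?thesis by (simp add: log_bump_def Let_def flat_eq_0_iff)
qed

lemma log_bump_test_function: "log_bump n \<in> test_functions (ball 0 1)"
proof (rule test_functionsI[where K = "cball 0 (3 / 4)"])
  show "log_bump n x = 0" if "x \<notin> cball 0 (3 / 4)" for x
  proof (rule log_bump_eq_0)
    have "(3 / 4)\<^sup>2 \<le> (norm x)\<^sup>2" using that by (intro power_mono) auto
    then show "1 / 2 \<le> (norm x)\<^sup>2" by (simp add: power2_eq_square)
  qed
qed (auto simp: C_k_log_bump)

lemma log_bump_ge:
  assumes "(norm x)\<^sup>2 \<le> 1 / 2 ^ n"
  shows "(real n - 2) * ln 2 - 1 \<le> log_bump n x"
proof -
  define u where "u = - ln (2 * (Re x * Re x + Im x * Im x + 1 / 2 ^ n))"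
  have pos: "0 < 2 * (Re x * Re x + Im x * Im x + 1 / 2 ^ n)"
    by (auto intro!: add_nonneg_pos)
  have "2 * (Re x * Re x + Im x * Im x + 1 / 2 ^ n) \<le> 4 / 2 ^ n"
    unfolding Re_Im_squares using assms by simp
  then have "ln (2 * (Re x * Re x + Im x * Im x + 1 / 2 ^ n)) \<le> ln (4 / 2 ^ n)"
    using pos by (intro ln_mono) auto
  also have "ln (4 / 2 ^ n) = 2 * ln 2 - real n * ln (2::real)"
    using ln_realpow[of "2::real" 2] by (simp add: ln_div ln_realpow)
  finally have "(real n - 2) * ln 2 \<le> u" by (simp add: u_def algebra_simps)
  then show ?thesis using t_flat_ge[of u] by (simp add: log_bump_def u_def Let_def)
qed

text \<open>As the truncation has slope at most 1, the gradient is dominated by that of ln(|x|^2 +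
  2^(-n)), whose length is 2|x|/(|x|^2 + 2^(-n)).\<close>

lemma norm_grad_log_bump_le:
  "(norm (grad (log_bump n) x))\<^sup>2 \<le> (if (norm x)\<^sup>2 \<le> 1 then 4 * (norm x)\<^sup>2 / ((norm x)\<^sup>2 + 1 / 2 ^ n)\<^sup>2 else 0)"
proof (cases "(norm x)\<^sup>2 \<le> 1")
  case False
  then have "x \<notin> ball 0 1" using power_mono[of "norm x" 1 2] by force
  then show ?thesis
    using False test_functions_zero_outside(2)[OF log_bump_test_function] by simp
next
  case True
  define \<epsilon> :: real where "\<epsilon> = 1 / 2 ^ n"
  define \<rho> where "\<rho> x = Re x * Re x + Im x * Im x" for x :: complex
  define u where "u x = - ln (2 * (\<rho> x + \<epsilon>))" for x
  define c where "c = (if u x \<le> 0 then 0 else exp (- (1 / u x)) * (1 + 1 / u x))"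
  have pos: "0 < \<rho> x + \<epsilon>" for x by (auto simp: \<rho>_def \<epsilon>_def intro!: add_nonneg_pos)
  have c: "0 \<le> c" "c \<le> 1" using t_flat_derivative_bounds[of "u x"] by (auto simp: c_def)
  have du: "(u has_derivative (\<lambda>v. - (2 * (Re x * Re v + Im x * Im v) / (\<rho> x + \<epsilon>)))) (at x)"
    unfolding u_def[abs_def] \<rho>_def
    using pos[of x, unfolded \<rho>_def] pos[of x, unfolded \<rho>_def]
    by (auto intro!: derivative_eq_intros simp: fun_eq_iff field_simps)
  have "((\<lambda>y. u y * flat (u y)) has_derivative (\<lambda>v. c * - (2 * (Re x * Re v + Im x * Im v) / (\<rho> x + \<epsilon>)))) (at x)"
    using has_derivative_compose[OF du t_flat_has_derivative[unfolded has_field_derivative_def]]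
    by (simp add: c_def)
  moreover have "(\<lambda>y. u y * flat (u y)) = log_bump n"
    by (simp add: log_bump_def[abs_def] u_def \<rho>_def \<epsilon>_def Let_def)
  ultimately have "frechet_derivative (log_bump n) (at x) = (\<lambda>v. c * - (2 * (Re x * Re v + Im x * Im v) / (\<rho> x + \<epsilon>)))"
    using frechet_derivative_at by metis
  then have "grad (log_bump n) x = (- (2 * c / (\<rho> x + \<epsilon>))) *\<^sub>R x"
    by (simp add: grad_def complex_eq_iff)
  then have "norm (grad (log_bump n) x) = c * (2 * norm x / (\<rho> x + \<epsilon>))"
    using c pos[of x] by simp
  also have "\<dots> \<le> 2 * norm x / (\<rho> x + \<epsilon>)"
    using c pos[of x] by (intro mult_left_le_one_le) auto
  finally have "(norm (grad (log_bump n) x))\<^sup>2 \<le> (2 * norm x / (\<rho> x + \<epsilon>))\<^sup>2"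
    by (intro power_mono) auto
  also have "\<rho> x = (norm x)\<^sup>2" unfolding \<rho>_def by (rule Re_Im_squares)
  finally show ?thesis using True by (simp add: \<epsilon>_def power_divide power_mult_distrib)
qed

section \<open>Gradient and function norms of the logarithmic bump\<close>

lemma dyadic_shell:
  fixes \<rho> :: real
  assumes "\<rho> \<le> 1"
  shows "\<rho> \<le> 1 / 2 ^ n \<or> (\<exists>j<n. 1 / 2 ^ Suc j < \<rho> \<and> \<rho> \<le> 1 / 2 ^ j)"
proof (induction n)
  case (Suc n)
  then show ?case
  proof
    assume "\<rho> \<le> 1 / 2 ^ n"
    then show ?thesis by (cases "\<rho> \<le> 1 / 2 ^ Suc n") (auto intro: exI[of _ n])
  qed (auto simp: less_Suc_eq)
qed (use assms in simp)

text \<open>A dyadic substitute for polar coordinates: on the shell 2^(-j-1) < \<rho> \<le> 2^(-j)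
  the left side is below 4/\<rho>, hence below 8 2^j. With \<rho> = |x|^2 the j-th disc has area pi
  2^(-j), so every summand integrates to 8 pi and the energy grows only linearly in n.\<close>

lemma dyadic_gradient_bound:
  fixes \<rho> :: real
  assumes "0 \<le> \<rho>" and "\<rho> \<le> 1"
  shows "4 * \<rho> / (\<rho> + 1 / 2 ^ n)\<^sup>2 \<le> (\<Sum>j\<le>n. 8 * 2 ^ j * of_bool (\<rho> \<le> 1 / 2 ^ j))"
proof -
  have e: "(0::real) < 1 / 2 ^ n" by simp
  then have pos: "0 < \<rho> + 1 / 2 ^ n" using assms by linarith
  have "4 * \<rho> / (\<rho> + 1 / 2 ^ n)\<^sup>2 \<le> 4 * (\<rho> + 1 / 2 ^ n) / (\<rho> + 1 / 2 ^ n)\<^sup>2"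
    by (intro divide_right_mono) auto
  also have "\<dots> = 4 / (\<rho> + 1 / 2 ^ n)"
    using pos unfolding power2_eq_square by (metis less_numeral_extra(3) mult_divide_mult_cancel_right)
  also have "\<dots> \<le> (\<Sum>j\<le>n. 8 * 2 ^ j * of_bool (\<rho> \<le> 1 / 2 ^ j))"
  proof -
    have single: "8 * 2 ^ j * of_bool (\<rho> \<le> 1 / 2 ^ j) \<le> (\<Sum>j\<le>n. 8 * 2 ^ j * of_bool (\<rho> \<le> 1 / 2 ^ j) :: real)"
      if "j \<le> n" for j
      using that by (intro member_le_sum) auto
    from dyadic_shell[OF assms(2), of n] show ?thesis
    proof
      assume le: "\<rho> \<le> 1 / 2 ^ n"
      have "4 / (\<rho> + 1 / 2 ^ n) \<le> 4 / (1 / 2 ^ n)"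
        using assms e pos by (intro divide_left_mono mult_pos_pos) auto
      also have "\<dots> \<le> 8 * 2 ^ n * of_bool (\<rho> \<le> 1 / 2 ^ n)" using le by simp
      finally show ?thesis using single[of n] by linarith
    next
      assume "\<exists>j<n. 1 / 2 ^ Suc j < \<rho> \<and> \<rho> \<le> 1 / 2 ^ j"
      then obtain j where j: "j < n" "1 / 2 ^ Suc j < \<rho>" "\<rho> \<le> 1 / 2 ^ j" by blast
      have "4 / (\<rho> + 1 / 2 ^ n) \<le> 4 / (1 / 2 ^ Suc j)"
      proof (intro divide_left_mono mult_pos_pos pos)
        show "1 / 2 ^ Suc j \<le> \<rho> + 1 / 2 ^ n"
          by (rule order_trans[OF less_imp_le[OF j(2)]]) simp
      qed auto
      also have "\<dots> = 8 * 2 ^ j * of_bool (\<rho> \<le> 1 / 2 ^ j)" using j by simp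
      finally show ?thesis using single[of j] j by linarith
    qed
  qed
  finally show ?thesis .
qed

lemma measure_lborel_disc: "0 \<le> r \<Longrightarrow> measure lborel (ball (0::complex) r) = pi * r\<^sup>2"
  and measure_lborel_cdisc: "0 \<le> r \<Longrightarrow> measure lborel (cball (0::complex) r) = pi * r\<^sup>2"
  using content_ball[of r "0::complex"] content_cball[of r "0::complex"]
  by (simp_all add: unit_ball_vol_2)

lemma integral_grad_log_bump_le:
  "(\<integral>x. norm (grad (log_bump n) x) powr 2 \<partial>lborel) \<le> 8 * pi * (real n + 1)"
proof -
  define S where "S x = (\<Sum>j\<le>n. 8 * 2 ^ j * indicat_real (cball 0 (sqrt (1 / 2 ^ j))) x)" for x :: complex
  have int: "integrable lborel (indicat_real (cball (0::complex) r))" for r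
    using emeasure_lborel_cball_finite[of "0::complex" r] by (intro integrable_real_indicator) auto
  have "(\<integral>x. norm (grad (log_bump n) x) powr 2 \<partial>lborel) \<le> (\<integral>x. S x \<partial>lborel)"
  proof (rule integral_mono)
    show "integrable lborel (\<lambda>x. norm (grad (log_bump n) x) powr 2)"
      by (rule integrable_powr_test_function(2)[OF log_bump_test_function]) simp
    show "integrable lborel S"
      unfolding S_def by (intro Bochner_Integration.integrable_sum integrable_mult_right int)
    fix x :: complex
    have mem: "indicat_real (cball 0 (sqrt (1 / 2 ^ j))) x = of_bool ((norm x)\<^sup>2 \<le> 1 / 2 ^ j)" for j :: nat
      by (auto simp: indicator_def norm_le_sqrt_iff simp del: real_sqrt_divide)
    have S0: "0 \<le> S x" unfolding S_def by (intro sum_nonneg) auto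
    have "norm (grad (log_bump n) x) powr 2 = (norm (grad (log_bump n) x))\<^sup>2"
      by (simp add: powr_numeral)
    also have "\<dots> \<le> S x"
      using norm_grad_log_bump_le[of n x] dyadic_gradient_bound[of "(norm x)\<^sup>2" n] S0
      unfolding S_def mem by (auto split: if_splits)
    finally show "norm (grad (log_bump n) x) powr 2 \<le> S x" .
  qed
  also have "(\<integral>x. S x \<partial>lborel) = (\<Sum>j\<le>n. 8 * 2 ^ j * measure lborel (cball (0::complex) (sqrt (1 / 2 ^ j))))"
    unfolding S_def by (subst Bochner_Integration.integral_sum) (use int in auto)
  also have "\<dots> = (\<Sum>j\<le>n. 8 * pi)"
    by (intro sum.cong) (simp_all add: measure_lborel_cdisc)
  finally show ?thesis by (simp add: algebra_simps)
qed

text \<open>Averaged norms increase from q to 2; undoing the normalisation on the unit disc, of area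
  pi, leaves the factor pi^(1/q - 1/2), which the powers of pi in \<open>M_const\<close>
  compensate.\<close>

lemma Lp_norm_grad_log_bump_le:
  assumes "0 < q" and "q \<le> 2"
  shows "Lp_norm q (ball 0 1) (grad (log_bump n)) \<le> pi powr (1 / q - 1 / 2) * sqrt (8 * pi * (real n + 1))"
proof -
  note \<phi> = log_bump_test_function[of n]
  have b: "open (ball (0::complex) 1)" "bounded (ball (0::complex) 1)" "ball (0::complex) 1 \<noteq> {}" by auto
  interpret test_function_on "ball 0 1" "log_bump n"
    using \<phi> measure_borel_bounded_open[OF b] by unfold_locales auto
  define J where "J q = (\<integral>x. norm (grad (log_bump n) x) powr q \<partial>lborel)" for q
  have J: "0 \<le> J q" for q by (simp add: J_def)
  have split: "(c / pi) powr (1 / 2) * pi powr (1 / q) = pi powr (1 / q - 1 / 2) * c powr (1 / 2)"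
    if "0 \<le> c" for c
    using that by (simp add: powr_divide powr_diff)
  have "(J q / pi) powr (1 / q) \<le> (J 2 / pi) powr (1 / 2)"
    using G_mono[OF assms] measure_lborel_disc[of 1] by (simp add: G_def avg_norm_def J_def)
  also have "\<dots> \<le> (8 * pi * (real n + 1) / pi) powr (1 / 2)"
    using integral_grad_log_bump_le[of n] J[of 2] unfolding J_def
    by (intro powr_mono2 divide_right_mono) auto
  finally have "(J q / pi) powr (1 / q) * pi powr (1 / q) \<le> (8 * pi * (real n + 1) / pi) powr (1 / 2) * pi powr (1 / q)"
    by (intro mult_right_mono) auto
  also have "\<dots> = pi powr (1 / q - 1 / 2) * (8 * pi * (real n + 1)) powr (1 / 2)"
    using split[of "8 * pi * (real n + 1)"] by simp
  also have "(J q / pi) powr (1 / q) * pi powr (1 / q) = J q powr (1 / q)"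
    using J[of q] by (simp add: powr_divide)
  finally show ?thesis
    using Lp_test_function(4)[OF \<phi> assms(1)] by (simp add: J_def powr_half_sqrt)
qed

lemma Lp_norm_log_bump_ge:
  assumes r: "0 < r" and n: "0 \<le> (real n - 2) * ln 2 - 1"
  shows "((real n - 2) * ln 2 - 1) * (pi / 2 ^ n) powr (1 / r) \<le> Lp_norm r (ball 0 1) (log_bump n)"
proof -
  note \<phi> = log_bump_test_function[of n]
  define L where "L = (real n - 2) * ln 2 - 1"
  define B where "B = cball (0::complex) (sqrt (1 / 2 ^ n))"
  have int: "integrable lborel (indicat_real B)"
    using emeasure_lborel_cball_finite[of "0::complex"] unfolding B_def
    by (intro integrable_real_indicator) auto
  have "L powr r * (pi / 2 ^ n) = (\<integral>x. L powr r * indicat_real B x \<partial>lborel)"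
    using int by (simp add: B_def measure_lborel_cdisc)
  also have "\<dots> \<le> (\<integral>x. \<bar>log_bump n x\<bar> powr r \<partial>lborel)"
  proof (rule integral_mono)
    show "integrable lborel (\<lambda>x. L powr r * indicat_real B x)" using int by simp
    show "integrable lborel (\<lambda>x. \<bar>log_bump n x\<bar> powr r)"
      by (rule integrable_powr_test_function(1)[OF \<phi> r])
    fix x :: complex
    show "L powr r * indicat_real B x \<le> \<bar>log_bump n x\<bar> powr r"
    proof (cases "x \<in> B")
      case True
      then have "(norm x)\<^sup>2 \<le> 1 / 2 ^ n"
        by (simp add: B_def norm_le_sqrt_iff del: real_sqrt_divide)
      then have "L \<le> \<bar>log_bump n x\<bar>" using log_bump_ge[of x n] by (simp add: L_def)
      then show ?thesis using True r n by (simp add: L_def powr_mono2)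
    qed simp
  qed
  finally have "(L powr r * (pi / 2 ^ n)) powr (1 / r) \<le> Lp_norm r (ball 0 1) (log_bump n)"
    unfolding Lp_test_function(3)[OF \<phi> r] using r by (intro powr_mono2) auto
  moreover have "(L powr r * c) powr (1 / r) = L * c powr (1 / r)" for c
    using r n by (simp add: L_def powr_mult powr_powr)
  ultimately show ?thesis by (simp only: L_def)
qed

section \<open>The constant of the theorem\<close>

text \<open>In \<open>nu\<close> the power of 10 is at least 10^8 and the factor with K at least 1,
  so the remaining fraction is below 10^(-8). This is what makes the exponent p \<alpha>/(\<alpha> -
  1) exceed 2 * 10^7.\<close>

lemma nu_less_1_imp:
  assumes K: "1 \<le> K" and \<alpha>: "1 < \<alpha>" and nu: "nu K \<alpha> < 1"
  shows "\<alpha> - 1 < 1 / 10 ^ 7"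
proof -
  have pi2: "1 \<le> pi\<^sup>2" using pi_ge_two by (simp add: one_le_power)
  have K2: "1 \<le> K\<^sup>2" using K by (simp add: one_le_power)
  have "1 \<le> 24 * pi\<^sup>2 * K\<^sup>2"
    using mult_mono[OF pi2 K2] by simp
  then have A: "1 \<le> (24 * pi\<^sup>2 * K\<^sup>2) powr (2 * \<alpha>)" using \<alpha> by (intro ge_one_powr_ge_zero) auto
  have "(10::real) powr 8 \<le> 10 powr (8 * \<alpha>)" using \<alpha> by (intro powr_mono) auto
  then have B: "(10::real) ^ 8 \<le> 10 powr (8 * \<alpha>)" by (simp add: powr_numeral)
  have r: "0 \<le> (2 * \<alpha> - 2) / (2 * \<alpha> - 1)" using \<alpha> by simp
  have "10 ^ 8 * ((2 * \<alpha> - 2) / (2 * \<alpha> - 1)) * 1 \<le> nu K \<alpha>"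
    unfolding nu_def using A B r by (intro mult_mono mult_nonneg_nonneg) auto
  then have "10 ^ 8 * ((2 * \<alpha> - 2) / (2 * \<alpha> - 1)) < 1" using nu by simp
  then show ?thesis using \<alpha> by (simp add: divide_simps)
qed

lemma nu_strict_mono:
  assumes K: "1 \<le> K" and "1 \<le> a" "a < b"
  shows "nu K a < nu K b"
proof -
  have pi2: "1 \<le> pi\<^sup>2" using pi_ge_two by (simp add: one_le_power)
  have K2: "1 \<le> K\<^sup>2" using K by (simp add: one_le_power)
  have c: "1 \<le> 24 * pi\<^sup>2 * K\<^sup>2"
    using mult_mono[OF pi2 K2] by simp
  have "(10::real) powr (8 * a) \<le> 10 powr (8 * b)" using assms by (intro powr_mono) auto
  moreover have "(2 * a - 2) / (2 * a - 1) < (2 * b - 2) / (2 * b - 1)"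
    using assms by (simp add: divide_simps algebra_simps)
  moreover have "0 \<le> (2 * a - 2) / (2 * a - 1)" using assms by simp
  ultimately have "10 powr (8 * a) * ((2 * a - 2) / (2 * a - 1)) < 10 powr (8 * b) * ((2 * b - 2) / (2 * b - 1))"
    by (intro mult_le_less_imp_less) auto
  moreover have "(24 * pi\<^sup>2 * K\<^sup>2) powr (2 * a) \<le> (24 * pi\<^sup>2 * K\<^sup>2) powr (2 * b)"
    using assms c by (intro powr_mono) auto
  moreover have "0 \<le> 10 powr (8 * a) * ((2 * a - 2) / (2 * a - 1))" using assms by simp
  moreover have "0 < (24 * pi\<^sup>2 * K\<^sup>2) powr (2 * a)" using K by simp
  ultimately show ?thesis
    unfolding nu_def by (rule mult_less_le_imp_less)
qed

lemma alpha_tilde: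
  assumes K: "1 \<le> K"
  shows "1 < alpha_tilde K" and "nu K (alpha_tilde K) = 1"
proof -
  have cont: "continuous_on {1..2} (nu K)"
    unfolding nu_def[abs_def] using K by (intro continuous_intros) auto
  have nu1: "nu K 1 = 0" by (simp add: nu_def)
  \<comment> \<open>Otherwise \<open>nu_less_1_imp\<close> at 2 would give 1 < 10^(-7).\<close>
  have "1 \<le> nu K 2"
    using nu_less_1_imp[OF K, of 2] by (cases "nu K 2 < 1") auto
  then obtain \<alpha> where \<alpha>: "1 \<le> \<alpha>" "\<alpha> \<le> 2" "nu K \<alpha> = 1"
    using IVT'[of "nu K" 1 1 2] cont nu1 by auto
  have "\<exists>!\<alpha>. 1 < \<alpha> \<and> nu K \<alpha> = 1"
  proof
    show "1 < \<alpha> \<and> nu K \<alpha> = 1" using \<alpha> nu1 by (cases "\<alpha> = 1") auto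
    fix \<beta> assume "1 < \<beta> \<and> nu K \<beta> = 1"
    then show "\<beta> = \<alpha>"
      using \<alpha> nu_strict_mono[OF K, of \<alpha> \<beta>] nu_strict_mono[OF K, of \<beta> \<alpha>] by linarith
  qed
  from theI'[OF this] show "1 < alpha_tilde K" "nu K (alpha_tilde K) = 1"
    by (simp_all add: alpha_tilde_def)
qed

lemma alpha_less_alpha_star:
  assumes K: "1 \<le> K" and \<alpha>: "1 < \<alpha>" "ereal \<alpha> < alpha_star K"
  shows "nu K \<alpha> < 1" and "\<alpha> - 1 < 1 / 10 ^ 7"
proof -
  have "\<alpha> < alpha_tilde K" using \<alpha> by (simp add: alpha_star_def)
  then show nu: "nu K \<alpha> < 1"
    using nu_strict_mono[OF K, of \<alpha> "alpha_tilde K"] alpha_tilde[OF K] \<alpha> by simp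
  show "\<alpha> - 1 < 1 / 10 ^ 7" by (rule nu_less_1_imp[OF K \<alpha>(1) nu])
qed

text \<open>\<open>C_const K \<alpha> powr (- 2)\<close> is at most 2 * 10^(-12), since squaring
  turns the root 1/(2 \<alpha>) into 1/\<alpha> and its base lies in (0, 2]. The other factors
  contribute at most 16.\<close>

lemma prefactor_le_1:
  assumes K: "1 \<le> K" and \<alpha>: "1 < \<alpha>" "nu K \<alpha> < 1" "\<alpha> - 1 < 1 / 10 ^ 7"
  shows "4 * pi / K\<^sup>2 * exp (- (K\<^sup>2 * pi\<^sup>2 * (2 + pi\<^sup>2)\<^sup>2 / (2 * ln 3))) * (pi powr (- 1 / \<alpha>) * C_const K \<alpha> powr (- 2)) \<le> 1"
proof -
  define Y where "Y = (2 * \<alpha> - 1) * (1 - nu K \<alpha>)"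
  have Y0: "0 < Y" using \<alpha> by (simp add: Y_def)
  have "0 \<le> nu K \<alpha>" using nu_strict_mono[OF K, of 1 \<alpha>] \<alpha> by (simp add: nu_def)
  then have "Y \<le> (2 * \<alpha> - 1) * 1" unfolding Y_def using \<alpha> by (intro mult_left_mono) auto
  also have "\<dots> \<le> 2" using \<alpha> by simp
  finally have Y2: "Y \<le> 2" .
  have "Y powr (1 / \<alpha>) \<le> 2 powr (1 / \<alpha>)" using Y0 Y2 \<alpha> by (intro powr_mono2) auto
  also have "\<dots> \<le> 2 powr 1" using \<alpha> by (intro powr_mono) auto
  finally have Y3: "Y powr (1 / \<alpha>) \<le> 2" by simp
  have "C_const K \<alpha> powr (- 2) = (10 ^ 6) powr (- 2) / (Y powr (1 / (2 * \<alpha>))) powr (- 2)"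
    unfolding C_const_def Y_def[symmetric] by (rule powr_divide)
  also have "\<dots> = Y powr (1 / \<alpha>) / 10 ^ 12"
    using Y0 \<alpha> by (simp add: powr_powr powr_minus divide_simps powr_numeral)
  finally have C: "C_const K \<alpha> powr (- 2) \<le> 2 / 10 ^ 12" using Y3 by (simp add: divide_right_mono)
  have p1: "pi powr (- 1 / \<alpha>) \<le> pi powr 0" using \<alpha> pi_ge_two by (intro powr_mono) auto
  have K2: "1 \<le> K\<^sup>2" using K by (simp add: one_le_power)
  have "4 * pi / K\<^sup>2 \<le> 4 * pi / 1" using K2 by (intro divide_left_mono) auto
  also have "\<dots> \<le> 16" using pi_less_4 by simp
  finally have a: "4 * pi / K\<^sup>2 \<le> 16" .
  have e: "exp (- (K\<^sup>2 * pi\<^sup>2 * (2 + pi\<^sup>2)\<^sup>2 / (2 * ln 3))) \<le> 1" by simp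
  have "4 * pi / K\<^sup>2 * exp (- (K\<^sup>2 * pi\<^sup>2 * (2 + pi\<^sup>2)\<^sup>2 / (2 * ln 3))) * (pi powr (- 1 / \<alpha>) * C_const K \<alpha> powr (- 2)) \<le>
      16 * 1 * (1 * (2 / 10 ^ 12))"
    using p1 by (intro mult_mono a e C) auto
  then show ?thesis by simp
qed

text \<open>Purely topological: a homeomorphism of the plane maps open sets to open sets and the
  closed disc to a compact set.\<close>

lemma quasidisc_open_bounded:
  assumes "quasidisc K \<Omega>"
  shows "open \<Omega>" and "bounded \<Omega>" and "\<Omega> \<noteq> {}"
proof -
  obtain \<psi> where qc: "quasiconformal K UNIV UNIV \<psi>" and \<Omega>: "\<Omega> = \<psi> ` ball 0 1"
    using assms by (auto simp: quasidisc_def)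
  obtain \<eta> where hom: "homeomorphism UNIV UNIV \<psi> \<eta>"
    using qc by (auto simp: quasiconformal_def)
  have "openin (top_of_set UNIV) (\<psi> ` ball 0 1)"
    using hom by (rule homeomorphism_imp_open_map) simp
  then show "open \<Omega>" by (simp add: \<Omega>)
  have "compact (\<psi> ` cball 0 1)"
    using hom by (intro compact_continuous_image) (auto simp: homeomorphism_def intro: continuous_on_subset)
  then show "bounded \<Omega>"
    unfolding \<Omega> by (rule bounded_subset[OF compact_imp_bounded]) auto
  show "\<Omega> \<noteq> {}" by (simp add: \<Omega>)
qed

lemma R_star_eq:
  assumes "0 < area \<Omega>"
  shows "R_star \<Omega> = sqrt (area \<Omega> / pi)"
proof -
  have disc: "area (ball 0 R) = pi * R\<^sup>2" if "0 < R" for R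
    using content_ball[of R "0::complex"] that by (simp add: area_def unit_ball_vol_2)
  show ?thesis
    unfolding R_star_def
  proof (rule the_equality)
    show "0 < sqrt (area \<Omega> / pi) \<and> area (ball 0 (sqrt (area \<Omega> / pi))) = area \<Omega>"
      using assms disc[of "sqrt (area \<Omega> / pi)"] by (simp del: real_sqrt_divide)
    fix R assume R: "0 < R \<and> area (ball 0 R) = area \<Omega>"
    then have "R\<^sup>2 = area \<Omega> / pi" using disc[of R] by (simp add: field_simps)
    then show "R = sqrt (area \<Omega> / pi)" using R by (metis less_imp_le real_sqrt_unique)
  qed
qed

text \<open>The height of \<open>log_bump n\<close> is of order n and its gradient norm of order
  sqrt n, so the quotient grows like sqrt n as long as (2^(-n))^(1/r) stays near 1. For n = 10^6 and
  r at least 2 * 10^7 that loss is at most 1/20.\<close>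

lemma sobolev_poincare_const_disc_ge:
  assumes r: "2 * 10 ^ 7 \<le> r" and q: "1 < q" "q \<le> 2" and qr: "(r / 2 - 1) * (q / (q - 1)) \<le> r"
  shows "81 / pi powr (1 / q - 1 / 2) \<le> sobolev_poincare_const r q (ball 0 1)"
proof -
  define n :: nat where "n = 10 ^ 6"
  define L where "L = (real n - 2) * ln 2 - 1"
  define S where "S = sqrt (8 * pi * (real n + 1))"
  define B where "B = pi powr (1 / q - 1 / 2) * S"
  have "0 < S" by (simp add: S_def)
  then have B: "0 < B" by (simp add: B_def)
  have "(10 ^ 6 - 2) * (2 / 3) \<le> (real n - 2) * ln 2"
    using ln2_ge_two_thirds unfolding n_def by (intro mult_mono) auto
  then have L: "666000 \<le> L" by (simp add: L_def)
  have "8 * pi * (real n + 1) \<le> 8 * 4 * (10 ^ 6 + 1)"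
    using pi_less_4 unfolding n_def by (intro mult_mono) auto
  \<comment> \<open>With this bound the comparison below is 81 * 5700 = 461700 against 666000 *
    19/20 = 632700.\<close>
  also have "\<dots> \<le> 5700\<^sup>2" by simp
  finally have S: "S \<le> 5700" unfolding S_def by (intro real_le_lsqrt) auto
  have "real n * ln 2 / r \<le> 10 ^ 6 * 1 / (2 * 10 ^ 7)"
    using r ln_2_less_1 unfolding n_def by (intro frac_le mult_mono) auto
  then have "19 / 20 \<le> 1 + - (real n * ln 2 / r)" by simp
  also have "\<dots> \<le> exp (- (real n * ln 2 / r))" by (rule exp_ge_add_one_self)
  also have "\<dots> = (1 / 2 ^ n) powr (1 / r)"
    by (simp add: powr_def ln_div ln_realpow)
  also have "\<dots> \<le> (pi / 2 ^ n) powr (1 / r)"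
    using r pi_ge_two by (intro powr_mono2 divide_right_mono) auto
  finally have "666000 * (19 / 20) \<le> L * (pi / 2 ^ n) powr (1 / r)"
    using L by (intro mult_mono) auto
  also have "\<dots> \<le> Lp_norm r (ball 0 1) (log_bump n)"
    using Lp_norm_log_bump_ge[of r n] r L by (simp add: L_def)
  finally have "81 * S \<le> Lp_norm r (ball 0 1) (log_bump n)" using S by simp
  then have "81 * S / B \<le> Lp_norm r (ball 0 1) (log_bump n) / B"
    using B by (intro divide_right_mono) auto
  also have "\<dots> \<le> sobolev_poincare_const r q (ball 0 1)"
  proof (rule sobolev_poincare_const_ge[OF _ _ _ _ q(1) qr log_bump_test_function])
    show "Lp_norm q (ball 0 1) (grad (log_bump n)) \<le> B"
      unfolding B_def S_def using q by (intro Lp_norm_grad_log_bump_le) auto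
  qed (use r B in auto)
  also have "81 * S / B = 81 / pi powr (1 / q - 1 / 2)"
    using \<open>0 < S\<close> by (simp add: B_def)
  finally show ?thesis .
qed

lemma M_const_le:
  assumes p: "2 < p" and K: "1 \<le> K"
  shows "M_const p K \<le> ereal (1 / 81 powr p)"
proof -
  define E where "E = exp (- (K\<^sup>2 * pi\<^sup>2 * (2 + pi\<^sup>2)\<^sup>2 / (2 * ln 3)))"
  define c where "c = 4 * pi powr (1 + p / 2) / K\<^sup>2 * E"
  have c: "0 < c" using K by (simp add: c_def E_def)
  have neg_power: "(81 / pi powr y) powr (- p) = 1 / 81 powr p * pi powr (y * p)" for y
    by (simp add: powr_divide powr_powr powr_minus_divide)
  have term_le: "sobolev_poincare_const (p * \<alpha> / (\<alpha> - 1)) q (ball 0 1) powr (- p) *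
      pi powr (- (p / q) - 1 / \<alpha>) * C_const K \<alpha> powr (- 2) \<le> 1 / 81 powr p / c"
    if \<alpha>: "1 < \<alpha>" "ereal \<alpha> < alpha_star K" and q: "q_star p \<alpha> < q" "q \<le> 2" for \<alpha> q
  proof -
    note \<alpha>' = alpha_less_alpha_star[OF K \<alpha>]
    define r where "r = p * \<alpha> / (\<alpha> - 1)"
    define A where "A = sobolev_poincare_const r q (ball 0 1)"
    define F where "F = pi powr (- 1 / \<alpha>) * C_const K \<alpha> powr (- 2)"
    have r\<alpha>: "r * (\<alpha> - 1) = p * \<alpha>" using \<alpha> by (simp add: r_def)
    have "2 * 1 / (1 / 10 ^ 7) \<le> r"
      unfolding r_def using p \<alpha> \<alpha>' by (intro frac_le mult_mono) auto
    then have r: "2 * 10 ^ 7 \<le> r" by simp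
    have den: "0 < \<alpha> * p + 2 * (\<alpha> - 1)" using p \<alpha> by (simp add: add_pos_pos)
    \<comment> \<open>\<open>q_star p \<alpha>\<close> equals 2r/(r + 2), so the condition on q
      reads 2r < q (r + 2). For q < 2 this is r < 2q/(2 - q); in all cases it implies the exponent
      condition of \<open>sobolev\<close>, and for such large r it forces q > 1.\<close>
    have "2 * \<alpha> * p < q * (\<alpha> * p + 2 * (\<alpha> - 1))"
      using q(1) den by (simp add: q_star_def divide_less_eq)
    also have "\<dots> = q * (r + 2) * (\<alpha> - 1)"
      using r\<alpha> by (simp add: algebra_simps)
    also have "2 * \<alpha> * p = 2 * r * (\<alpha> - 1)"
      using r\<alpha> by (simp add: algebra_simps)
    finally have qr: "2 * r < q * (r + 2)" using \<alpha> by simp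
    have q1: "1 < q"
    proof (rule ccontr)
      assume "\<not> 1 < q"
      then have "q * (r + 2) \<le> 1 * (r + 2)" using r by (intro mult_right_mono) auto
      with qr have "2 * r < 1 * (r + 2)" by (rule less_le_trans)
      then show False using r by simp
    qed
    have "(r / 2 - 1) * (q / (q - 1)) \<le> r"
      using q1 qr by (simp add: divide_simps algebra_simps)
    from sobolev_poincare_const_disc_ge[OF r q1 q(2) this]
    have "A powr (- p) \<le> (81 / pi powr (1 / q - 1 / 2)) powr (- p)"
      unfolding A_def using p by (intro powr_mono2') auto
    also have "\<dots> = 1 / 81 powr p * pi powr ((1 / q - 1 / 2) * p)"
      by (rule neg_power)
    finally have "A powr (- p) * (pi powr (1 + p / 2) * pi powr (- (p / q) - 1 / \<alpha>)) \<le>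
        1 / 81 powr p * pi powr ((1 / q - 1 / 2) * p) * (pi powr (1 + p / 2) * pi powr (- (p / q) - 1 / \<alpha>))"
      by (intro mult_right_mono) auto
    \<comment> \<open>All exponents of pi that contain p cancel; what remains, pi^(1 - 1/\<alpha>),
      goes into \<open>prefactor_le_1\<close>.\<close>
    also have "\<dots> = 1 / 81 powr p * (pi * pi powr (- 1 / \<alpha>))"
    proof -
      have "pi powr ((1 / q - 1 / 2) * p) * (pi powr (1 + p / 2) * pi powr (- (p / q) - 1 / \<alpha>)) =
          pi powr ((1 / q - 1 / 2) * p + (1 + p / 2 + (- (p / q) - 1 / \<alpha>)))"
        by (simp only: powr_add)
      also have "(1 / q - 1 / 2) * p + (1 + p / 2 + (- (p / q) - 1 / \<alpha>)) = 1 + - 1 / \<alpha>"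
        by (simp add: algebra_simps)
      also have "pi powr (1 + - 1 / \<alpha>) = pi * pi powr (- 1 / \<alpha>)"
        by (simp only: powr_add powr_one[OF pi_ge_zero])
      finally show ?thesis by (simp only: mult.assoc)
    qed
    finally have "4 / K\<^sup>2 * E * C_const K \<alpha> powr (- 2) *
          (A powr (- p) * (pi powr (1 + p / 2) * pi powr (- (p / q) - 1 / \<alpha>))) \<le>
        4 / K\<^sup>2 * E * C_const K \<alpha> powr (- 2) * (1 / 81 powr p * (pi * pi powr (- 1 / \<alpha>)))"
      using K by (intro mult_left_mono) (auto simp: E_def)
    also have "\<dots> = 1 / 81 powr p * (4 * pi / K\<^sup>2 * E * F)"
      by (simp add: F_def mult_ac)
    also have "\<dots> \<le> 1 / 81 powr p * 1"
      using prefactor_le_1[OF K \<alpha>(1) \<alpha>'] unfolding E_def F_def by (intro mult_left_mono) auto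
    finally have "c * (A powr (- p) * pi powr (- (p / q) - 1 / \<alpha>) * C_const K \<alpha> powr (- 2)) \<le> 1 / 81 powr p"
      by (simp add: c_def mult_ac)
    then show ?thesis
      using c by (simp add: pos_le_divide_eq mult_ac A_def r_def)
  qed
  \<comment> \<open>Since c is positive, it is enough to bound each member of the suprema by
    81^(-p)/c.\<close>
  have "M_const p K \<le> ereal c * ereal (1 / 81 powr p / c)"
    unfolding M_const_def c_def[unfolded E_def, symmetric]
    using c term_le by (intro ereal_mult_left_mono SUP_least) auto
  then show ?thesis using c by simp
qed

theorem theorem1p2:
  fixes p K :: real and \<Omega> :: "complex set"
  assumes "2 < p" and "1 \<le> K" and "quasidisc K \<Omega>"
  shows "ereal (lambda_p p \<Omega>) \<ge> M_const p K / ereal (area \<Omega> powr (p / 2)) \<and>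
         M_const p K / ereal (area \<Omega> powr (p / 2)) = M_star_const p K / ereal (R_star \<Omega> powr p)"
proof
  note \<Omega> = quasidisc_open_bounded[OF assms(3)]
  have a: "0 < area \<Omega>" using measure_borel_bounded_open[OF \<Omega>] by (simp add: area_def)
  then have ap: "0 < area \<Omega> powr (p / 2)" by simp
  have "M_const p K / ereal (area \<Omega> powr (p / 2)) \<le> ereal (1 / 81 powr p) / ereal (area \<Omega> powr (p / 2))"
    using M_const_le[OF assms(1,2)] ap by (intro ereal_divide_right_mono) auto
  also have "\<dots> = ereal (1 / (81 powr p * area \<Omega> powr (p / 2)))" using ap by simp
  also have "\<dots> \<le> ereal (lambda_p p \<Omega>)"
    using lambda_p_ge[OF \<Omega> assms(1)] by (simp add: area_def)
  finally show "ereal (lambda_p p \<Omega>) \<ge> M_const p K / ereal (area \<Omega> powr (p / 2))" .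
  have R: "R_star \<Omega> powr p = area \<Omega> powr (p / 2) * pi powr (- (p / 2))"
  proof -
    have "R_star \<Omega> powr p = ((area \<Omega> / pi) powr (1 / 2)) powr p"
      using a by (simp add: R_star_eq powr_half_sqrt)
    also have "\<dots> = (area \<Omega> / pi) powr (p / 2)" by (simp add: powr_powr)
    also have "\<dots> = area \<Omega> powr (p / 2) * pi powr (- (p / 2))"
      by (simp add: powr_divide powr_minus_divide)
    finally show ?thesis .
  qed
  show "M_const p K / ereal (area \<Omega> powr (p / 2)) = M_star_const p K / ereal (R_star \<Omega> powr p)"
    unfolding M_star_const_def R
    \<comment> \<open>The case split also covers infinite values in \<open>ereal\<close>; the
      factors of area and pi are positive, so they cancel in the finite case and preserve the
      infinite ones.\<close>
    using ap by (cases "M_const p K") (auto simp: field_simps)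
qed


end
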